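(* Let $h$ be sufficiently small such that $\mathcal K_{\hat{\mathbf z},h}=\mathcal K_{\hat{\mathbf z}}$ holds and such that the discrete inf-sup property (I) below holds. Let $(\mathbf u,\lambda)$ be the unique solution of the continuous problem (P) and $(\mathbf u_h,\lambda_h)$ the unique solution of the discrete problem (P$_h$). Then $$\|\mathbf u-\mathbf u_h\|_1\le c_1\min_{\mathbf v_h\in\mathbf V_h}\|\mathbf u-\mathbf v_h\|_1+c_2\min_{\mu_h\in V_h}\|\lambda-\mu_h\|_1,$$ with $c_1=\big(1+\tfrac1\gamma\|a\|\big)\big(1+\tfrac1\beta\|b\|\big)$ and $c_2=\tfrac1\gamma\|b\|$, where $\gamma>0$ and $\beta>0$ (independent of $h$) are the constants in the following two properties: (E) $a(\mathbf v_h,\mathbf v_h)\ge\gamma\|\mathbf v_h\|_1^2$ for all $\mathbf v_h\in\mathbf V_{h,\ast}\cap\ker_h(b)$; (I) $\displaystyle\sup_{\mathbf v_h\in\mathbf V_{h,\ast}}\frac{b(\lambda_h,\mathbf v_h)}{\|\mathbf v_h\|_1}\ge\beta\|\lambda_h\|_1$ for all $\lambda_h\in V_h$.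
   Context: Let $d\in\{2,3\}$ and let $\Omega\subset\mathbb R^d$ be a bounded connected open polygonal (polyhedral) domain with Lipschitz boundary. $\mathbf H^1(\Omega)=H^1(\Omega)^d$; $(\cdot,\cdot)_1$ and $\|\cdot\|_1$ are the standard $H^1$ inner product and norm (for scalar and vector functions: $L^2$ inner product of the functions plus that of their gradients). Let $\mathbf z=z\hat{\mathbf z}$ with $z\in H^{1,\infty}(\Omega)$ and $\hat{\mathbf z}\in H^{1,\infty}(\Omega)^d$, $\|\hat{\mathbf z}\|=1$ (Euclidean norm) a.e. on $\Omega$; moreover $\hat{\mathbf z}\in H^{k+1,\infty}(\Omega)^d$, with $k$ as below. Set $\mathbf E(\mathbf v)=\nabla\mathbf v+\nabla\mathbf v^T$, $a(\mathbf u,\mathbf v)=\int_\Omega\mathbf E(\mathbf u):\mathbf E(\mathbf v)\,d\mathbf x$ for $\mathbf u,\mathbf v\in\mathbf H^1(\Omega)$, and $b(\lambda,\mathbf v)=(\lambda,\mathbf v\cdot\hat{\mathbf z})_1$ for $\lambda\in H^1(\Omega)$, $\mathbf v\in\mathbf H^1(\Omega)$. $\|a\|,\|b\|$ denote the norms of these bounded bilinear forms with respect to $\|\cdot\|_1$. Let $K=\{\mathbf v\in\mathbf H^1(\Omega): a(\mathbf v,\mathbf v)=0\}$ (rigid motions) and $\mathcal K_{\hat{\mathbf z}}=\{\mathbf v\in K:\mathbf v\cdot\hat{\mathbf z}=0\text{ a.e. on }\Omega\}$. For a closed subspace $W\subset\mathbf H^1(\Omega)$, $Q_W$ is the $(\cdot,\cdot)_1$-orthogonal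 projection onto $W$. Let $\{\mathcal T_h\}_{h>0}$ be a shape regular (not necessarily quasi-uniform) family of simplicial triangulations of $\Omega$ ($h$ is the mesh size), $V_h$ the space of continuous piecewise polynomials of degree $k\ge1$ on $\mathcal T_h$, $\mathbf V_h=V_h^d$. Set $\ker_h(b)=\{\mathbf v_h\in\mathbf V_h: b(\lambda_h,\mathbf v_h)=0\ \forall\lambda_h\in V_h\}$, $\mathcal K_{\hat{\mathbf z},h}=\ker_h(b)\cap K$, and $\mathbf V_{h,\ast}=\{\mathbf v_h\in\mathbf V_h: Q_{\mathcal K_{\hat{\mathbf z},h}}\mathbf v_h=0\}$. Problem (P): find $(\mathbf u,\lambda)\in\mathbf H^1(\Omega)\times H^1(\Omega)$ with $Q_{\mathcal K_{\hat{\mathbf z}}}\mathbf u=Q_{\mathcal K_{\hat{\mathbf z}}}\mathbf z$ such that $a(\mathbf u,\mathbf v)+b(\lambda,\mathbf v)=0$ for all $\mathbf v\in\mathbf H^1(\Omega)$ and $b(\mu,\mathbf u)=b(\mu,\mathbf z)$ for all $\mu\in H^1(\Omega)$. Problem (P$_h$): find $(\mathbf u_h,\lambda_h)\in\mathbf V_h\times V_h$ with $Q_{\mathcal K_{\hat{\mathbf z},h}}\mathbf u_h=Q_{\mathcal K_{\hat{\mathbf z},h}}\mathbf z$ such that $a(\mathbf u_h,\mathbf v_h)+b(\lambda_h,\mathbf v_h)=0$ for all $\mathbf v_h\in\mathbf V_h$ and $b(\mu_h,\mathbf u_h)=b(\mu_h,\mathbf z)$ for all $\mu_h\in V_h$.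 *)

theory Defs
  imports "HOL-Analysis.Analysis"
begin

text \<open>
  Elements of a Lebesgue or Sobolev space over \<open>\<Omega>\<close> are represented by functions on the whole
  type \<open>real ^ 'n\<close> of which only the values on \<open>\<Omega>\<close>, up to null sets, matter. All spaces below are
  closed under changing a function on a null subset of \<open>\<Omega>\<close> or outside \<open>\<Omega>\<close>, so that equality of
  such sets is equality of the corresponding sets of equivalence classes; equality of elements is
  written \<open>AE x in lebesgue_on \<Omega>. _\<close>. Scalar and vector fields are treated uniformly as functions
  into a Euclidean space.
\<close>

section \<open>Weak derivatives and Sobolev spaces\<close>

definition pdiff :: "'n::finite \<Rightarrow> (real ^ 'n \<Rightarrow> real) \<Rightarrow> (real ^ 'n \<Rightarrow> real)" where
  "pdiff i f = (\<lambda>x. frechet_derivative f (at x) (axis i 1))"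

text \<open>A multi-index is given as the list of the coordinate directions to differentiate in.\<close>

definition pdiffs :: "'n::finite list \<Rightarrow> (real ^ 'n \<Rightarrow> real) \<Rightarrow> (real ^ 'n \<Rightarrow> real)" where
  "pdiffs \<alpha> f = foldr pdiff \<alpha> f"

definition test_functions :: "(real ^ 'n::finite) set \<Rightarrow> (real ^ 'n \<Rightarrow> real) set" where
  "test_functions \<Omega> =
     {\<phi>. (\<forall>\<alpha> x. pdiffs \<alpha> \<phi> differentiable (at x)) \<and>
         (\<exists>C. compact C \<and> C \<subseteq> \<Omega> \<and> (\<forall>x. x \<notin> C \<longrightarrow> \<phi> x = 0))}"

definition locally_integrable ::
  "(real ^ 'n::finite) set \<Rightarrow> (real ^ 'n \<Rightarrow> 'b::euclidean_space) \<Rightarrow> bool" where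
  "locally_integrable \<Omega> f \<longleftrightarrow>
     (\<forall>C. compact C \<and> C \<subseteq> \<Omega> \<longrightarrow> f absolutely_integrable_on C)"

definition is_weak_deriv ::
  "(real ^ 'n::finite) set \<Rightarrow> 'n list \<Rightarrow> (real ^ 'n \<Rightarrow> 'b::euclidean_space) \<Rightarrow>
    (real ^ 'n \<Rightarrow> 'b) \<Rightarrow> bool" where
  "is_weak_deriv \<Omega> \<alpha> f g \<longleftrightarrow>
     locally_integrable \<Omega> f \<and> locally_integrable \<Omega> g \<and>
     (\<forall>\<phi>\<in>test_functions \<Omega>.
        (LINT x|lebesgue_on \<Omega>. pdiffs \<alpha> \<phi> x *\<^sub>R f x) =
        (-1) ^ length \<alpha> *\<^sub>R (LINT x|lebesgue_on \<Omega>. \<phi> x *\<^sub>R g x))"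

definition L2_space :: "(real ^ 'n::finite) set \<Rightarrow> (real ^ 'n \<Rightarrow> 'b::euclidean_space) set" where
  "L2_space \<Omega> =
     {f \<in> borel_measurable (lebesgue_on \<Omega>). integrable (lebesgue_on \<Omega>) (\<lambda>x. (norm (f x))\<^sup>2)}"

definition Linf_space :: "(real ^ 'n::finite) set \<Rightarrow> (real ^ 'n \<Rightarrow> 'b::euclidean_space) set" where
  "Linf_space \<Omega> =
     {f \<in> borel_measurable (lebesgue_on \<Omega>). \<exists>C. AE x in lebesgue_on \<Omega>. norm (f x) \<le> C}"

text \<open>Functions in \<open>X\<close> (an \<open>L\<^sup>p\<close> space) all of whose weak derivatives of order at most \<open>m\<close>
  exist and are in \<open>X\<close>.\<close>

definition sobolev ::
  "(real ^ 'n::finite) set \<Rightarrow> nat \<Rightarrow> (real ^ 'n \<Rightarrow> 'b::euclidean_space) set \<Rightarrow>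
    (real ^ 'n \<Rightarrow> 'b) set" where
  "sobolev \<Omega> m X = {f \<in> X. \<forall>\<alpha>. length \<alpha> \<le> m \<longrightarrow> (\<exists>g\<in>X. is_weak_deriv \<Omega> \<alpha> f g)}"

definition H1 :: "(real ^ 'n::finite) set \<Rightarrow> (real ^ 'n \<Rightarrow> 'b::euclidean_space) set" where
  "H1 \<Omega> = sobolev \<Omega> 1 (L2_space \<Omega>)"

definition Hinf ::
  "(real ^ 'n::finite) set \<Rightarrow> nat \<Rightarrow> (real ^ 'n \<Rightarrow> 'b::euclidean_space) set" where
  "Hinf \<Omega> m = sobolev \<Omega> m (Linf_space \<Omega>)"

definition weak_pd ::
  "(real ^ 'n::finite) set \<Rightarrow> 'n \<Rightarrow> (real ^ 'n \<Rightarrow> 'b::euclidean_space) \<Rightarrow> (real ^ 'n \<Rightarrow> 'b)" where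
  "weak_pd \<Omega> i f = (SOME g. is_weak_deriv \<Omega> [i] f g)"

definition h1_inner ::
  "(real ^ 'n::finite) set \<Rightarrow> (real ^ 'n \<Rightarrow> 'b::euclidean_space) \<Rightarrow> (real ^ 'n \<Rightarrow> 'b) \<Rightarrow> real" where
  "h1_inner \<Omega> u v =
     (LINT x|lebesgue_on \<Omega>. u x \<bullet> v x) +
     (\<Sum>i\<in>UNIV. LINT x|lebesgue_on \<Omega>. weak_pd \<Omega> i u x \<bullet> weak_pd \<Omega> i v x)"

definition h1_norm ::
  "(real ^ 'n::finite) set \<Rightarrow> (real ^ 'n \<Rightarrow> 'b::euclidean_space) \<Rightarrow> real" where
  "h1_norm \<Omega> u = sqrt (h1_inner \<Omega> u u)"

text \<open>A representative of the orthogonal projection of \<open>v\<close> onto the subspace \<open>W\<close>; it is determined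
  only up to null sets.\<close>

definition h1_proj ::
  "(real ^ 'n::finite) set \<Rightarrow> (real ^ 'n \<Rightarrow> 'b::euclidean_space) set \<Rightarrow> (real ^ 'n \<Rightarrow> 'b) \<Rightarrow>
    (real ^ 'n \<Rightarrow> 'b)" where
  "h1_proj \<Omega> W v = (SOME w. w \<in> W \<and> (\<forall>w'\<in>W. h1_inner \<Omega> (\<lambda>x. v x - w x) w' = 0))"

definition form_norm ::
  "(real ^ 'n::finite) set \<Rightarrow>
    ((real ^ 'n \<Rightarrow> 'b::euclidean_space) \<Rightarrow> (real ^ 'n \<Rightarrow> 'c::euclidean_space) \<Rightarrow> real) \<Rightarrow> real" where
  "form_norm \<Omega> B =
     Sup {\<bar>B p q\<bar> | p q. p \<in> H1 \<Omega> \<and> q \<in> H1 \<Omega> \<and> h1_norm \<Omega> p \<le> 1 \<and> h1_norm \<Omega> q \<le> 1}"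

section \<open>Domain and triangulations\<close>

text \<open>Near every boundary point, \<open>\<Omega>\<close> is the part above the graph of a Lipschitz function over the
  hyperplane orthogonal to some unit vector \<open>e\<close>.\<close>

definition lipschitz_boundary :: "(real ^ 'n::finite) set \<Rightarrow> bool" where
  "lipschitz_boundary \<Omega> \<longleftrightarrow>
     (\<forall>p\<in>frontier \<Omega>. \<exists>e r L g. norm e = 1 \<and> r > 0 \<and> L-lipschitz_on {y. y \<bullet> e = 0} g \<and>
        \<Omega> \<inter> ball p r = {x \<in> ball p r. g (x - (x \<bullet> e) *\<^sub>R e) < x \<bullet> e})"

definition polyhedral_lipschitz_domain :: "(real ^ 'n::finite) set \<Rightarrow> bool" where
  "polyhedral_lipschitz_domain \<Omega> \<longleftrightarrow>
     \<Omega> \<noteq> {} \<and> open \<Omega> \<and> connected \<Omega> \<and> bounded \<Omega> \<and>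
     (\<exists>P. finite P \<and> (\<forall>p\<in>P. polytope p) \<and> closure \<Omega> = \<Union>P) \<and>
     lipschitz_boundary \<Omega>"

definition triangulation_of :: "(real ^ 'n::finite) set \<Rightarrow> (real ^ 'n) set set \<Rightarrow> bool" where
  "triangulation_of \<Omega> \<T> \<longleftrightarrow>
     triangulation \<T> \<and> (\<forall>t\<in>\<T>. int CARD('n) simplex t) \<and> \<Union>\<T> = closure \<Omega>"

definition inradius :: "(real ^ 'n::finite) set \<Rightarrow> real" where
  "inradius t = Sup {r. \<exists>x. ball x r \<subseteq> t}"

text \<open>The family is indexed by its set \<open>H\<close> of mesh sizes (on a bounded domain not every
  \<open>h > 0\<close> is the mesh size of a triangulation).\<close>

definition shape_regular_family ::
  "(real ^ 'n::finite) set \<Rightarrow> real set \<Rightarrow> (real \<Rightarrow> (real ^ 'n) set set) \<Rightarrow> bool" where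
  "shape_regular_family \<Omega> H T \<longleftrightarrow>
     H \<subseteq> {0<..} \<and>
     (\<forall>h\<in>H. triangulation_of \<Omega> (T h) \<and> h = Max (diameter ` T h)) \<and>
     (\<exists>\<sigma>. \<forall>h\<in>H. \<forall>t\<in>T h. diameter t \<le> \<sigma> * inradius t)"

section \<open>Finite element spaces\<close>

definition poly_of_degree :: "nat \<Rightarrow> (real ^ 'n::finite \<Rightarrow> real) \<Rightarrow> bool" where
  "poly_of_degree k p \<longleftrightarrow>
     (\<exists>c :: ('n \<Rightarrow> nat) \<Rightarrow> real. \<forall>x.
        p x = (\<Sum>\<alpha> | (\<Sum>i\<in>UNIV. \<alpha> i) \<le> k. c \<alpha> * (\<Prod>i\<in>UNIV. (x $ i) ^ \<alpha> i)))"

definition Vh ::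
  "(real ^ 'n::finite) set \<Rightarrow> nat \<Rightarrow> (real ^ 'n) set set \<Rightarrow> (real ^ 'n \<Rightarrow> real) set" where
  "Vh \<Omega> k \<T> =
     {v. \<exists>w. continuous_on (closure \<Omega>) w \<and>
             (\<forall>t\<in>\<T>. \<exists>p. poly_of_degree k p \<and> (\<forall>x\<in>t. w x = p x)) \<and>
             (AE x in lebesgue_on \<Omega>. v x = w x)}"

definition VVh ::
  "(real ^ 'n::finite) set \<Rightarrow> nat \<Rightarrow> (real ^ 'n) set set \<Rightarrow> (real ^ 'n \<Rightarrow> real ^ 'n) set" where
  "VVh \<Omega> k \<T> = {v. \<forall>i. (\<lambda>x. v x $ i) \<in> Vh \<Omega> k \<T>}"

section \<open>Forms, kernels and problems\<close>

definition E_op ::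
  "(real ^ 'n::finite) set \<Rightarrow> (real ^ 'n \<Rightarrow> real ^ 'n) \<Rightarrow> (real ^ 'n \<Rightarrow> real ^ 'n ^ 'n)" where
  "E_op \<Omega> v x = (\<chi> i j. weak_pd \<Omega> j v x $ i + weak_pd \<Omega> i v x $ j)"

text \<open>The inner product of matrices is the Frobenius product.\<close>

definition a_form ::
  "(real ^ 'n::finite) set \<Rightarrow> (real ^ 'n \<Rightarrow> real ^ 'n) \<Rightarrow> (real ^ 'n \<Rightarrow> real ^ 'n) \<Rightarrow> real" where
  "a_form \<Omega> u v = (LINT x|lebesgue_on \<Omega>. E_op \<Omega> u x \<bullet> E_op \<Omega> v x)"

definition b_form ::
  "(real ^ 'n::finite) set \<Rightarrow> (real ^ 'n \<Rightarrow> real ^ 'n) \<Rightarrow>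
    (real ^ 'n \<Rightarrow> real) \<Rightarrow> (real ^ 'n \<Rightarrow> real ^ 'n) \<Rightarrow> real" where
  "b_form \<Omega> zh \<mu> v = h1_inner \<Omega> \<mu> (\<lambda>x. v x \<bullet> zh x)"

definition rigid :: "(real ^ 'n::finite) set \<Rightarrow> (real ^ 'n \<Rightarrow> real ^ 'n) set" where
  "rigid \<Omega> = {v \<in> H1 \<Omega>. a_form \<Omega> v v = 0}"

definition Kz ::
  "(real ^ 'n::finite) set \<Rightarrow> (real ^ 'n \<Rightarrow> real ^ 'n) \<Rightarrow> (real ^ 'n \<Rightarrow> real ^ 'n) set" where
  "Kz \<Omega> zh = {v \<in> rigid \<Omega>. AE x in lebesgue_on \<Omega>. v x \<bullet> zh x = 0}"

definition ker_bh ::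
  "(real ^ 'n::finite) set \<Rightarrow> (real ^ 'n \<Rightarrow> real ^ 'n) \<Rightarrow> nat \<Rightarrow> (real ^ 'n) set set \<Rightarrow>
    (real ^ 'n \<Rightarrow> real ^ 'n) set" where
  "ker_bh \<Omega> zh k \<T> = {v \<in> VVh \<Omega> k \<T>. \<forall>\<mu>\<in>Vh \<Omega> k \<T>. b_form \<Omega> zh \<mu> v = 0}"

definition Kzh ::
  "(real ^ 'n::finite) set \<Rightarrow> (real ^ 'n \<Rightarrow> real ^ 'n) \<Rightarrow> nat \<Rightarrow> (real ^ 'n) set set \<Rightarrow>
    (real ^ 'n \<Rightarrow> real ^ 'n) set" where
  "Kzh \<Omega> zh k \<T> = ker_bh \<Omega> zh k \<T> \<inter> rigid \<Omega>"

definition VVh_star ::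
  "(real ^ 'n::finite) set \<Rightarrow> (real ^ 'n \<Rightarrow> real ^ 'n) \<Rightarrow> nat \<Rightarrow> (real ^ 'n) set set \<Rightarrow>
    (real ^ 'n \<Rightarrow> real ^ 'n) set" where
  "VVh_star \<Omega> zh k \<T> =
     {v \<in> VVh \<Omega> k \<T>. AE x in lebesgue_on \<Omega>. h1_proj \<Omega> (Kzh \<Omega> zh k \<T>) v x = 0}"

definition solves_P ::
  "(real ^ 'n::finite) set \<Rightarrow> (real ^ 'n \<Rightarrow> real ^ 'n) \<Rightarrow> (real ^ 'n \<Rightarrow> real ^ 'n) \<Rightarrow>
    (real ^ 'n \<Rightarrow> real ^ 'n) \<Rightarrow> (real ^ 'n \<Rightarrow> real) \<Rightarrow> bool" where
  "solves_P \<Omega> zh zz u lam \<longleftrightarrow>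
     u \<in> H1 \<Omega> \<and> lam \<in> H1 \<Omega> \<and>
     (AE x in lebesgue_on \<Omega>. h1_proj \<Omega> (Kz \<Omega> zh) u x = h1_proj \<Omega> (Kz \<Omega> zh) zz x) \<and>
     (\<forall>v\<in>H1 \<Omega>. a_form \<Omega> u v + b_form \<Omega> zh lam v = 0) \<and>
     (\<forall>\<mu>\<in>H1 \<Omega>. b_form \<Omega> zh \<mu> u = b_form \<Omega> zh \<mu> zz)"

definition solves_Ph ::
  "(real ^ 'n::finite) set \<Rightarrow> (real ^ 'n \<Rightarrow> real ^ 'n) \<Rightarrow> (real ^ 'n \<Rightarrow> real ^ 'n) \<Rightarrow> nat \<Rightarrow>
    (real ^ 'n) set set \<Rightarrow> (real ^ 'n \<Rightarrow> real ^ 'n) \<Rightarrow> (real ^ 'n \<Rightarrow> real) \<Rightarrow> bool" where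
  "solves_Ph \<Omega> zh zz k \<T> uh lamh \<longleftrightarrow>
     uh \<in> VVh \<Omega> k \<T> \<and> lamh \<in> Vh \<Omega> k \<T> \<and>
     (AE x in lebesgue_on \<Omega>.
        h1_proj \<Omega> (Kzh \<Omega> zh k \<T>) uh x = h1_proj \<Omega> (Kzh \<Omega> zh k \<T>) zz x) \<and>
     (\<forall>v\<in>VVh \<Omega> k \<T>. a_form \<Omega> uh v + b_form \<Omega> zh lamh v = 0) \<and>
     (\<forall>\<mu>\<in>Vh \<Omega> k \<T>. b_form \<Omega> zh \<mu> uh = b_form \<Omega> zh \<mu> zz)"

definition coercive_h ::
  "(real ^ 'n::finite) set \<Rightarrow> (real ^ 'n \<Rightarrow> real ^ 'n) \<Rightarrow> nat \<Rightarrow> (real ^ 'n) set set \<Rightarrow>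
    real \<Rightarrow> bool" where
  "coercive_h \<Omega> zh k \<T> \<gamma> \<longleftrightarrow>
     (\<forall>v \<in> VVh_star \<Omega> zh k \<T> \<inter> ker_bh \<Omega> zh k \<T>. a_form \<Omega> v v \<ge> \<gamma> * (h1_norm \<Omega> v)\<^sup>2)"

text \<open>Functions of norm zero contribute the quotient \<open>0 / 0 = 0\<close> to the supremum, which is
  harmless since the remaining quotients are closed under negation.\<close>

definition inf_sup_h ::
  "(real ^ 'n::finite) set \<Rightarrow> (real ^ 'n \<Rightarrow> real ^ 'n) \<Rightarrow> nat \<Rightarrow> (real ^ 'n) set set \<Rightarrow>
    real \<Rightarrow> bool" where
  "inf_sup_h \<Omega> zh k \<T> \<beta> \<longleftrightarrow>
     (\<forall>\<mu> \<in> Vh \<Omega> k \<T>.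
        (SUP v \<in> VVh_star \<Omega> zh k \<T>. b_form \<Omega> zh \<mu> v / h1_norm \<Omega> v) \<ge> \<beta> * h1_norm \<Omega> \<mu>)"

end

theory Submission
  imports Defs "HOL-Library.Function_Algebras"
begin

text \<open>
  The estimate is Cea's argument for a saddle point problem whose primal form is coercive only on
  the discrete kernel of the constraint and only modulo rigid motions. Let \<open>v\<close> and \<open>\<mu>\<close> be
  arbitrary elements of the two discrete spaces and \<open>K\<close> the rigid motions in the discrete kernel. The
  inf-sup condition yields a correction \<open>w\<close> that is bounded by \<open>\<parallel>b\<parallel> / \<beta> * \<parallel>u - v\<parallel>\<close> and gives
  \<open>v + w\<close> the constraint values of \<open>u\<close>, which are those of \<open>u\<^sub>h\<close> (\<open>inf_sup_lift\<close>). Hence \<open>v + w - u\<^sub>h\<close> is in the discrete kernel of \<open>b\<close>. Its part orthogonal to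
  \<open>K\<close> is estimated by coercivity and the two Galerkin equations, in which \<open>\<mu>\<close> may replace the
  discrete multiplier because \<open>b\<close> vanishes there. Its part in \<open>K\<close> is harmless: since \<open>u - u\<^sub>h\<close> is
  orthogonal to \<open>K\<close>, this part is minus the \<open>K\<close>-component of \<open>u - v - w\<close>, and adding it to
  \<open>u - v - w\<close> does not lengthen that vector. This is \<open>quasi_optimality\<close>, a statement about
  semi-inner products; minimisers exist because the discrete spaces have finite dimension modulo null
  functions.

  What remains is to see that the concrete forms and spaces satisfy the hypotheses of the abstract
  statement.
  \<^item> The \<open>H\<^sup>1\<close> inner product is bilinear because weak derivatives are unique up to null sets
    (\<open>weak_deriv_unique\<close>).
  \<^item> The form \<open>b\<close> is bilinear and bounded because \<open>v \<mapsto> v \<bullet> zh\<close> maps \<open>H\<^sup>1\<close> boundedly into itself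
    (\<open>inner_multiplier_bounded\<close>), which follows from the product rule \<open>weak_deriv_product\<close> for a factor with
    bounded weak derivatives.
  \<^item> The finite element functions are in \<open>H\<^sup>1\<close> (\<open>w_H1\<close> in the locale \<open>piecewise_smooth\<close>).

  The first two rest on one approximation result, \<open>kernel_approximation\<close>: the double integral of
  \<open>f x * g y * \<eta> (y - x)\<close> tends to the integral of \<open>f x * g x\<close> as the support of the mollifier \<open>\<eta>\<close>
  shrinks to the origin, because translation is continuous in \<open>L\<^sup>1\<close>. Under the double
  integral, weak derivatives can be tested in each variable separately: the kernel \<open>\<eta> (y - x)\<close> is a
  test function in \<open>y\<close> for \<open>x\<close> in a fixed compact set, and a test function in \<open>x\<close> after
  multiplication by one. The third is obtained from difference quotients: those
  of a test function times a piecewise polynomial are bounded, have integral zero, and converge off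
  the boundaries of the simplices.
\<close>

section \<open>Abstract saddle point problems\<close>

text \<open>
  Functions form a vector space pointwise, so subspaces and spans of the library apply directly to
  sets of representatives of Sobolev functions.
\<close>

instantiation "fun" :: (type, real_vector) real_vector
begin

definition scaleR_fun :: "real \<Rightarrow> ('a \<Rightarrow> 'b) \<Rightarrow> 'a \<Rightarrow> 'b" where
  "c *\<^sub>R f = (\<lambda>x. c *\<^sub>R f x)"

instance
  by standard (auto simp: scaleR_fun_def fun_eq_iff scaleR_add_right scaleR_add_left)

end

text \<open>
  The form is only positive semidefinite: on representatives of Sobolev functions, the null vectors of
  the \<open>H\<^sup>1\<close> inner product are the functions that vanish almost everywhere.
\<close>

locale semi_inner =
  fixes X :: "'v::real_vector set" and s :: "'v \<Rightarrow> 'v \<Rightarrow> real"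
  assumes subspace_X: "subspace X"
    and s_add: "x \<in> X \<Longrightarrow> y \<in> X \<Longrightarrow> z \<in> X \<Longrightarrow> s (x + y) z = s x z + s y z"
    and s_scale: "x \<in> X \<Longrightarrow> z \<in> X \<Longrightarrow> s (c *\<^sub>R x) z = c * s x z"
    and s_sym: "x \<in> X \<Longrightarrow> y \<in> X \<Longrightarrow> s x y = s y x"
    and s_nonneg: "x \<in> X \<Longrightarrow> 0 \<le> s x x"
begin

definition nrm :: "'v \<Rightarrow> real" where
  "nrm x = sqrt (s x x)"

lemma X_closed [simp]:
  "0 \<in> X" "x \<in> X \<Longrightarrow> y \<in> X \<Longrightarrow> x + y \<in> X" "x \<in> X \<Longrightarrow> y \<in> X \<Longrightarrow> x - y \<in> X"
  "x \<in> X \<Longrightarrow> c *\<^sub>R x \<in> X"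
  using subspace_X by (auto simp: subspace_0 subspace_add subspace_diff subspace_scale)

lemma s_add_right: "x \<in> X \<Longrightarrow> y \<in> X \<Longrightarrow> z \<in> X \<Longrightarrow> s z (x + y) = s z x + s z y"
  using s_add s_sym by (metis X_closed(2))

lemma s_scale_right: "x \<in> X \<Longrightarrow> z \<in> X \<Longrightarrow> s z (c *\<^sub>R x) = c * s z x"
  using s_scale s_sym by (metis X_closed(4))

lemma s_diff: "x \<in> X \<Longrightarrow> y \<in> X \<Longrightarrow> z \<in> X \<Longrightarrow> s (x - y) z = s x z - s y z"
  using s_add[of "x - y" y z] by simp

lemma s_diff_right: "x \<in> X \<Longrightarrow> y \<in> X \<Longrightarrow> z \<in> X \<Longrightarrow> s z (x - y) = s z x - s z y"
  using s_add_right[of "x - y" y z] by simp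

lemmas s_bilinear = s_add s_add_right s_scale s_scale_right s_diff s_diff_right

lemma nrm_nonneg [simp]: "x \<in> X \<Longrightarrow> 0 \<le> nrm x"
  by (simp add: nrm_def s_nonneg)

lemma nrm_sq: "x \<in> X \<Longrightarrow> (nrm x)\<^sup>2 = s x x"
  by (simp add: nrm_def s_nonneg)

lemma nrm_scale: "x \<in> X \<Longrightarrow> nrm (c *\<^sub>R x) = \<bar>c\<bar> * nrm x"
  by (simp add: nrm_def s_bilinear real_sqrt_mult flip: mult.assoc)

lemma cauchy_schwarz:
  assumes x: "x \<in> X" and y: "y \<in> X"
  shows "\<bar>s x y\<bar> \<le> nrm x * nrm y"
proof -
  have expand: "0 \<le> s x x + 2 * c * s x y + c\<^sup>2 * s y y" for c
  proof -
    have "s (x + c *\<^sub>R y) (x + c *\<^sub>R y) = s x x + 2 * c * s x y + c\<^sup>2 * s y y"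
      using x y by (simp add: s_bilinear s_sym[OF y x] power2_eq_square algebra_simps)
    then show ?thesis using s_nonneg[of "x + c *\<^sub>R y"] x y by simp
  qed
  have "(s x y)\<^sup>2 \<le> s x x * s y y"
  proof (cases "s y y = 0")
    case True
    have "s x y = 0"
    proof (rule ccontr)
      assume "s x y \<noteq> 0"
      then show False
        using expand[of "- (s x x + 1) / (2 * s x y)"] True by (simp add: field_simps)
    qed
    then show ?thesis using True by simp
  next
    case False
    then have pos: "s y y > 0" using s_nonneg[OF y] by simp
    have "0 \<le> s x x - (s x y)\<^sup>2 / s y y"
      using expand[of "- s x y / s y y"] pos by (simp add: field_simps power2_eq_square)
    then show ?thesis using pos by (simp add: field_simps)
  qed
  then have "\<bar>s x y\<bar> \<le> sqrt (s x x * s y y)"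
    by (metis real_sqrt_abs real_sqrt_le_iff)
  then show ?thesis by (simp add: nrm_def real_sqrt_mult)
qed

lemma nrm_add_sq: "x \<in> X \<Longrightarrow> y \<in> X \<Longrightarrow> (nrm (x + y))\<^sup>2 = (nrm x)\<^sup>2 + 2 * s x y + (nrm y)\<^sup>2"
  by (simp add: nrm_sq s_bilinear s_sym[of y x])

lemma nrm_triangle:
  assumes x: "x \<in> X" and y: "y \<in> X"
  shows "nrm (x + y) \<le> nrm x + nrm y"
proof (rule power2_le_imp_le)
  have "(nrm (x + y))\<^sup>2 = (nrm x)\<^sup>2 + 2 * s x y + (nrm y)\<^sup>2"
    using x y by (rule nrm_add_sq)
  also have "\<dots> \<le> (nrm x + nrm y)\<^sup>2"
    using cauchy_schwarz[OF x y] by (simp add: power2_sum)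
  finally show "(nrm (x + y))\<^sup>2 \<le> (nrm x + nrm y)\<^sup>2" .
qed (use x y in simp)

lemma nrm_minus: "x \<in> X \<Longrightarrow> nrm (- x) = nrm x"
  using nrm_scale[of x "-1"] by simp

text \<open>
  Gram-Schmidt, one vector at a time. The new vector \<open>b\<close> is replaced by its residual \<open>r\<close>, which is
  orthogonal to the previous span. If \<open>r\<close> is null, then \<open>F r = 0\<close> and the previous representative
  still works; otherwise the coefficient of \<open>r\<close> has to be \<open>F r / s r r\<close>.
\<close>

lemma riesz_span:
  assumes "finite B" "B \<subseteq> X"
    and "\<And>x y. x \<in> span B \<Longrightarrow> y \<in> span B \<Longrightarrow> F (x + y) = F x + F y"
    and "\<And>c x. x \<in> span B \<Longrightarrow> F (c *\<^sub>R x) = c * F x"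
    and "\<And>x. x \<in> span B \<Longrightarrow> s x x = 0 \<Longrightarrow> F x = (0::real)"
  shows "\<exists>w\<in>span B. \<forall>v\<in>span B. s w v = F v"
  using assms
proof (induction B arbitrary: F rule: finite_induct)
  case empty
  then show ?case using s_scale[of 0 0 0] by simp
next
  case (insert b B)
  have mono: "x \<in> span B \<Longrightarrow> x \<in> span (insert b B)" for x
    using span_mono[of B "insert b B"] by auto
  have inX: "span (insert b B) \<subseteq> X"
    using insert.prems(1) subspace_X by (rule span_minimal)
  have bX: "b \<in> X" using insert.prems(1) by simp
  have BX: "span B \<subseteq> X" using inX mono by auto
  obtain w0 where w0: "w0 \<in> span B" "\<And>v. v \<in> span B \<Longrightarrow> s w0 v = F v"
    using insert.IH[of F] insert.prems mono by (metis insert_subset)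
  have "\<exists>w\<in>span B. \<forall>v\<in>span B. s w v = s b v"
  proof (rule insert.IH)
    show "s b x = 0" if "x \<in> span B" "s x x = 0" for x
      using cauchy_schwarz[OF bX, of x] that BX by (auto simp: nrm_def)
  qed (use BX bX insert.prems in \<open>auto simp: s_bilinear subset_iff\<close>)
  then obtain p where p: "p \<in> span B" "\<And>v. v \<in> span B \<Longrightarrow> s p v = s b v" by blast
  define r where "r = b - p"
  have pX: "p \<in> X" and rX: "r \<in> X" and w0X: "w0 \<in> X" using p w0 BX bX by (auto simp: r_def)
  have r_span: "r \<in> span (insert b B)"
    unfolding r_def by (intro span_diff mono p span_base) simp
  have r_orth: "s r v = 0" if "v \<in> span B" for v
    using that p BX bX pX by (auto simp: r_def s_bilinear subset_iff)
  define c where "c = (if s r r = 0 then 0 else F r / s r r)"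
  have c: "c * s r r = F r"
    using insert.prems(4)[OF r_span] by (simp add: c_def)
  define w where "w = w0 + c *\<^sub>R r"
  have "s w v = F v" if v: "v \<in> span (insert b B)" for v
  proof -
    obtain k where k: "v - k *\<^sub>R b \<in> span B" using v by (auto simp: span_insert)
    define v' where "v' = (v - k *\<^sub>R b) + k *\<^sub>R p"
    have v': "v' \<in> span B" unfolding v'_def by (intro span_add k span_scale p)
    have v_eq: "v = v' + k *\<^sub>R r" by (simp add: v'_def r_def algebra_simps)
    have v'X: "v' \<in> X" using v' BX by auto
    have "F v = F v' + k * F r"
      unfolding v_eq using insert.prems(2,3) mono[OF v'] r_span span_scale by metis
    moreover have "s w v = s w0 v' + c * s r v' + k * (s w0 r + c * s r r)"
      unfolding w_def v_eq using w0X rX v'X by (simp add: s_bilinear algebra_simps)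
    moreover have "s w0 r = 0" using r_orth[OF w0(1)] s_sym[OF w0X rX] by simp
    ultimately show ?thesis using w0(2)[OF v'] r_orth[OF v'] c by simp
  qed
  moreover have "w \<in> span (insert b B)"
    unfolding w_def by (intro span_add mono w0 span_scale r_span)
  ultimately show ?case by blast
qed

end

text \<open>
  The set \<open>B\<close> may lie outside \<open>V\<close>: the natural spanning set for continuous piecewise polynomials
  consists of discontinuous functions, namely monomials cut off to single simplices.
\<close>

definition finite_dim_mod :: "'v::real_vector set \<Rightarrow> 'v set \<Rightarrow> bool" where
  "finite_dim_mod N V \<longleftrightarrow> (\<exists>B. finite B \<and> (\<forall>v\<in>V. \<exists>b\<in>span B. v - b \<in> N))"

lemma finite_dim_mod_subset: "finite_dim_mod N V \<Longrightarrow> W \<subseteq> V \<Longrightarrow> finite_dim_mod N W"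
  unfolding finite_dim_mod_def by blast

context semi_inner
begin

text \<open>
  A basis of \<open>V \<inter> span B\<close> spans \<open>V\<close> up to null vectors, and null vectors change neither side of the
  representation: the form by the Cauchy-Schwarz inequality, \<open>F\<close> by assumption.
\<close>

lemma riesz:
  assumes V: "subspace V" "V \<subseteq> X" and fin: "finite_dim_mod N V"
    and N: "N \<subseteq> V" "\<And>n. n \<in> N \<Longrightarrow> s n n = 0"
    and add: "\<And>x y. x \<in> V \<Longrightarrow> y \<in> V \<Longrightarrow> F (x + y) = F x + F y"
    and scale: "\<And>c x. x \<in> V \<Longrightarrow> F (c *\<^sub>R x) = c * F x"
    and null: "\<And>x. x \<in> V \<Longrightarrow> s x x = 0 \<Longrightarrow> F x = (0::real)"
  shows "\<exists>w\<in>V. \<forall>v\<in>V. s w v = F v"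
proof -
  obtain B0 where B0: "finite B0" "\<forall>v\<in>V. \<exists>b\<in>span B0. v - b \<in> N"
    using fin unfolding finite_dim_mod_def by (elim exE conjE)
  obtain B where B: "B \<subseteq> V \<inter> span B0" "independent B" "V \<inter> span B0 \<subseteq> span B"
    using basis_exists[of "V \<inter> span B0"] by metis
  have "finite B" using independent_span_bound[OF B0(1) B(2)] B(1) by auto
  have BV: "span B \<subseteq> V" using B(1) V(1) by (intro span_minimal) auto
  have "\<exists>w\<in>span B. \<forall>v\<in>span B. s w v = F v"
    by (rule riesz_span) (use \<open>finite B\<close> B(1) V(2) subsetD[OF BV] add scale null in auto)
  then obtain w where w: "w \<in> span B" "\<And>v. v \<in> span B \<Longrightarrow> s w v = F v" by blast
  have "s w v = F v" if v: "v \<in> V" for v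
  proof -
    obtain b where b: "b \<in> span B0" "v - b \<in> N" using bspec[OF B0(2) v] ..
    have "b = v - (v - b)" by simp
    then have "b \<in> V" using v b(2) N(1) V(1) by (metis subspace_diff subsetD)
    then have bB: "b \<in> span B" using b B(3) by auto
    have "s (v - b) (v - b) = 0" "F (v - b) = 0"
      using N b null by auto
    then have "s w (v - b) = 0"
      using cauchy_schwarz[of w "v - b"] w(1) BV V N b by (auto simp: nrm_def subset_iff)
    then have "s w v = s w b" "F v = F b"
      using s_add_right[of b "v - b" w] add[of b "v - b"] \<open>b \<in> V\<close> w(1) BV V N b \<open>F (v - b) = 0\<close>
      by (auto simp: subset_iff)
    then show ?thesis using w(2)[OF bB] by simp
  qed
  then show ?thesis using w(1) BV by blast
qed

lemma projection_exists:
  assumes V: "subspace V" "V \<subseteq> X" and fin: "finite_dim_mod N V"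
    and N: "N \<subseteq> V" "\<And>n. n \<in> N \<Longrightarrow> s n n = 0" and u: "u \<in> X"
  shows "\<exists>w\<in>V. \<forall>v\<in>V. s (u - w) v = 0"
proof -
  have "\<exists>w\<in>V. \<forall>v\<in>V. s w v = s u v"
  proof (rule riesz[OF V fin N])
    show "s u x = 0" if "x \<in> V" "s x x = 0" for x
      using cauchy_schwarz[OF u, of x] that V by (auto simp: nrm_def)
  qed (use V u in \<open>auto simp: s_bilinear subset_iff\<close>)
  then obtain w where w: "w \<in> V" "\<forall>v\<in>V. s w v = s u v" ..
  have "s (u - w) v = 0" if v: "v \<in> V" for v
  proof -
    have "w \<in> X" "v \<in> X" using V(2) w(1) v by auto
    then have "s (u - w) v = s u v - s w v" by (rule s_diff[OF u])
    also have "s w v = s u v" using w(2) v by (rule bspec)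
    finally show ?thesis by simp
  qed
  with w(1) show ?thesis by blast
qed

lemma projection_is_best:
  assumes V: "subspace V" "V \<subseteq> X" and u: "u \<in> X" and w: "w \<in> V"
    and orth: "\<And>v. v \<in> V \<Longrightarrow> s (u - w) v = 0" and v: "v \<in> V"
  shows "nrm (u - w) \<le> nrm (u - v)"
proof (rule power2_le_imp_le)
  have wv: "w - v \<in> V" using V w v by (simp add: subspace_diff)
  have X: "u - w \<in> X" "w - v \<in> X" "u - v \<in> X" using V u w v wv by auto
  have "(nrm (u - v))\<^sup>2 = (nrm (u - w))\<^sup>2 + 2 * s (u - w) (w - v) + (nrm (w - v))\<^sup>2"
    using nrm_add_sq[OF X(1,2)] by simp
  then show "(nrm (u - w))\<^sup>2 \<le> (nrm (u - v))\<^sup>2"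
    using orth[OF wv] by simp
  show "0 \<le> nrm (u - v)" using X by simp
qed

lemma best_approximation_exists:
  assumes V: "subspace V" "V \<subseteq> X" and fin: "finite_dim_mod N V"
    and N: "N \<subseteq> V" "\<And>n. n \<in> N \<Longrightarrow> s n n = 0" and u: "u \<in> X"
  shows "\<exists>w\<in>V. \<forall>v\<in>V. nrm (u - w) \<le> nrm (u - v)"
proof -
  obtain w where w: "w \<in> V" "\<And>v. v \<in> V \<Longrightarrow> s (u - w) v = 0"
    using projection_exists[OF assms] by auto
  then have "\<forall>v\<in>V. nrm (u - w) \<le> nrm (u - v)"
    by (intro ballI projection_is_best[OF V u])
  with w(1) show ?thesis by (rule bexI[rotated])
qed

end

locale saddle_point_forms =
  X: semi_inner X sX + Y: semi_inner Y sY
  for X :: "'v::real_vector set" and sX and Y :: "'w::real_vector set" and sY +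
  fixes a :: "'v \<Rightarrow> 'v \<Rightarrow> real" and b :: "'w \<Rightarrow> 'v \<Rightarrow> real" and Ca Cb :: real
  assumes a_add: "x \<in> X \<Longrightarrow> y \<in> X \<Longrightarrow> z \<in> X \<Longrightarrow> a (x + y) z = a x z + a y z"
    and a_scale: "x \<in> X \<Longrightarrow> z \<in> X \<Longrightarrow> a (c *\<^sub>R x) z = c * a x z"
    and b_add: "p \<in> Y \<Longrightarrow> q \<in> Y \<Longrightarrow> x \<in> X \<Longrightarrow> b (p + q) x = b p x + b q x"
    and b_scale: "p \<in> Y \<Longrightarrow> x \<in> X \<Longrightarrow> b (c *\<^sub>R p) x = c * b p x"
    and b_add_right: "p \<in> Y \<Longrightarrow> x \<in> X \<Longrightarrow> y \<in> X \<Longrightarrow> b p (x + y) = b p x + b p y"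
    and b_scale_right: "p \<in> Y \<Longrightarrow> x \<in> X \<Longrightarrow> b p (c *\<^sub>R x) = c * b p x"
    and a_bound: "x \<in> X \<Longrightarrow> y \<in> X \<Longrightarrow> \<bar>a x y\<bar> \<le> Ca * X.nrm x * X.nrm y"
    and b_bound: "p \<in> Y \<Longrightarrow> x \<in> X \<Longrightarrow> \<bar>b p x\<bar> \<le> Cb * Y.nrm p * X.nrm x"
    and Ca_nonneg: "0 \<le> Ca" and Cb_nonneg: "0 \<le> Cb"
begin

lemma a_diff: "x \<in> X \<Longrightarrow> y \<in> X \<Longrightarrow> z \<in> X \<Longrightarrow> a (x - y) z = a x z - a y z"
  using a_add[of "x - y" y z] by simp

lemma b_diff: "p \<in> Y \<Longrightarrow> q \<in> Y \<Longrightarrow> x \<in> X \<Longrightarrow> b (p - q) x = b p x - b q x"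
  using b_add[of "p - q" q x] by simp

lemma b_diff_right: "p \<in> Y \<Longrightarrow> x \<in> X \<Longrightarrow> y \<in> X \<Longrightarrow> b p (x - y) = b p x - b p y"
  using b_add_right[of p "x - y" y] by simp

text \<open>
  Let \<open>R p\<close> represent \<open>b p\<close> on \<open>V\<close>. By the inf-sup condition \<open>\<beta> * nrm p \<le> nrm (R p)\<close>, so with respect
  to the semi-inner product \<open>t p q = (R p, R q)\<close> on \<open>M\<close> the functional \<open>q \<mapsto> b q x\<close> kills all null
  vectors and is represented by some \<open>p\<close>. Then \<open>w = R p\<close> satisfies
  \<open>b q w = (R q, R p) = b q x\<close>, and \<open>(nrm w)\<^sup>2 = b p x \<le> Cb * nrm p * nrm x \<le> Cb / \<beta> * nrm w * nrm x\<close>.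
  In the hypothesis \<open>inf_sup\<close> the supremum of \<open>b p v / nrm v\<close> is replaced by its upper bounds \<open>C\<close>,
  which avoids the quotient at vectors of norm zero.
\<close>

lemma inf_sup_lift:
  assumes V: "subspace V" "V \<subseteq> X" "finite_dim_mod NX V"
    and NX: "NX \<subseteq> V" "\<And>n. n \<in> NX \<Longrightarrow> sX n n = 0"
    and M: "subspace M" "M \<subseteq> Y" "finite_dim_mod NY M"
    and NY: "NY \<subseteq> M" "\<And>n. n \<in> NY \<Longrightarrow> sY n n = 0"
    and \<beta>: "\<beta> > 0"
    and inf_sup: "\<And>p C. p \<in> M \<Longrightarrow> 0 \<le> C \<Longrightarrow> (\<And>v. v \<in> V \<Longrightarrow> b p v \<le> C * X.nrm v) \<Longrightarrow> \<beta> * Y.nrm p \<le> C"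
    and x: "x \<in> X"
  shows "\<exists>w\<in>V. (\<forall>p\<in>M. b p w = b p x) \<and> X.nrm w \<le> Cb / \<beta> * X.nrm x"
proof -
  have YM: "p \<in> M \<Longrightarrow> p \<in> Y" and XV: "v \<in> V \<Longrightarrow> v \<in> X" for p v using M V by auto
  have "\<exists>w\<in>V. \<forall>v\<in>V. sX w v = b p v" if p: "p \<in> M" for p
  proof (rule X.riesz[OF V NX])
    show "b p v = 0" if "v \<in> V" "sX v v = 0" for v
      using b_bound[of p v] that p YM XV by (auto simp: X.nrm_def)
  qed (use p YM XV in \<open>auto simp: b_add_right b_scale_right\<close>)
  then obtain R where R: "\<And>p. p \<in> M \<Longrightarrow> R p \<in> V" "\<And>p v. p \<in> M \<Longrightarrow> v \<in> V \<Longrightarrow> sX (R p) v = b p v"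
    by metis
  have R_lower: "\<beta> * Y.nrm p \<le> X.nrm (R p)" if p: "p \<in> M" for p
  proof (rule inf_sup[OF p])
    show "0 \<le> X.nrm (R p)" using R p XV by simp
    show "b p v \<le> X.nrm (R p) * X.nrm v" if "v \<in> V" for v
      using X.cauchy_schwarz[of "R p" v] R p that XV by auto
  qed
  define t where "t p q = sX (R p) (R q)" for p q
  have t_b: "t p q = b p (R q)" if "p \<in> M" "q \<in> M" for p q
    using R that by (simp add: t_def)
  interpret T: semi_inner M t
  proof
    show "subspace M" by (fact M)
    show "t p q = t q p" if "p \<in> M" "q \<in> M" for p q
      unfolding t_def using R that XV by (intro X.s_sym) auto
    show "0 \<le> t p p" if "p \<in> M" for p
      unfolding t_def using R that XV by (intro X.s_nonneg) auto
    show "t (p + q) r = t p r + t q r" if "p \<in> M" "q \<in> M" "r \<in> M" for p q r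
      using that R YM XV M(1) by (simp add: t_b subspace_add b_add)
    show "t (c *\<^sub>R p) r = c * t p r" if "p \<in> M" "r \<in> M" for c p r
      using that R YM XV M(1) by (simp add: t_b subspace_scale b_scale)
  qed
  have null: "Y.nrm p = 0" if "p \<in> M" "t p p = 0" for p
  proof -
    have "\<beta> * Y.nrm p \<le> 0" using R_lower[of p] that by (simp add: t_def X.nrm_def)
    then have "Y.nrm p \<le> 0" using \<beta> by (simp add: mult_le_0_iff)
    then show ?thesis using Y.nrm_nonneg[OF YM[OF that(1)]] by simp
  qed
  have "\<exists>p\<in>M. \<forall>q\<in>M. t p q = b q x"
  proof (rule T.riesz)
    show "t n n = 0" if n: "n \<in> NY" for n
    proof -
      have nM: "n \<in> M" using n NY by auto
      have "\<bar>b n (R n)\<bar> \<le> 0"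
        using b_bound[of n "R n"] nM YM XV R NY(2)[OF n] by (simp add: Y.nrm_def)
      then show ?thesis using t_b nM by simp
    qed
    show "b q x = 0" if "q \<in> M" "t q q = 0" for q
      using b_bound[of q x] null[OF that] that YM x by simp
  qed (use M NY YM x in \<open>auto simp: b_add b_scale\<close>)
  then obtain p where p: "p \<in> M" "\<And>q. q \<in> M \<Longrightarrow> t p q = b q x" by blast
  have w: "b q (R p) = b q x" if "q \<in> M" for q
    using p(2)[OF that] t_b[OF that p(1)] T.s_sym[OF that p(1)] by simp
  have RpX: "R p \<in> X" using R p XV by auto
  have "(X.nrm (R p))\<^sup>2 = b p x"
    using p RpX by (simp add: X.nrm_sq flip: t_def)
  also have "\<dots> \<le> Cb * Y.nrm p * X.nrm x"
    using b_bound[of p x] p YM x by auto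
  also have "\<dots> \<le> Cb * (X.nrm (R p) / \<beta>) * X.nrm x"
    using R_lower[OF p(1)] \<beta> Cb_nonneg x by (intro mult_right_mono mult_left_mono) (auto simp: field_simps)
  finally have "X.nrm (R p) * X.nrm (R p) \<le> (Cb / \<beta> * X.nrm x) * X.nrm (R p)"
    by (simp add: power2_eq_square field_simps)
  then have "X.nrm (R p) \<le> Cb / \<beta> * X.nrm x"
  proof (cases "X.nrm (R p) = 0")
    case True
    then show ?thesis using X.nrm_nonneg[OF x] Cb_nonneg \<beta> by simp
  next
    case False
    then have "X.nrm (R p) > 0" using X.nrm_nonneg[OF RpX] by simp
    then show ?thesis using \<open>_ \<le> (Cb / \<beta> * X.nrm x) * X.nrm (R p)\<close> by (rule mult_right_le_imp_le[rotated])
  qed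
  then show ?thesis using w R p by blast
qed

text \<open>
  With \<open>x = v + w\<close> for the lift \<open>w\<close> of \<open>u - v\<close>, the error splits as \<open>u - uh = (e + k) + d'\<close>, where
  \<open>e = u - x\<close>, \<open>k\<close> is the projection of \<open>d = x - uh\<close> to \<open>K\<close> and \<open>d' = d - k\<close>. Coercivity bounds \<open>d'\<close>
  by \<open>e\<close> and \<open>l - m\<close>, and \<open>e + k\<close> is no longer than \<open>e\<close>.
\<close>

theorem quasi_optimality:
  assumes V: "subspace V" "V \<subseteq> X" "finite_dim_mod NX V"
    and M: "subspace M" "M \<subseteq> Y" "finite_dim_mod NY M"
    and K: "subspace K" "K \<subseteq> V"
    and K_b: "\<And>k p. k \<in> K \<Longrightarrow> p \<in> M \<Longrightarrow> b p k = 0"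
    and K_a: "\<And>k v. k \<in> K \<Longrightarrow> v \<in> X \<Longrightarrow> a k v = 0"
    and NX: "NX \<subseteq> K" "\<And>n. n \<in> NX \<Longrightarrow> sX n n = 0"
    and NY: "NY \<subseteq> M" "\<And>n. n \<in> NY \<Longrightarrow> sY n n = 0"
    and W_def: "W = {v \<in> V. \<forall>k\<in>K. sX v k = 0}"
    and \<gamma>: "\<gamma> > 0"
    and coercive: "\<And>v. v \<in> W \<Longrightarrow> (\<And>p. p \<in> M \<Longrightarrow> b p v = 0) \<Longrightarrow> \<gamma> * (X.nrm v)\<^sup>2 \<le> a v v"
    and \<beta>: "\<beta> > 0"
    and inf_sup: "\<And>p C. p \<in> M \<Longrightarrow> 0 \<le> C \<Longrightarrow> (\<And>v. v \<in> W \<Longrightarrow> b p v \<le> C * X.nrm v) \<Longrightarrow> \<beta> * Y.nrm p \<le> C"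
    and u: "u \<in> X" and uh: "uh \<in> V" and l: "l \<in> Y" and lh: "lh \<in> M"
    and u_K: "\<And>k. k \<in> K \<Longrightarrow> sX (u - uh) k = 0"
    and u_b: "\<And>p. p \<in> M \<Longrightarrow> b p u = b p uh"
    and u_a: "\<And>v. v \<in> V \<Longrightarrow> a u v + b l v = 0"
    and uh_a: "\<And>v. v \<in> V \<Longrightarrow> a uh v + b lh v = 0"
    and v: "v \<in> V" and m: "m \<in> M"
  shows "X.nrm (u - uh) \<le> (1 + 1 / \<gamma> * Ca) * (1 + 1 / \<beta> * Cb) * X.nrm (u - v)
           + 1 / \<gamma> * Cb * Y.nrm (l - m)"
proof -
  have XV: "x \<in> V \<Longrightarrow> x \<in> X" and XK: "k \<in> K \<Longrightarrow> k \<in> X" and VK: "k \<in> K \<Longrightarrow> k \<in> V"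
    and YM: "p \<in> M \<Longrightarrow> p \<in> Y" for x k p using V M K by auto
  have NK: "n \<in> K" if "n \<in> NX" for n using that NX by auto
  have NW: "NX \<subseteq> W"
  proof
    fix n assume n: "n \<in> NX"
    have "sX n k = 0" if "k \<in> K" for k
      using X.cauchy_schwarz[of n k] XK[OF NK[OF n]] XK[OF that] NX(2)[OF n] by (simp add: X.nrm_def)
    then show "n \<in> W" using VK[OF NK[OF n]] by (simp add: W_def)
  qed
  have WV: "W \<subseteq> V" by (auto simp: W_def)
  have subW: "subspace W"
  proof (rule subspaceI)
    show "0 \<in> W" using V(1) XK X.s_scale[of 0 _ 0] by (auto simp: W_def subspace_0)
    show "x + y \<in> W" if "x \<in> W" "y \<in> W" for x y
      using that V(1) XK XV by (simp add: W_def subspace_add X.s_add)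
    show "c *\<^sub>R x \<in> W" if "x \<in> W" for c x
      using that V(1) XK XV by (simp add: W_def subspace_scale X.s_scale)
  qed
  have "\<exists>w\<in>W. (\<forall>p\<in>M. b p w = b p (u - v)) \<and> X.nrm w \<le> Cb / \<beta> * X.nrm (u - v)"
    by (rule inf_sup_lift[OF subW _ finite_dim_mod_subset[OF V(3) WV] NW NX(2) M NY \<beta> inf_sup])
      (use WV XV u v in auto)
  then obtain w where w: "w \<in> W" "\<And>p. p \<in> M \<Longrightarrow> b p w = b p (u - v)"
    "X.nrm w \<le> Cb / \<beta> * X.nrm (u - v)" by blast
  have wV: "w \<in> V" using w WV by auto
  define x where "x = v + w"
  define d where "d = x - uh"
  have xV: "x \<in> V" and dV: "d \<in> V"
    using V(1) v wV uh by (auto simp: x_def d_def subspace_add subspace_diff)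
  have dX: "d \<in> X" and xX: "x \<in> X" and uhX: "uh \<in> X" and vX: "v \<in> X" and wX: "w \<in> X" 
    using dV xV uh v wV XV by auto
  obtain k where k: "k \<in> K" "\<And>k'. k' \<in> K \<Longrightarrow> sX (d - k) k' = 0"
    using X.projection_exists[OF K(1) _ finite_dim_mod_subset[OF V(3) K(2)] NX dX] XK by auto
  have kX: "k \<in> X" using k XK by auto
  define d' where "d' = d - k"
  have d'V: "d' \<in> V" unfolding d'_def using V(1) dV k VK by (simp add: subspace_diff)
  have d'X: "d' \<in> X" using d'V XV by auto
  have d'W: "d' \<in> W" using d'V k by (auto simp: W_def d'_def)
  have d'_ker: "b p d' = 0" if p: "p \<in> M" for p
    using w(2)[OF p] u_b[OF p] K_b[OF k(1) p] YM[OF p] u vX wX uhX kX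
    by (simp add: d'_def d_def x_def b_add_right b_diff_right)
  define e where "e = u - x"
  have eX: "e \<in> X" using u xX by (simp add: e_def)
  have "a d' d' = a d d'"
    using K_a[OF k(1) d'X] dX kX d'X a_diff[of d k d'] by (simp add: d'_def)
  also have "\<dots> = - a e d' - b (l - m) d'"
  proof -
    have "b lh d' = 0" "b m d' = 0" using d'_ker lh m by auto
    then show ?thesis
      using u_a[OF d'V] uh_a[OF d'V] l YM[OF m] d'X xX uhX u
      by (simp add: d_def e_def a_diff b_diff)
  qed
  also have "\<dots> \<le> Ca * X.nrm e * X.nrm d' + Cb * Y.nrm (l - m) * X.nrm d'"
    using a_bound[OF eX d'X] b_bound[of "l - m", OF _ d'X] l YM[OF m] by auto
  finally have "\<gamma> * (X.nrm d')\<^sup>2 \<le> (Ca * X.nrm e + Cb * Y.nrm (l - m)) * X.nrm d'"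
    using coercive[OF d'W d'_ker] by (simp add: algebra_simps)
  then have "(\<gamma> * X.nrm d') * X.nrm d' \<le> (Ca * X.nrm e + Cb * Y.nrm (l - m)) * X.nrm d'"
    by (simp add: power2_eq_square mult.assoc)
  then have "\<gamma> * X.nrm d' \<le> Ca * X.nrm e + Cb * Y.nrm (l - m)"
    using X.nrm_nonneg[OF d'X] X.nrm_nonneg[OF eX] Y.nrm_nonneg[of "l - m"] Ca_nonneg Cb_nonneg l YM[OF m]
    by (cases "X.nrm d' = 0") (auto simp: mult_le_cancel_right)
  then have d'_bound: "X.nrm d' \<le> 1 / \<gamma> * Ca * X.nrm e + 1 / \<gamma> * Cb * Y.nrm (l - m)"
    using \<gamma> by (simp add: field_simps)
  have e_bound: "X.nrm e \<le> (1 + 1 / \<beta> * Cb) * X.nrm (u - v)"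
  proof -
    have "e = (u - v) + - w" by (simp add: e_def x_def)
    then have "X.nrm e \<le> X.nrm (u - v) + X.nrm w"
      using X.nrm_triangle[of "u - v" "- w"] X.nrm_minus[OF wX] X.X_closed(4)[OF wX, of "-1"] u vX by simp
    then show ?thesis using w(3) by (simp add: algebra_simps)
  qed
  \<comment> \<open>The vector \<open>- k\<close> is the projection of \<open>e\<close> to \<open>K\<close>, since \<open>e + k = (u - uh) - d'\<close> is orthogonal to \<open>K\<close>.\<close>
  have "X.nrm (e + k) \<le> X.nrm e"
  proof -
    have mk: "- k \<in> K" using subspace_neg[OF K(1)] k by auto
    have "X.nrm (e - (- k)) \<le> X.nrm (e - 0)"
    proof (rule X.projection_is_best[OF K(1) _ eX mk])
      show "sX (e - - k) k' = 0" if k': "k' \<in> K" for k'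
      proof -
        have "e - - k = (u - uh) - (d - k)" by (simp add: e_def d_def)
        moreover have "sX ((u - uh) - (d - k)) k' = 0"
          using u_K[OF k'] k(2)[OF k'] X.s_diff[of "u - uh" "d - k" k'] u uhX dX kX XK[OF k'] by simp
        ultimately show ?thesis by (simp only:)
      qed
    qed (use XK K in \<open>auto simp: subspace_0\<close>)
    then show ?thesis by simp
  qed
  moreover have "u - uh = (e + k) + d'" by (simp add: e_def d'_def d_def)
  ultimately have "X.nrm (u - uh) \<le> X.nrm e + X.nrm d'"
    using X.nrm_triangle[of "e + k" d'] eX kX d'X by simp
  also have "\<dots> \<le> (1 + 1 / \<gamma> * Ca) * X.nrm e + 1 / \<gamma> * Cb * Y.nrm (l - m)"
    using d'_bound by (simp add: algebra_simps)
  also have "\<dots> \<le> (1 + 1 / \<gamma> * Ca) * ((1 + 1 / \<beta> * Cb) * X.nrm (u - v)) + 1 / \<gamma> * Cb * Y.nrm (l - m)"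
    using e_bound \<gamma> Ca_nonneg by (intro add_right_mono mult_left_mono) auto
  finally show ?thesis by (simp add: mult.assoc)
qed

end

section \<open>Smooth functions\<close>

definition smooth :: "(real ^ 'n::finite \<Rightarrow> real) \<Rightarrow> bool" where
  "smooth f \<longleftrightarrow> (\<forall>\<alpha> x. pdiffs \<alpha> f differentiable (at x))"

lemma pdiff_eqI: "(f has_derivative f') (at x) \<Longrightarrow> pdiff i f x = f' (axis i 1)"
  unfolding pdiff_def using frechet_derivative_at by metis

lemma pdiffs_Nil [simp]: "pdiffs [] f = f"
  by (simp add: pdiffs_def)

lemma pdiffs_singleton [simp]: "pdiffs [i] f = pdiff i f"
  by (simp add: pdiffs_def)

lemma pdiffs_snoc: "pdiffs (\<alpha> @ [i]) f = pdiffs \<alpha> (pdiff i f)"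
  by (simp add: pdiffs_def)

lemma smooth_differentiable: "smooth f \<Longrightarrow> f differentiable (at x)"
  unfolding smooth_def using pdiffs_Nil by metis

lemma smooth_has_derivative: "smooth f \<Longrightarrow> (f has_derivative frechet_derivative f (at x)) (at x)"
  using smooth_differentiable frechet_derivative_works by blast

lemma smooth_pdiff: "smooth f \<Longrightarrow> smooth (pdiff i f)"
  unfolding smooth_def by (metis pdiffs_snoc)

lemma smooth_continuous: "smooth f \<Longrightarrow> continuous_on S f"
  by (meson continuous_at_imp_continuous_on differentiable_imp_continuous_within smooth_differentiable)

lemma smooth_measurable [measurable]: "smooth f \<Longrightarrow> f \<in> borel_measurable borel"
  by (rule borel_measurable_continuous_onI) (rule smooth_continuous)

text \<open>
  Smoothness is the greatest property of differentiable functions that passes to all partial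
  derivatives.
\<close>

lemma smooth_coinduct:
  assumes "P f" and step: "\<And>f. P f \<Longrightarrow> (\<forall>x. f differentiable (at x)) \<and> (\<forall>i. P (pdiff i f))"
  shows "smooth f"
proof -
  have "\<forall>f. P f \<longrightarrow> (\<forall>x. pdiffs \<alpha> f differentiable (at x))" for \<alpha>
  proof (induction \<alpha> rule: rev_induct)
    case Nil
    then show ?case using step by simp
  next
    case (snoc i \<alpha>)
    then show ?case using step by (simp add: pdiffs_snoc)
  qed
  then show ?thesis using assms(1) by (simp add: smooth_def)
qed

inductive_set algebra_gen :: "('a \<Rightarrow> real) set \<Rightarrow> ('a \<Rightarrow> real) set"
  for A :: "('a \<Rightarrow> real) set" where
  base: "f \<in> A \<Longrightarrow> f \<in> algebra_gen A"
| const: "(\<lambda>x. c) \<in> algebra_gen A"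
| add: "f \<in> algebra_gen A \<Longrightarrow> g \<in> algebra_gen A \<Longrightarrow> (\<lambda>x. f x + g x) \<in> algebra_gen A"
| mult: "f \<in> algebra_gen A \<Longrightarrow> g \<in> algebra_gen A \<Longrightarrow> (\<lambda>x. f x * g x) \<in> algebra_gen A"

lemma pdiff_const [simp]: "pdiff i (\<lambda>x. c) = (\<lambda>x. 0)"
  by (rule ext) (simp add: pdiff_eqI[OF has_derivative_const])

lemma pdiff_add:
  assumes "f differentiable (at x)" "g differentiable (at x)"
  shows "pdiff i (\<lambda>x. f x + g x) x = pdiff i f x + pdiff i g x"
  using assms[unfolded frechet_derivative_works, THEN pdiff_eqI, of i]
    pdiff_eqI[OF has_derivative_add[OF assms[unfolded frechet_derivative_works]], of i] by simp

lemma pdiff_mult: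
  assumes "f differentiable (at x)" "g differentiable (at x)"
  shows "pdiff i (\<lambda>x. f x * g x) x = f x * pdiff i g x + pdiff i f x * g x"
  using assms[unfolded frechet_derivative_works, THEN pdiff_eqI, of i]
    pdiff_eqI[OF has_derivative_mult[OF assms[unfolded frechet_derivative_works]], of i] by simp

text \<open>
  By the Leibniz rule, an algebra of functions is closed under partial derivatives as soon as those
  of its generators stay in it. With all smooth functions as generators this gives the closure
  properties of smooth functions, with explicit generators it gives examples.
\<close>

lemma smooth_algebra_gen:
  assumes A: "\<And>f. f \<in> A \<Longrightarrow> (\<forall>x. f differentiable (at x)) \<and> (\<forall>i. pdiff i f \<in> algebra_gen A)"
    and f: "f \<in> algebra_gen A"
  shows "smooth f"
proof (rule smooth_coinduct[where P = "\<lambda>f. f \<in> algebra_gen A"])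
  show "(\<forall>x. g differentiable (at x)) \<and> (\<forall>i. pdiff i g \<in> algebra_gen A)"
    if "g \<in> algebra_gen A" for g
    using that
  proof induction
    case (base f)
    then show ?case by (rule A)
  next
    case (const c)
    then show ?case by (auto intro: algebra_gen.const)
  next
    case (add f g)
    then have "pdiff i (\<lambda>x. f x + g x) = (\<lambda>x. pdiff i f x + pdiff i g x)" for i
      by (intro ext pdiff_add) auto
    with add show ?case by (auto intro: algebra_gen.intros)
  next
    case (mult f g)
    then have "pdiff i (\<lambda>x. f x * g x) = (\<lambda>x. f x * pdiff i g x + pdiff i f x * g x)" for i
      by (intro ext pdiff_mult) auto
    moreover have "(\<lambda>x. f x * pdiff i g x + pdiff i f x * g x) \<in> algebra_gen A" for i
      using mult by (intro algebra_gen.add algebra_gen.mult) auto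
    ultimately show ?case using mult by auto
  qed
qed (fact f)

lemma smooth_gen_smooth:
  assumes "f \<in> algebra_gen (Collect smooth)"
  shows "smooth f"
  by (rule smooth_algebra_gen[OF _ assms])
    (auto intro: smooth_differentiable smooth_pdiff algebra_gen.base)

lemma smooth_const: "smooth (\<lambda>x. c)"
  by (intro smooth_gen_smooth algebra_gen.intros)

lemma smooth_add: "smooth f \<Longrightarrow> smooth g \<Longrightarrow> smooth (\<lambda>x. f x + g x)"
  by (intro smooth_gen_smooth algebra_gen.intros) simp_all

lemma smooth_mult: "smooth f \<Longrightarrow> smooth g \<Longrightarrow> smooth (\<lambda>x. f x * g x)"
  by (intro smooth_gen_smooth algebra_gen.intros) simp_all

lemma smooth_sum: "(\<And>i. i \<in> I \<Longrightarrow> smooth (f i)) \<Longrightarrow> smooth (\<lambda>x. \<Sum>i\<in>I. f i x)"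
  by (induction I rule: infinite_finite_induct) (auto intro: smooth_const smooth_add)

lemma smooth_prod: "(\<And>i. i \<in> I \<Longrightarrow> smooth (f i)) \<Longrightarrow> smooth (\<lambda>x. \<Prod>i\<in>I. f i x)"
  by (induction I rule: infinite_finite_induct) (auto intro: smooth_const smooth_mult)

lemma smooth_power: "smooth f \<Longrightarrow> smooth (\<lambda>x. f x ^ m)"
  by (induction m) (auto intro: smooth_const smooth_mult)

lemma has_derivative_vec_nth: "((\<lambda>x. x $ i) has_derivative (\<lambda>h. h $ i)) (at x)"
  by (rule bounded_linear_imp_has_derivative) (rule bounded_linear_vec_nth)

lemma smooth_vec_nth: "smooth (\<lambda>x::real ^ 'n::finite. x $ i)"
proof (rule smooth_algebra_gen[where A = "{\<lambda>x. x $ i}"])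
  show "(\<forall>x. f differentiable (at x)) \<and> (\<forall>j. pdiff j f \<in> algebra_gen {\<lambda>x. x $ i})"
    if "f \<in> {\<lambda>x. x $ i}" for f :: "real ^ 'n \<Rightarrow> real"
  proof -
    have f: "f = (\<lambda>x. x $ i)" using that by simp
    have "pdiff j f = (\<lambda>x. axis j 1 $ i)" for j
      unfolding f by (rule ext) (rule pdiff_eqI[OF has_derivative_vec_nth])
    then show ?thesis
      unfolding f using has_derivative_vec_nth by (auto simp: differentiable_def intro: algebra_gen.const)
  qed
qed (auto intro: algebra_gen.base)

lemma has_derivative_scale_shift:
  assumes "f differentiable (at (s *\<^sub>R x + a))"
  shows "((\<lambda>y. f (s *\<^sub>R y + a)) has_derivative
           (\<lambda>h. frechet_derivative f (at (s *\<^sub>R x + a)) (s *\<^sub>R h))) (at x)"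
proof -
  have "((\<lambda>y. s *\<^sub>R y + a) has_derivative (\<lambda>h. s *\<^sub>R h)) (at x)"
    by (auto intro!: derivative_eq_intros)
  from has_derivative_compose[OF this assms[unfolded frechet_derivative_works]]
  show ?thesis .
qed

lemma pdiff_scale_shift:
  assumes "f differentiable (at (s *\<^sub>R x + a))"
  shows "pdiff i (\<lambda>y. f (s *\<^sub>R y + a)) x = s * pdiff i f (s *\<^sub>R x + a)"
  using pdiff_eqI[OF has_derivative_scale_shift[OF assms]]
    linear_scale[OF linear_frechet_derivative[OF assms]] by (simp add: pdiff_def)

lemma smooth_scale_shift:
  assumes "smooth f"
  shows "smooth (\<lambda>y. f (s *\<^sub>R y + a))"
proof (rule smooth_coinduct[where P = "\<lambda>g. \<exists>c f. smooth f \<and> g = (\<lambda>y. c * f (s *\<^sub>R y + a))"])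
  show "\<exists>c g. smooth g \<and> (\<lambda>y. f (s *\<^sub>R y + a)) = (\<lambda>y. c * g (s *\<^sub>R y + a))"
    using assms by (intro exI[of _ 1] exI[of _ f]) simp
next
  fix g assume "\<exists>c f. smooth f \<and> g = (\<lambda>y. c * f (s *\<^sub>R y + a))"
  then obtain c f where f: "smooth f" and g: "g = (\<lambda>y. c * f (s *\<^sub>R y + a))" by blast
  have diff: "(\<lambda>y. f (s *\<^sub>R y + a)) differentiable (at x)" for x
    using has_derivative_scale_shift[OF smooth_differentiable[OF f]] by (auto simp: differentiable_def)
  have "pdiff i g = (\<lambda>y. (c * s) * pdiff i f (s *\<^sub>R y + a))" for i
    unfolding g using pdiff_mult[OF differentiable_const diff, of i c]
    by (simp add: fun_eq_iff pdiff_scale_shift smooth_differentiable[OF f])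
  moreover have "g differentiable (at x)" for x
    unfolding g by (intro differentiable_mult differentiable_const diff)
  ultimately show "(\<forall>x. g differentiable (at x)) \<and>
      (\<forall>i. \<exists>d f. smooth f \<and> pdiff i g = (\<lambda>y. d * f (s *\<^sub>R y + a)))"
    using smooth_pdiff[OF f] by blast
qed

section \<open>Bump functions\<close>

text \<open>
  The case \<open>m = 0\<close> is the classical function that is flat at the origin. The powers in the
  denominator make the family closed under differentiation up to linear combinations.
\<close>

definition flat_exp :: "nat \<Rightarrow> real \<Rightarrow> real" where
  "flat_exp m t = (if t \<le> 0 then 0 else exp (- (1 / t)) / t ^ m)"

lemma flat_exp_nonneg: "0 \<le> flat_exp m t"
  by (simp add: flat_exp_def)

lemma flat_exp_pos_iff: "0 < flat_exp m t \<longleftrightarrow> 0 < t"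
  by (simp add: flat_exp_def)

lemma flat_exp_tendsto_0: "((\<lambda>t. flat_exp m t) \<longlongrightarrow> 0) (at 0)"
proof -
  have "((\<lambda>t. (inverse t) ^ m / exp (inverse t)) \<longlongrightarrow> (0::real)) (at_right 0)"
    using tendsto_power_div_exp_0 filterlim_inverse_at_top_right by (rule filterlim_compose)
  moreover have "\<forall>\<^sub>F t in at_right 0. (inverse t) ^ m / exp (inverse t) = flat_exp m t"
    unfolding eventually_at_right_field
    by (intro exI[of _ 1]) (auto simp: flat_exp_def field_simps exp_minus)
  ultimately have right: "(flat_exp m \<longlongrightarrow> 0) (at_right 0)"
    by (rule Lim_transform_eventually)
  have "\<forall>\<^sub>F t in at_left 0. 0 = flat_exp m t"
    unfolding eventually_at_left_field by (intro exI[of _ "-1"]) (auto simp: flat_exp_def)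
  then have "(flat_exp m \<longlongrightarrow> 0) (at_left 0)"
    by (rule Lim_transform_eventually[OF tendsto_const])
  with right show ?thesis by (simp add: filterlim_split_at)
qed

text \<open>
  At the origin the difference quotient of \<open>flat_exp m\<close> is \<open>flat_exp (m + 1)\<close>, so differentiability
  there is the limit statement for the next member of the family.
\<close>

lemma flat_exp_deriv:
  "(flat_exp m has_real_derivative (flat_exp (m + 2) t - real m * flat_exp (m + 1) t)) (at t)"
proof -
  consider "t < 0" | "t = 0" | "t > 0" by linarith
  then show ?thesis
  proof cases
    case 1
    have ev: "\<forall>\<^sub>F s in nhds t. 0 = flat_exp m s"
      using eventually_nhds_in_open[of "{..<0}" t] 1
      by (auto simp: flat_exp_def elim!: eventually_mono)
    have "(flat_exp m has_real_derivative 0) (at t)"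
      using iffD1[OF DERIV_cong_ev[OF refl ev refl], of 0] by simp
    then show ?thesis using 1 by (simp add: flat_exp_def)
  next
    case 2
    have "(\<lambda>h. (flat_exp m (0 + h) - flat_exp m 0) / h) = flat_exp (m + 1)"
      by (auto simp: flat_exp_def fun_eq_iff)
    then have "(flat_exp m has_real_derivative 0) (at 0)"
      unfolding DERIV_def using flat_exp_tendsto_0[of "m + 1"] by (simp only:)
    then show ?thesis using 2 by (simp add: flat_exp_def)
  next
    case 3
    have "((\<lambda>t. exp (- (1 / t)) / t ^ m) has_real_derivative
        (exp (- (1 / t)) * (1 / t\<^sup>2) * t ^ m - exp (- (1 / t)) * (real m * t ^ (m - 1))) / (t ^ m * t ^ m)) (at t)"
      using 3 by (auto intro!: derivative_eq_intros simp: power2_eq_square)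
    moreover have "(exp (- (1 / t)) * (1 / t\<^sup>2) * t ^ m - exp (- (1 / t)) * (real m * t ^ (m - 1))) / (t ^ m * t ^ m)
        = flat_exp (m + 2) t - real m * flat_exp (m + 1) t"
      using 3 by (cases m) (auto simp: flat_exp_def field_simps power2_eq_square)
    moreover have ev: "\<forall>\<^sub>F s in nhds t. exp (- (1 / s)) / s ^ m = flat_exp m s"
      using eventually_nhds_in_open[of "{0<..}" t] 3
      by (auto simp: flat_exp_def elim!: eventually_mono)
    ultimately show ?thesis
      using DERIV_cong_ev[OF refl ev refl] by simp
  qed
qed

lemma smooth_flat_exp: "smooth (\<lambda>x::real ^ 'n::finite. flat_exp m (c * x $ i + d))"
proof -
  define A where "A = {f. \<exists>m. f = (\<lambda>x::real ^ 'n. flat_exp m (c * x $ i + d))}"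
  have inA: "(\<lambda>x. flat_exp m (c * x $ i + d)) \<in> algebra_gen A" for m
    by (rule algebra_gen.base) (auto simp: A_def)
  show ?thesis
  proof (rule smooth_algebra_gen[where A = A, OF _ inA])
    fix f assume "f \<in> A"
    then obtain m where f: "f = (\<lambda>x. flat_exp m (c * x $ i + d))" by (auto simp: A_def)
    have aff: "((\<lambda>x. c * x $ i + d) has_derivative (\<lambda>h. c * h $ i)) (at x)" for x :: "real ^ 'n"
      by (auto intro!: derivative_eq_intros has_derivative_vec_nth)
    have der: "(f has_derivative (\<lambda>h. (c * h $ i) *
       (flat_exp (m + 2) (c * x $ i + d) - real m * flat_exp (m + 1) (c * x $ i + d)))) (at x)" for x
      unfolding f by (rule DERIV_compose_FDERIV[OF flat_exp_deriv aff])
    have "pdiff j f = (\<lambda>x. (c * axis j 1 $ i) *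
       (flat_exp (m + 2) (c * x $ i + d) + (- real m) * flat_exp (m + 1) (c * x $ i + d)))" for j
      by (rule ext, subst pdiff_eqI[OF der]) simp
    moreover have "(\<lambda>x. (c * axis j 1 $ i) * (flat_exp (m + 2) (c * x $ i + d) +
        (- real m) * flat_exp (m + 1) (c * x $ i + d))) \<in> algebra_gen A" for j
      by (intro algebra_gen.mult algebra_gen.add algebra_gen.const inA)
    moreover have "f differentiable (at x)" for x
      unfolding differentiable_def by (rule exI) (rule der)
    ultimately show "(\<forall>x. f differentiable (at x)) \<and> (\<forall>i. pdiff i f \<in> algebra_gen A)"
      by simp
  qed
qed

definition bump :: "real ^ 'n::finite \<Rightarrow> real ^ 'n \<Rightarrow> real ^ 'n \<Rightarrow> real" where
  "bump a b x = (\<Prod>i\<in>UNIV. flat_exp 0 (x $ i - a $ i) * flat_exp 0 (b $ i - x $ i))"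

lemma smooth_bump: "smooth (bump a b)"
proof -
  have "smooth (\<lambda>x. flat_exp 0 (x $ i - a $ i))" "smooth (\<lambda>x. flat_exp 0 (b $ i - x $ i))" for i
    using smooth_flat_exp[of 0 1 i "- a $ i"] smooth_flat_exp[of 0 "-1" i "b $ i"] by simp_all
  then show ?thesis
    unfolding bump_def by (intro smooth_prod smooth_mult)
qed

lemma bump_nonneg: "0 \<le> bump a b x"
  by (auto simp: bump_def intro!: prod_nonneg mult_nonneg_nonneg flat_exp_nonneg)

lemma bump_pos_iff: "0 < bump a b x \<longleftrightarrow> x \<in> box a b"
proof
  assume "x \<in> box a b"
  then show "0 < bump a b x"
    by (auto simp: bump_def mem_box_cart flat_exp_pos_iff intro!: prod_pos mult_pos_pos)
next
  assume *: "0 < bump a b x"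
  have "0 < flat_exp 0 (x $ i - a $ i) * flat_exp 0 (b $ i - x $ i)" for i
  proof (rule ccontr)
    assume "\<not> ?thesis"
    then have "flat_exp 0 (x $ i - a $ i) * flat_exp 0 (b $ i - x $ i) = 0"
      by (metis flat_exp_nonneg less_eq_real_def mult_nonneg_nonneg)
    then have "bump a b x = 0" unfolding bump_def by (intro prod_zero) auto
    with * show False by simp
  qed
  then have "0 < x $ i - a $ i \<and> 0 < b $ i - x $ i" for i
    by (metis flat_exp_nonneg flat_exp_pos_iff less_eq_real_def mult_eq_0_iff)
  then show "x \<in> box a b" by (simp add: mem_box_cart)
qed

lemma bump_eq_0: "x \<notin> box a b \<Longrightarrow> bump a b x = 0"
  using bump_nonneg[of a b x] bump_pos_iff[of a b x] by linarith

section \<open>Translations and mollification\<close>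

lemma lborel_shift:
  fixes f :: "'a::euclidean_space \<Rightarrow> real"
  assumes [measurable]: "f \<in> borel_measurable borel"
  shows lborel_integral_shift: "(\<integral>x. f (x + y) \<partial>lborel) = (\<integral>x. f x \<partial>lborel)"
    and lborel_integrable_shift: "integrable lborel (\<lambda>x. f (x + y)) \<longleftrightarrow> integrable lborel f"
proof -
  have "(\<integral>x. f x \<partial>lborel) = (\<integral>x. f x \<partial>distr lborel borel ((+) y))"
    by (simp add: lborel_distr_plus)
  also have "\<dots> = (\<integral>x. f (y + x) \<partial>lborel)"
    by (rule integral_distr) auto
  finally show "(\<integral>x. f (x + y) \<partial>lborel) = (\<integral>x. f x \<partial>lborel)"
    by (simp add: add.commute)
  have "integrable lborel f \<longleftrightarrow> integrable (distr lborel borel ((+) y)) f"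
    by (simp add: lborel_distr_plus)
  also have "\<dots> \<longleftrightarrow> integrable lborel (\<lambda>x. f (y + x))"
    by (rule integrable_distr_eq) auto
  finally show "integrable lborel (\<lambda>x. f (x + y)) \<longleftrightarrow> integrable lborel f"
    by (simp add: add.commute)
qed

lemma compact_in_open_separated:
  fixes K U :: "'a::euclidean_space set"
  assumes "compact K" "open U" "K \<subseteq> U"
  shows "\<exists>d>0. \<forall>x\<in>K. \<forall>y. norm (y - x) < d \<longrightarrow> y \<in> U"
proof (cases "K = {}")
  case True
  then show ?thesis by (intro exI[of _ 1]) auto
next
  case False
  have "\<exists>d>0. \<forall>x\<in>K. \<forall>y\<in>- U. d \<le> dist x y"
    using separate_compact_closed[OF \<open>compact K\<close>, of "- U"] assms by auto
  then obtain d where "d > 0" "\<And>x y. x \<in> K \<Longrightarrow> y \<notin> U \<Longrightarrow> d \<le> dist x y" by auto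
  then show ?thesis
    by (intro exI[of _ d]) (auto simp: dist_norm norm_minus_commute dest: leD)
qed

text \<open>
  Continuity at the origin of the translates of \<open>f\<close>, measured in \<open>L\<^sup>1\<close>.
\<close>

definition shift_continuous :: "('a::euclidean_space \<Rightarrow> real) \<Rightarrow> bool" where
  "shift_continuous f \<longleftrightarrow>
     (\<forall>e>0. \<exists>d>0. \<forall>y. norm y < d \<longrightarrow> (\<integral>x. \<bar>f (x + y) - f x\<bar> \<partial>lborel) < e)"

lemma integrable_shift_diff:
  assumes "integrable lborel (f :: 'a::euclidean_space \<Rightarrow> real)"
  shows "integrable lborel (\<lambda>x. \<bar>f (x + y) - f x\<bar>)"
proof -
  have [measurable]: "f \<in> borel_measurable borel" using assms by (auto dest: borel_measurable_integrable)
  show ?thesis using assms by (intro integrable_abs Bochner_Integration.integrable_diff) (simp_all add: lborel_integrable_shift)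
qed

lemma shift_continuous_add:
  assumes f: "integrable lborel f" "shift_continuous f" and g: "integrable lborel g" "shift_continuous g"
  shows "shift_continuous (\<lambda>x. f x + g x)"
  unfolding shift_continuous_def
proof (intro allI impI)
  fix e :: real assume e: "0 < e"
  obtain d1 where d1: "d1 > 0" "\<And>y. norm y < d1 \<Longrightarrow> (\<integral>x. \<bar>f (x + y) - f x\<bar> \<partial>lborel) < e / 2"
    using f(2) half_gt_zero[OF e] unfolding shift_continuous_def by meson
  obtain d2 where d2: "d2 > 0" "\<And>y. norm y < d2 \<Longrightarrow> (\<integral>x. \<bar>g (x + y) - g x\<bar> \<partial>lborel) < e / 2"
    using g(2) half_gt_zero[OF e] unfolding shift_continuous_def by meson
  show "\<exists>d>0. \<forall>y. norm y < d \<longrightarrow> (\<integral>x. \<bar>f (x + y) + g (x + y) - (f x + g x)\<bar> \<partial>lborel) < e"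
  proof (intro exI[of _ "min d1 d2"] conjI allI impI)
    fix y :: 'a assume y: "norm y < min d1 d2"
    have "(\<integral>x. \<bar>f (x + y) + g (x + y) - (f x + g x)\<bar> \<partial>lborel)
        \<le> (\<integral>x. \<bar>f (x + y) - f x\<bar> + \<bar>g (x + y) - g x\<bar> \<partial>lborel)"
      using integrable_shift_diff[OF Bochner_Integration.integrable_add[OF f(1) g(1)], of y]
      by (intro integral_mono Bochner_Integration.integrable_add integrable_shift_diff f g) auto
    also have "\<dots> = (\<integral>x. \<bar>f (x + y) - f x\<bar> \<partial>lborel) + (\<integral>x. \<bar>g (x + y) - g x\<bar> \<partial>lborel)"
      by (intro Bochner_Integration.integral_add integrable_shift_diff f g)
    also have "\<dots> < e" using d1(2)[of y] d2(2)[of y] y by simp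
    finally show "(\<integral>x. \<bar>f (x + y) + g (x + y) - (f x + g x)\<bar> \<partial>lborel) < e" .
  qed (use d1 d2 in auto)
qed

lemma shift_continuous_limit:
  assumes s: "\<And>i. integrable lborel (s i)" "\<And>i. shift_continuous (s i)"
    and lim: "\<And>x. (\<lambda>i. s i x) \<longlonglongrightarrow> f x" and bound: "\<And>i x. \<bar>s i x\<bar> \<le> 2 * \<bar>f x\<bar>"
    and f: "integrable lborel f"
  shows "shift_continuous f"
  unfolding shift_continuous_def
proof (intro allI impI)
  fix e :: real assume e: "0 < e"
  have [measurable]: "f \<in> borel_measurable borel" "\<And>i. s i \<in> borel_measurable borel"
    using f s(1) by (auto dest: borel_measurable_integrable)
  have int: "integrable lborel (\<lambda>x. \<bar>s i x - f x\<bar>)" for i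
    using s f by auto
  have "(\<lambda>i. \<integral>x. \<bar>s i x - f x\<bar> \<partial>lborel) \<longlonglongrightarrow> (\<integral>x. 0 \<partial>(lborel :: 'a measure))"
  proof (rule integral_dominated_convergence)
    show "integrable lborel (\<lambda>x. 3 * \<bar>f x\<bar>)" using f by auto
    show "AE x in lborel. (\<lambda>i. \<bar>s i x - f x\<bar>) \<longlonglongrightarrow> 0"
      using lim by (auto intro!: AE_I2 tendsto_rabs_zero simp: LIM_zero_iff)
    show "AE x in lborel. norm \<bar>s i x - f x\<bar> \<le> 3 * \<bar>f x\<bar>" for i
    proof (rule AE_I2)
      show "norm \<bar>s i x - f x\<bar> \<le> 3 * \<bar>f x\<bar>" for x using bound[of i x] by simp
    qed
  qed measurable
  then have "\<forall>\<^sub>F i in sequentially. (\<integral>x. \<bar>s i x - f x\<bar> \<partial>lborel) < e / 3"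
    using e by (intro order_tendstoD(2)) auto
  then obtain i where i: "(\<integral>x. \<bar>s i x - f x\<bar> \<partial>lborel) < e / 3"
    by (meson eventually_sequentially order_refl)
  obtain d where d: "d > 0" "\<And>y. norm y < d \<Longrightarrow> (\<integral>x. \<bar>s i (x + y) - s i x\<bar> \<partial>lborel) < e / 3"
    using s(2)[of i] e unfolding shift_continuous_def by (metis zero_less_divide_iff zero_less_numeral)
  show "\<exists>d>0. \<forall>y. norm y < d \<longrightarrow> (\<integral>x. \<bar>f (x + y) - f x\<bar> \<partial>lborel) < e"
  proof (intro exI[of _ d] conjI allI impI d(1))
    fix y :: 'a assume y: "norm y < d"
    have int': "integrable lborel (\<lambda>x. \<bar>s i (x + y) - f (x + y)\<bar>)"
      using int lborel_integrable_shift[of "\<lambda>x. \<bar>s i x - f x\<bar>" y] by simp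
    have "(\<integral>x. \<bar>f (x + y) - f x\<bar> \<partial>lborel) \<le>
        (\<integral>x. (\<bar>s i (x + y) - f (x + y)\<bar> + \<bar>s i (x + y) - s i x\<bar>) + \<bar>s i x - f x\<bar> \<partial>lborel)"
      by (intro integral_mono Bochner_Integration.integrable_add integrable_shift_diff f s int int') auto
    also have "\<dots> = (\<integral>x. \<bar>s i (x + y) - f (x + y)\<bar> \<partial>lborel) + (\<integral>x. \<bar>s i (x + y) - s i x\<bar> \<partial>lborel)
        + (\<integral>x. \<bar>s i x - f x\<bar> \<partial>lborel)"
      by (simp add: Bochner_Integration.integral_add integrable_shift_diff s int int')
    also have "(\<integral>x. \<bar>s i (x + y) - f (x + y)\<bar> \<partial>lborel) = (\<integral>x. \<bar>s i x - f x\<bar> \<partial>lborel)"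
      using lborel_integral_shift[of "\<lambda>x. \<bar>s i x - f x\<bar>" y] by simp
    finally show "(\<integral>x. \<bar>f (x + y) - f x\<bar> \<partial>lborel) < e"
      using i d(2)[OF y] by linarith
  qed
qed

text \<open>
  Squeeze \<open>A\<close> between a compact set \<open>K\<close> and an open set \<open>U\<close> such that \<open>U - K\<close> is small. For \<open>y\<close>
  shorter than the distance from \<open>K\<close> to the complement of \<open>U\<close>, the indicator of \<open>A\<close> can differ at
  \<open>x\<close> and \<open>x + y\<close> only if one of these points is in \<open>U - K\<close>.
\<close>

lemma shift_continuous_bounded_indicator:
  assumes A: "A \<in> sets borel" "bounded A"
  shows "shift_continuous (\<lambda>x::'a::euclidean_space. indicator A x *\<^sub>R c)"
  unfolding shift_continuous_def
proof (intro allI impI)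
  fix e :: real assume e: "0 < e"
  define e' where "e' = e / (4 * (\<bar>c\<bar> + 1))"
  have e': "e' > 0" using e by (simp add: e'_def)
  have Al: "A \<in> sets lebesgue" using A by simp
  obtain K where K: "closed K" "K \<subseteq> A" "A - K \<in> lmeasurable" "emeasure lebesgue (A - K) < ennreal e'"
    using sets_lebesgue_inner_closed[OF Al e'] .
  obtain U where U: "open U" "A \<subseteq> U" "U - A \<in> lmeasurable" "emeasure lebesgue (U - A) < ennreal e'"
    using sets_lebesgue_outer_open[OF Al e'] .
  have "compact K" using K A bounded_subset compact_eq_bounded_closed by blast
  have meas: "measure lebesgue (A - K) < e'" "measure lebesgue (U - A) < e'"
    using K U e' by (metis emeasure_eq_measure2 ennreal_less_iff measure_nonneg)+
  have UK: "U - K = (A - K) \<union> (U - A)" using K U by auto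
  have UKm: "U - K \<in> lmeasurable" unfolding UK using K U by auto
  have UKb [measurable]: "U - K \<in> sets borel" using K U by auto
  have "measure lebesgue (U - K) \<le> measure lebesgue (A - K) + measure lebesgue (U - A)"
    unfolding UK using K U by (intro measure_Un_le) auto
  then have small: "measure lborel (U - K) < 2 * e'"
    using meas UKb by (simp add: measure_completion)
  have UKint: "integrable lborel (indicator (U - K) :: 'a \<Rightarrow> real)"
    using UKm UKb by (simp add: fmeasurable_def)
  obtain d where d: "d > 0" "\<And>x y. x \<in> K \<Longrightarrow> norm (y - x) < d \<Longrightarrow> y \<in> U"
    using compact_in_open_separated[OF \<open>compact K\<close> U(1)] K U by (metis order_trans)
  show "\<exists>d>0. \<forall>y. norm y < d \<longrightarrow>
     (\<integral>x. \<bar>indicator A (x + y) *\<^sub>R c - indicator A x *\<^sub>R c\<bar> \<partial>lborel) < e"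
  proof (intro exI[of _ d] conjI allI impI d(1))
    fix y :: 'a assume y: "norm y < d"
    have Aint: "integrable lborel (\<lambda>x. indicator A x *\<^sub>R c)"
      using A by (intro integrable_scaleR_left)
        (use emeasure_bounded_finite[OF A(2)] in \<open>auto intro!: integrable_real_indicator\<close>)
    have UKint': "integrable lborel (\<lambda>x. indicator (U - K) (x + y) :: real)"
      using UKint lborel_integrable_shift[of "indicator (U - K)" y] by simp
    have "\<bar>indicator A (x + y) *\<^sub>R c - indicator A x *\<^sub>R c\<bar> \<le>
        \<bar>c\<bar> * (indicator (U - K) x + indicator (U - K) (x + y))" for x
      using d(2)[of x "x + y"] d(2)[of "x + y" x] y K(2) U(2)
      by (auto simp: indicator_def norm_minus_commute)
    then have "(\<integral>x. \<bar>indicator A (x + y) *\<^sub>R c - indicator A x *\<^sub>R c\<bar> \<partial>lborel) \<le>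
       (\<integral>x. \<bar>c\<bar> * (indicator (U - K) x + indicator (U - K) (x + y)) \<partial>lborel)"
      by (intro integral_mono integrable_shift_diff[OF Aint] integrable_mult_right
          Bochner_Integration.integrable_add UKint UKint') auto
    also have "\<dots> = \<bar>c\<bar> * ((\<integral>x. indicator (U - K) x \<partial>lborel) + (\<integral>x. indicator (U - K) (x + y) \<partial>lborel))"
      by (simp only: integral_mult_right_zero Bochner_Integration.integral_add[OF UKint UKint'])
    also have "(\<integral>x. indicator (U - K) (x + y) \<partial>lborel) = (\<integral>x. indicator (U - K) x \<partial>lborel :: real)"
      by (rule lborel_integral_shift) measurable
    also have "(\<integral>x. indicator (U - K) x \<partial>lborel :: real) = measure lborel (U - K)"
      by simp
    also have "\<bar>c\<bar> * (measure lborel (U - K) + measure lborel (U - K)) \<le> \<bar>c\<bar> * (4 * e')"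
      using small by (intro mult_left_mono) auto
    also have "\<dots> < (\<bar>c\<bar> + 1) * (4 * e')"
      using e' by (intro mult_strict_right_mono) auto
    also have "\<dots> = e" unfolding e'_def by (simp add: add_pos_nonneg field_simps)
    finally show "(\<integral>x. \<bar>indicator A (x + y) *\<^sub>R c - indicator A x *\<^sub>R c\<bar> \<partial>lborel) < e" .
  qed
qed

lemma shift_continuous_integrable:
  assumes "integrable lborel (f :: 'a::euclidean_space \<Rightarrow> real)"
  shows "shift_continuous f"
  using assms
proof (induction rule: integrable_induct)
  case (base A c)
  have int: "integrable lborel (\<lambda>x. indicator B x *\<^sub>R c)" if "B \<in> sets borel" "B \<subseteq> A" for B
  proof (intro integrable_scaleR_left integrable_real_indicator)
    show "emeasure lborel B < \<infinity>" using emeasure_mono[OF that(2), of lborel] base by auto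
  qed (use that in auto)
  show ?case
  proof (rule shift_continuous_limit[where s = "\<lambda>n x. indicator (A \<inter> cball 0 (real n)) x *\<^sub>R c"])
    show "shift_continuous (\<lambda>x. indicator (A \<inter> cball 0 (real n)) x *\<^sub>R c)" for n
      using base by (intro shift_continuous_bounded_indicator) auto
    show "(\<lambda>n. indicator (A \<inter> cball 0 (real n)) x *\<^sub>R c) \<longlonglongrightarrow> indicator A x *\<^sub>R c" for x :: 'a
    proof (rule tendsto_eventually)
      obtain N where "norm x \<le> real N" using real_arch_simple by blast
      then show "\<forall>\<^sub>F n in sequentially. indicator (A \<inter> cball 0 (real n)) x *\<^sub>R c = indicator A x *\<^sub>R c"
        by (intro eventually_sequentiallyI[of N]) (auto simp: indicator_def)
    qed
    show "integrable lborel (\<lambda>x. indicator (A \<inter> cball 0 (real n)) x *\<^sub>R c)" for n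
      using base by (intro int) auto
    show "\<bar>indicator (A \<inter> cball 0 (real n)) x *\<^sub>R c\<bar> \<le> 2 * \<bar>indicator A x *\<^sub>R c\<bar>" for n and x :: 'a
      by (auto simp: indicator_def)
    show "integrable lborel (\<lambda>x. indicator A x *\<^sub>R c)" using base by (intro int) auto
  qed
next
  case (add f g)
  then show ?case by (intro shift_continuous_add)
next
  case (lim f s)
  then show ?case by (intro shift_continuous_limit[of s f]) auto
qed

text \<open>
  Tonelli's criterion for integrands that are controlled by \<open>f\<close> in the first variable and by kernels
  of constant mass in the second.
\<close>

lemma integrable_productI:
  fixes f :: "'a::euclidean_space \<Rightarrow> real" and F :: "'a \<times> 'b::euclidean_space \<Rightarrow> real"
  assumes f: "integrable lborel f" and F [measurable]: "F \<in> borel_measurable (lborel \<Otimes>\<^sub>M lborel)"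
    and bound: "\<And>x y. \<bar>F (x, y)\<bar> \<le> \<bar>f x\<bar> * k x y"
    and k: "\<And>x. integrable lborel (k x)" "\<And>x. (\<integral>y. k x y \<partial>lborel) = c"
  shows "integrable (lborel \<Otimes>\<^sub>M lborel) F"
proof (rule lborel_pair.Fubini_integrable)
  have F1: "integrable lborel (\<lambda>y. F (x, y))" for x
  proof (rule Bochner_Integration.integrable_bound[OF integrable_mult_right[OF k(1), of "\<bar>f x\<bar>"]])
    show "AE y in lborel. norm (F (x, y)) \<le> norm (\<bar>f x\<bar> * k x y)"
      using bound by (intro AE_I2) (auto intro: order_trans[OF _ abs_ge_self])
  qed measurable
  then show "AE x in lborel. integrable lborel (\<lambda>y. F (x, y))" by simp
  have le: "(\<integral>y. norm (F (x, y)) \<partial>lborel) \<le> \<bar>f x\<bar> * c" for x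
  proof -
    have "(\<integral>y. norm (F (x, y)) \<partial>lborel) \<le> (\<integral>y. \<bar>f x\<bar> * k x y \<partial>lborel)"
      using bound by (intro integral_mono integrable_norm integrable_mult_right F1 k) auto
    then show ?thesis by (simp add: k(2))
  qed
  have "integrable lborel (\<lambda>x. \<bar>f x\<bar> * c)" using f by auto
  then show "integrable lborel (\<lambda>x. \<integral>y. norm (F (x, y)) \<partial>lborel)"
  proof (rule Bochner_Integration.integrable_bound)
    show "AE x in lborel. norm (\<integral>y. norm (F (x, y)) \<partial>lborel) \<le> norm (\<bar>f x\<bar> * c)"
    proof (rule AE_I2)
      fix x
      have "0 \<le> (\<integral>y. norm (F (x, y)) \<partial>lborel)" by (rule integral_nonneg_AE) simp
      then show "norm (\<integral>y. norm (F (x, y)) \<partial>lborel) \<le> norm (\<bar>f x\<bar> * c)"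
        using le[of x] abs_ge_self[of "\<bar>f x\<bar> * c"] by simp
    qed
  qed measurable
qed measurable

text \<open>
  The kernel is written with \<open>y - x\<close>, so that \<open>\<eta>\<close> is translated, and not reflected, in the variable
  of \<open>g\<close>.
\<close>

abbreviation kernel_pairing :: "('a::euclidean_space \<Rightarrow> real) \<Rightarrow> ('a \<Rightarrow> real) \<Rightarrow> ('a \<Rightarrow> real) \<Rightarrow> real" where
  "kernel_pairing \<eta> f g \<equiv> (\<integral>x. (\<integral>y. f x * g y * \<eta> (y - x) \<partial>lborel) \<partial>lborel)"

definition mollifier :: "real \<Rightarrow> ('a::euclidean_space \<Rightarrow> real) \<Rightarrow> bool" where
  "mollifier d \<eta> \<longleftrightarrow> integrable lborel \<eta> \<and> (\<forall>x. 0 \<le> \<eta> x) \<and> (\<integral>x. \<eta> x \<partial>lborel) = 1 \<and>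
     (\<forall>x. d \<le> norm x \<longrightarrow> \<eta> x = 0)"

lemma mollifier_mono: "mollifier d \<eta> \<Longrightarrow> d \<le> d' \<Longrightarrow> mollifier d' \<eta>"
  by (auto simp: mollifier_def)

text \<open>
  Substituting \<open>y = x + t\<close> and exchanging the integrals turns the pairing into the average, with
  weight \<open>\<eta>\<close>, of the integrals of \<open>f x * g (x + t)\<close>.
\<close>

lemma kernel_Fubini:
  fixes f g \<eta> :: "'a::euclidean_space \<Rightarrow> real"
  assumes f: "integrable lborel f" and g [measurable]: "g \<in> borel_measurable borel"
    and C: "\<And>x. \<bar>g x\<bar> \<le> C" and \<eta>: "integrable lborel \<eta>"
  shows kernel_integrable: "integrable (lborel \<Otimes>\<^sub>M lborel) (\<lambda>(x, y). f x * g y * \<eta> (y - x))"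
    and kernel_Fubini_shift:
      "kernel_pairing \<eta> f g =
       (\<integral>t. \<eta> t * (\<integral>x. f x * g (x + t) \<partial>lborel) \<partial>lborel)"
proof -
  have [measurable]: "f \<in> borel_measurable borel" "\<eta> \<in> borel_measurable borel"
    using f \<eta> by (auto dest: borel_measurable_integrable)
  have abs_\<eta>: "integrable lborel (\<lambda>t. C * \<bar>\<eta> t\<bar>)" using \<eta> by auto
  have bound: "\<bar>f x * g y * \<eta> t\<bar> \<le> \<bar>f x\<bar> * (C * \<bar>\<eta> t\<bar>)" for x y t
    using C[of y] by (auto simp: abs_mult mult.assoc intro!: mult_left_mono mult_right_mono)
  show "integrable (lborel \<Otimes>\<^sub>M lborel) (\<lambda>(x, y). f x * g y * \<eta> (y - x))"
  proof (rule integrable_productI[OF f])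
    show "integrable lborel (\<lambda>y. C * \<bar>\<eta> (y - x)\<bar>)" for x
      using abs_\<eta> lborel_integrable_shift[of "\<lambda>t. C * \<bar>\<eta> t\<bar>" "- x"] by simp
    show "(\<integral>y. C * \<bar>\<eta> (y - x)\<bar> \<partial>lborel) = (\<integral>t. C * \<bar>\<eta> t\<bar> \<partial>lborel)" for x
      using lborel_integral_shift[of "\<lambda>t. C * \<bar>\<eta> t\<bar>" "- x"] by simp
    show "\<bar>case (x, y) of (x, y) \<Rightarrow> f x * g y * \<eta> (y - x)\<bar> \<le> \<bar>f x\<bar> * (C * \<bar>\<eta> (y - x)\<bar>)" for x y
      using bound by simp
  qed measurable
  have int2: "integrable (lborel \<Otimes>\<^sub>M lborel) (\<lambda>(x, t). f x * g (x + t) * \<eta> t)"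
  proof (rule integrable_productI[OF f _ _ abs_\<eta> refl])
    show "\<bar>case (x, t) of (x, t) \<Rightarrow> f x * g (x + t) * \<eta> t\<bar> \<le> \<bar>f x\<bar> * (C * \<bar>\<eta> t\<bar>)" for x t
      using bound by simp
  qed measurable
  have "(\<integral>y. f x * g y * \<eta> (y - x) \<partial>lborel) = (\<integral>t. f x * g (x + t) * \<eta> t \<partial>lborel)" for x
    using lborel_integral_shift[of "\<lambda>y. f x * g y * \<eta> (y - x)" x] by (simp add: add.commute)
  then have "kernel_pairing \<eta> f g =
      (\<integral>x. (\<integral>t. f x * g (x + t) * \<eta> t \<partial>lborel) \<partial>lborel)" by simp
  also have "\<dots> = (\<integral>t. (\<integral>x. f x * g (x + t) * \<eta> t \<partial>lborel) \<partial>lborel)"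
    by (rule lborel_pair.Fubini_integral[symmetric]) (rule int2)
  also have "\<dots> = (\<integral>t. \<eta> t * (\<integral>x. f x * g (x + t) \<partial>lborel) \<partial>lborel)"
    by (simp add: mult.commute)
  finally show "kernel_pairing \<eta> f g =
       (\<integral>t. \<eta> t * (\<integral>x. f x * g (x + t) \<partial>lborel) \<partial>lborel)" .
qed

text \<open>
  By the previous identity it suffices that \<open>\<Phi> t\<close>, the integral of \<open>f x * g (x + t)\<close>, is continuous at
  \<open>t = 0\<close>. Moving the translation to \<open>f\<close>, the difference \<open>\<bar>\<Phi> t - \<Phi> 0\<bar>\<close> is at most \<open>C\<close> times the
  \<open>L\<^sup>1\<close> distance of \<open>f\<close> to its translate by \<open>- t\<close>.
\<close>

lemma kernel_approximation:
  fixes f g :: "'a::euclidean_space \<Rightarrow> real"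
  assumes f: "integrable lborel f" and g [measurable]: "g \<in> borel_measurable borel"
    and C: "\<And>x. \<bar>g x\<bar> \<le> C" and e: "e > 0"
  shows "\<exists>d>0. \<forall>\<eta>. mollifier d \<eta> \<longrightarrow>
     \<bar>kernel_pairing \<eta> f g - (\<integral>x. f x * g x \<partial>lborel)\<bar> \<le> e"
proof -
  have [measurable]: "f \<in> borel_measurable borel"
    using f by (auto dest: borel_measurable_integrable)
  have C0: "0 \<le> C" using C[of 0] by simp
  have int_fg: "integrable lborel (\<lambda>x. h x * k x)"
    if h: "integrable lborel h" and k: "k \<in> borel_measurable borel" "\<And>x. \<bar>k x\<bar> \<le> C" for h k :: "'a \<Rightarrow> real"
  proof (rule Bochner_Integration.integrable_bound[OF integrable_mult_left[OF h, of C]])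
    show "(\<lambda>x. h x * k x) \<in> borel_measurable lborel" using h k by auto
    show "AE x in lborel. norm (h x * k x) \<le> norm (h x * C)"
      using k(2) C0 by (auto intro!: AE_I2 mult_mono simp: abs_mult)
  qed
  define \<Phi> where "\<Phi> t = (\<integral>x. f x * g (x + t) \<partial>lborel)" for t
  \<comment> \<open>The denominator is \<open>C + 1\<close> because \<open>C\<close> may be zero.\<close>
  have e': "e / (C + 1) > 0" using e C0 by simp
  then obtain d where d: "d > 0" "\<And>y. norm y < d \<Longrightarrow> (\<integral>x. \<bar>f (x + y) - f x\<bar> \<partial>lborel) < e / (C + 1)"
    using shift_continuous_integrable[OF f] unfolding shift_continuous_def by meson
  have f_shift: "integrable lborel (\<lambda>x. f (x + t))" for t
    using f by (simp add: lborel_integrable_shift)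
  have \<Phi>_close: "\<bar>\<Phi> t - \<Phi> 0\<bar> \<le> e" if t: "norm t < d" for t
  proof -
    have "\<Phi> t = (\<integral>x. f (x + - t) * g x \<partial>lborel)"
      unfolding \<Phi>_def using lborel_integral_shift[of "\<lambda>x. f (x - t) * g x" t] by simp
    then have "\<Phi> t - \<Phi> 0 = (\<integral>x. (f (x + - t) - f x) * g x \<partial>lborel)"
      unfolding \<Phi>_def using int_fg[OF f_shift g C, of "- t"] int_fg[OF f g C]
      by (simp add: left_diff_distrib Bochner_Integration.integral_diff)
    also have "\<bar>\<dots>\<bar> \<le> (\<integral>x. \<bar>(f (x + - t) - f x) * g x\<bar> \<partial>lborel)"
      by (rule integral_abs_bound)
    also have "\<dots> \<le> (\<integral>x. \<bar>f (x + - t) - f x\<bar> * C \<partial>lborel)"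
      using C by (intro integral_mono integrable_abs int_fg Bochner_Integration.integrable_diff f f_shift g
          integrable_mult_left) (auto simp: abs_mult intro!: mult_left_mono)
    also have "\<dots> = (\<integral>x. \<bar>f (x + - t) - f x\<bar> \<partial>lborel) * C" by simp
    also have "\<dots> \<le> e / (C + 1) * (C + 1)"
      using d(2)[of "- t"] t C0 e' by (intro mult_mono) (auto intro: less_imp_le)
    also have "\<dots> = e" using C0 by simp
    finally show ?thesis .
  qed
  have \<Phi>_bound: "\<bar>\<Phi> t\<bar> \<le> (\<integral>x. \<bar>f x\<bar> * C \<partial>lborel)" for t
  proof -
    have "\<bar>\<Phi> t\<bar> \<le> (\<integral>x. \<bar>f x * g (x + t)\<bar> \<partial>lborel)" unfolding \<Phi>_def by (rule integral_abs_bound)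
    also have "\<dots> \<le> (\<integral>x. \<bar>f x\<bar> * C \<partial>lborel)"
      using C f by (intro integral_mono integrable_abs int_fg integrable_mult_left)
        (auto simp: abs_mult intro!: mult_left_mono)
    finally show ?thesis .
  qed
  have [measurable]: "\<Phi> \<in> borel_measurable borel" unfolding \<Phi>_def by measurable
  show ?thesis
  proof (intro exI[of _ d] conjI allI impI d(1))
    fix \<eta> :: "'a \<Rightarrow> real"
    assume "mollifier d \<eta>"
    then have \<eta>: "integrable lborel \<eta>" "\<forall>x. 0 \<le> \<eta> x" "(\<integral>x. \<eta> x \<partial>lborel) = 1" "\<forall>x. d \<le> norm x \<longrightarrow> \<eta> x = 0"
      by (simp_all add: mollifier_def)
    have \<eta>\<Phi>: "integrable lborel (\<lambda>t. \<eta> t * \<Phi> t)"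
      using \<Phi>_bound by (intro Bochner_Integration.integrable_bound[OF integrable_mult_left[OF \<eta>(1), of "\<integral>x. \<bar>f x\<bar> * C \<partial>lborel"]])
        (use \<eta>(1) C0 in \<open>auto intro!: AE_I2 mult_mono simp: abs_mult\<close>)
    have "kernel_pairing \<eta> f g - (\<integral>x. f x * g x \<partial>lborel)
        = (\<integral>t. \<eta> t * \<Phi> t \<partial>lborel) - \<Phi> 0 * (\<integral>t. \<eta> t \<partial>lborel)"
      unfolding kernel_Fubini_shift[OF f g C \<eta>(1)] \<eta>(3) by (simp add: \<Phi>_def)
    also have "\<dots> = (\<integral>t. \<eta> t * \<Phi> t - \<Phi> 0 * \<eta> t \<partial>lborel)"
      using \<eta>\<Phi> \<eta>(1) by (subst Bochner_Integration.integral_diff) auto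
    also have "\<bar>\<dots>\<bar> \<le> (\<integral>t. \<bar>\<eta> t * \<Phi> t - \<Phi> 0 * \<eta> t\<bar> \<partial>lborel)" by (rule integral_abs_bound)
    also have "\<dots> \<le> (\<integral>t. e * \<eta> t \<partial>lborel)"
    proof (intro integral_mono)
      show "\<bar>\<eta> t * \<Phi> t - \<Phi> 0 * \<eta> t\<bar> \<le> e * \<eta> t" for t
      proof (cases "norm t < d")
        case True
        have "\<bar>\<eta> t * \<Phi> t - \<Phi> 0 * \<eta> t\<bar> = \<bar>\<Phi> t - \<Phi> 0\<bar> * \<eta> t"
          using \<eta>(2) by (metis abs_mult abs_of_nonneg left_diff_distrib mult.commute)
        then show ?thesis using \<Phi>_close[OF True] \<eta>(2) by (simp add: mult_right_mono)
      next
        case False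
        then show ?thesis using \<eta>(4) by simp
      qed
    qed (use \<eta>\<Phi> \<eta>(1) in auto)
    also have "\<dots> = e" using \<eta>(3) by simp
    finally show "\<bar>kernel_pairing \<eta> f g - (\<integral>x. f x * g x \<partial>lborel)\<bar> \<le> e" .
  qed
qed

lemma mollifier_exists:
  assumes "d > 0"
  shows "\<exists>\<eta> :: real ^ 'n::finite \<Rightarrow> real. smooth \<eta> \<and> mollifier d \<eta>"
proof -
  obtain a b :: "real ^ 'n" where ab: "0 \<in> box a b" "box a b \<subseteq> ball 0 d"
    using rational_boxes[OF assms, of 0] by metis
  have sm: "smooth (bump a b)" by (rule smooth_bump)
  have "integrable lborel (\<lambda>x. indicator (cball 0 d) x *\<^sub>R bump a b x)"
    by (intro borel_integrable_compact smooth_continuous sm) auto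
  moreover have "indicator (cball 0 d) x *\<^sub>R bump a b x = bump a b x" for x
    using ab(2) bump_eq_0[of x a b] by (cases "x \<in> cball 0 d") (force simp: subset_iff)+
  ultimately have int: "integrable lborel (bump a b)" by (simp only:)
  define I where "I = (\<integral>x. bump a b x \<partial>lborel)"
  have "I \<noteq> 0"
  proof
    assume "I = 0"
    then have "AE x in lborel. bump a b x = 0"
      unfolding I_def using integral_nonneg_eq_0_iff_AE[OF int] bump_nonneg by auto
    then have "AE x in lborel. x \<notin> box a b"
      by eventually_elim (metis bump_pos_iff less_irrefl)
    then have "emeasure lborel (box a b) = 0"
      by (subst (asm) AE_iff_measurable[of "box a b"]) auto
    then have "negligible (box a b)"
      by (simp add: negligible_iff_null_sets null_sets_def emeasure_completion)
    then show False using open_not_negligible[of "box a b"] ab(1) by (auto simp: open_box)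
  qed
  moreover have "I \<ge> 0" unfolding I_def using bump_nonneg by (intro integral_nonneg_AE) auto
  ultimately have I: "I > 0" by simp
  show ?thesis
    unfolding mollifier_def
  proof (intro exI[of _ "\<lambda>x. (1 / I) * bump a b x"] conjI allI impI)
    show "smooth (\<lambda>x. (1 / I) * bump a b x)" by (intro smooth_mult smooth_const sm)
    show "integrable lborel (\<lambda>x. (1 / I) * bump a b x)" using int by (rule integrable_mult_right)
    show "0 \<le> (1 / I) * bump a b x" for x using I bump_nonneg[of a b x] by simp
    show "(\<integral>x. (1 / I) * bump a b x \<partial>lborel) = 1"
      using I by (simp flip: I_def)
    show "(1 / I) * bump a b x = 0" if "d \<le> norm x" for x
      using ab(2) bump_eq_0[of x a b] that by (force simp: subset_iff)
  qed
qed

section \<open>Weak derivatives\<close>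

lemma test_functions_iff:
  "\<phi> \<in> test_functions \<Omega> \<longleftrightarrow> smooth \<phi> \<and> (\<exists>C. compact C \<and> C \<subseteq> \<Omega> \<and> (\<forall>x. x \<notin> C \<longrightarrow> \<phi> x = 0))"
  by (simp add: test_functions_def smooth_def)

lemma pdiff_eq_0_outside:
  assumes "closed C" "\<And>x. x \<notin> C \<Longrightarrow> \<phi> x = 0" "x \<notin> C"
  shows "pdiff i \<phi> x = 0"
proof -
  have "((\<lambda>x. 0) has_derivative (\<lambda>h. 0)) (at x)" by simp
  then have "(\<phi> has_derivative (\<lambda>h. 0)) (at x)"
    by (rule has_derivative_transform_within_open[of _ _ _ _ "- C"]) (use assms in auto)
  then show ?thesis by (rule pdiff_eqI)
qed

lemma compact_support_bounded:
  assumes "continuous_on UNIV (\<phi> :: real ^ 'n::finite \<Rightarrow> real)" "compact C" "\<And>x. x \<notin> C \<Longrightarrow> \<phi> x = 0"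
  shows "\<exists>M\<ge>0. \<forall>x. \<bar>\<phi> x\<bar> \<le> M"
proof -
  have "bounded (\<phi> ` C)"
    using assms by (intro compact_imp_bounded compact_continuous_image continuous_on_subset[OF assms(1)]) auto
  then obtain M where M: "\<And>x. x \<in> C \<Longrightarrow> \<bar>\<phi> x\<bar> \<le> M" by (auto simp: bounded_iff)
  have "\<bar>\<phi> x\<bar> \<le> max M 0" for x using M[of x] assms(3)[of x] by (cases "x \<in> C") auto
  then show ?thesis by (intro exI[of _ "max M 0"]) simp
qed

lemma integral_lebesgue_on_support:
  fixes h :: "'a::euclidean_space \<Rightarrow> 'b::euclidean_space"
  assumes "\<Omega> \<in> sets lebesgue" "\<And>x. x \<notin> \<Omega> \<Longrightarrow> h x = 0"
  shows "(LINT x|lebesgue_on \<Omega>. h x) = (LINT x|lebesgue. h x)"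
  using assms by (subst integral_restrict_space) (auto intro!: Bochner_Integration.integral_cong simp: indicator_def)

lemma locally_integrable_scaleR:
  fixes f :: "real ^ 'n::finite \<Rightarrow> 'b::euclidean_space"
  assumes f: "locally_integrable \<Omega> f" and \<phi>: "continuous_on UNIV \<phi>"
    and C: "compact C" "C \<subseteq> \<Omega>" "\<And>x. x \<notin> C \<Longrightarrow> \<phi> x = 0"
  shows "integrable lebesgue (\<lambda>x. \<phi> x *\<^sub>R f x)"
proof -
  obtain M where M: "0 \<le> M" "\<And>x. \<bar>\<phi> x\<bar> \<le> M"
    using compact_support_bounded[OF \<phi> C(1,3)] by metis
  have int: "integrable lebesgue (\<lambda>x. indicator C x *\<^sub>R f x)"
    using f C by (auto simp: locally_integrable_def set_integrable_def)
  have "\<phi> \<in> borel_measurable borel" using \<phi> by (rule borel_measurable_continuous_onI)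
  then have [measurable]: "\<phi> \<in> borel_measurable lebesgue" by (simp add: measurable_completion)
  have "integrable lebesgue (\<lambda>x. \<phi> x *\<^sub>R (indicator C x *\<^sub>R f x))"
  proof (rule Bochner_Integration.integrable_bound[OF integrable_scaleR_right[OF int, of M]])
    show "AE x in lebesgue. norm (\<phi> x *\<^sub>R (indicator C x *\<^sub>R f x)) \<le> norm (M *\<^sub>R (indicator C x *\<^sub>R f x))"
      using M by (intro AE_I2) (simp only: norm_scaleR real_norm_def, intro mult_right_mono, auto)
    show "(\<lambda>x. \<phi> x *\<^sub>R (indicator C x *\<^sub>R f x)) \<in> borel_measurable lebesgue"
      by (intro borel_measurable_scaleR borel_measurable_integrable[OF int]) measurable
  qed
  moreover have "\<phi> x *\<^sub>R (indicator C x *\<^sub>R f x) = \<phi> x *\<^sub>R f x" for x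
    using C(3)[of x] by (auto simp: indicator_def)
  ultimately show ?thesis by (simp only:)
qed

lemma test_functions_pdiff:
  assumes "\<phi> \<in> test_functions \<Omega>"
  shows "pdiff i \<phi> \<in> test_functions \<Omega>"
proof -
  obtain C where C: "compact C" "C \<subseteq> \<Omega>" "\<And>x. x \<notin> C \<Longrightarrow> \<phi> x = 0" and sm: "smooth \<phi>"
    using assms by (auto simp: test_functions_iff)
  have "pdiff i \<phi> x = 0" if "x \<notin> C" for x
    using that C(3) by (intro pdiff_eq_0_outside[OF compact_imp_closed[OF C(1)]]) auto
  then show ?thesis
    unfolding test_functions_iff using C(1,2) smooth_pdiff[OF sm] by blast
qed

lemma test_functions_eq_0: "\<phi> \<in> test_functions \<Omega> \<Longrightarrow> x \<notin> \<Omega> \<Longrightarrow> \<phi> x = 0"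
  by (auto simp: test_functions_iff)

lemma test_functions_measurable: "\<phi> \<in> test_functions \<Omega> \<Longrightarrow> \<phi> \<in> borel_measurable borel"
  by (auto simp: test_functions_iff intro: smooth_measurable)

lemma test_functions_bounded:
  assumes "\<phi> \<in> test_functions \<Omega>"
  shows "\<exists>M\<ge>0. \<forall>x. \<bar>\<phi> x\<bar> \<le> M"
proof -
  obtain C where "compact C" "\<And>x. x \<notin> C \<Longrightarrow> \<phi> x = 0" "smooth \<phi>"
    using assms by (auto simp: test_functions_iff)
  then show ?thesis by (intro compact_support_bounded smooth_continuous) auto
qed

lemma test_times_locally_integrable:
  fixes f :: "real ^ 'n::finite \<Rightarrow> 'b::euclidean_space"
  assumes "\<phi> \<in> test_functions \<Omega>" "locally_integrable \<Omega> f"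
  shows "integrable lebesgue (\<lambda>x. \<phi> x *\<^sub>R f x)"
proof -
  obtain C where "compact C" "C \<subseteq> \<Omega>" "\<And>x. x \<notin> C \<Longrightarrow> \<phi> x = 0" "smooth \<phi>"
    using assms(1) by (auto simp: test_functions_iff)
  then show ?thesis using assms(2) by (intro locally_integrable_scaleR smooth_continuous) auto
qed

text \<open>
  Fubini's theorem is applied to products of Borel measures, whereas Sobolev functions are only
  Lebesgue measurable. The passage between the two goes through Borel functions that agree almost
  everywhere.
\<close>

lemma borel_representative:
  fixes h :: "'a::euclidean_space \<Rightarrow> real"
  assumes "h \<in> borel_measurable lebesgue"
  obtains h' where "h' \<in> borel_measurable borel" "AE x in lborel. h x = h' x"
  using completion_ex_borel_measurable_real[OF assms] by auto

lemma borel_representative_integral: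
  fixes h h' :: "'a::euclidean_space \<Rightarrow> real"
  assumes h: "h \<in> borel_measurable lebesgue" and h': "h' \<in> borel_measurable borel"
    and eq: "AE x in lborel. h x = h' x"
  shows "(LINT x|lebesgue. h x) = (LINT x|lborel. h' x)"
    and "integrable lebesgue h \<longleftrightarrow> integrable lborel h'"
proof -
  have h'm: "h' \<in> borel_measurable lebesgue" using h' by (simp add: measurable_completion)
  have eq': "AE x in lebesgue. h x = h' x" using eq by (rule AE_completion)
  show "(LINT x|lebesgue. h x) = (LINT x|lborel. h' x)"
    using integral_cong_AE[OF h h'm eq'] integral_completion[of h' lborel] h' by simp
  show "integrable lebesgue h \<longleftrightarrow> integrable lborel h'"
    using integrable_cong_AE[OF h h'm eq'] integrable_completion[of h' lborel] h' by simp
qed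

lemma test_functions_mult_smooth:
  "\<phi> \<in> test_functions \<Omega> \<Longrightarrow> smooth \<psi> \<Longrightarrow> (\<lambda>x. \<phi> x * \<psi> x) \<in> test_functions \<Omega>"
  unfolding test_functions_iff by (auto intro: smooth_mult)

lemma smooth_reflect: "smooth \<eta> \<Longrightarrow> smooth (\<lambda>x. \<eta> (y - x))"
  using smooth_scale_shift[of \<eta> "-1" y] by simp

lemma pdiff_reflect: "smooth \<eta> \<Longrightarrow> pdiff i (\<lambda>x. \<eta> (y - x)) x = - pdiff i \<eta> (y - x)"
  using pdiff_scale_shift[of \<eta> "-1" x y i] smooth_differentiable[of \<eta> "y - x"] by simp

lemma smooth_translate: "smooth \<eta> \<Longrightarrow> smooth (\<lambda>y. \<eta> (y - x))"
  using smooth_scale_shift[of \<eta> 1 "- x"] by simp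

lemma pdiff_translate: "smooth \<eta> \<Longrightarrow> pdiff i (\<lambda>y. \<eta> (y - x)) y = pdiff i \<eta> (y - x)"
  using pdiff_scale_shift[of \<eta> 1 y "- x" i] smooth_differentiable[of \<eta> "y - x"] by simp

text \<open>
  Let \<open>F\<close> be \<open>g\<close> times the bump function of the box. The function \<open>x \<mapsto> bump a b x * \<eta> (y - x)\<close> is
  a test function for every \<open>y\<close>, so the pairing of \<open>F\<close> with the bounded function \<open>sgn F\<close> vanishes for
  every mollifier. In the limit the integral of \<open>\<bar>F\<bar>\<close> vanishes.
\<close>

lemma fundamental_lemma_box:
  fixes g :: "real ^ 'n::finite \<Rightarrow> real"
  assumes \<Omega>: "open \<Omega>" and g: "locally_integrable \<Omega> g"
    and orth: "\<And>\<phi>. \<phi> \<in> test_functions \<Omega> \<Longrightarrow> (LINT x|lebesgue. \<phi> x * g x) = 0"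
    and box: "cbox a b \<subseteq> \<Omega>"
  shows "AE x in lebesgue. x \<in> box a b \<longrightarrow> g x = 0"
proof -
  have bump_test: "bump a b \<in> test_functions \<Omega>"
    unfolding test_functions_iff using box box_subset_cbox[of a b]
    by (intro conjI exI[of _ "cbox a b"] smooth_bump) (auto intro!: bump_eq_0)
  define F where "F x = bump a b x * g x" for x
  have Fint: "integrable lebesgue F"
    unfolding F_def using test_times_locally_integrable[OF bump_test g] by simp
  obtain F' where F': "F' \<in> borel_measurable borel" "AE x in lborel. F x = F' x"
    using borel_representative[of F] Fint by blast
  note [measurable] = F'(1)
  have F'int: "integrable lborel F'"
    using borel_representative_integral(2)[of F F'] F' Fint by auto
  have conv0: "(LINT x|lborel. F' x * \<eta> (y - x)) = 0" if \<eta>: "smooth \<eta>" for \<eta> y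
  proof -
    have sm: "smooth (\<lambda>x. \<eta> (y - x))" using \<eta> by (rule smooth_reflect)
    then have m: "(\<lambda>x. \<eta> (y - x)) \<in> borel_measurable borel" by (rule smooth_measurable)
    then have ml: "(\<lambda>x. \<eta> (y - x)) \<in> borel_measurable lebesgue" by (simp add: measurable_completion)
    have "(LINT x|lborel. F' x * \<eta> (y - x)) = (LINT x|lebesgue. F x * \<eta> (y - x))"
      by (rule borel_representative_integral(1)[symmetric])
        (use Fint ml m F' in \<open>auto intro!: borel_measurable_times dest: borel_measurable_integrable elim!: eventually_mono\<close>)
    also have "\<dots> = (LINT x|lebesgue. (bump a b x * \<eta> (y - x)) * g x)"
      by (simp add: F_def mult_ac)
    also have "\<dots> = 0"
      using test_functions_mult_smooth[OF bump_test sm] by (rule orth)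
    finally show ?thesis .
  qed
  have s0: "(LINT x|lborel. F' x * sgn (F' x)) = 0"
  proof -
    have "\<bar>LINT x|lborel. F' x * sgn (F' x)\<bar> \<le> e" if "e > 0" for e
    proof -
      have sm: "(\<lambda>x. sgn (F' x)) \<in> borel_measurable borel" by measurable
      have s1: "\<bar>sgn (F' x)\<bar> \<le> 1" for x by (simp add: abs_sgn_eq)
      obtain d where d: "d > 0" and close: "\<forall>\<eta>. mollifier d \<eta> \<longrightarrow>
          \<bar>kernel_pairing \<eta> F' (\<lambda>x. sgn (F' x)) - (\<integral>x. F' x * sgn (F' x) \<partial>lborel)\<bar> \<le> e"
        using kernel_approximation[OF F'int sm s1 \<open>e > 0\<close>] by (elim exE conjE)
      obtain \<eta> :: "real ^ 'n \<Rightarrow> real" where \<eta>: "smooth \<eta>" "mollifier d \<eta>"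
        using mollifier_exists[OF d] by (elim exE conjE)
      have \<eta>int: "integrable lborel \<eta>" using \<eta>(2) by (simp add: mollifier_def)
      have "kernel_pairing \<eta> F' (\<lambda>x. sgn (F' x)) =
          (\<integral>y. (\<integral>x. F' x * sgn (F' y) * \<eta> (y - x) \<partial>lborel) \<partial>lborel)"
        by (rule lborel_pair.Fubini_integral[symmetric]) (rule kernel_integrable[OF F'int sm s1 \<eta>int])
      also have "\<dots> = (\<integral>y. sgn (F' y) * (\<integral>x. F' x * \<eta> (y - x) \<partial>lborel) \<partial>lborel)"
        by (simp add: mult_ac flip: integral_mult_right_zero)
      also have "\<dots> = 0" using conv0[OF \<eta>(1)] by simp
      finally show ?thesis
        using close[THEN spec, THEN mp, OF \<eta>(2)] by simp
    qed
    then have "\<bar>LINT x|lborel. F' x * sgn (F' x)\<bar> \<le> 0"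
      by (rule field_le_epsilon) simp
    then show ?thesis by simp
  qed
  have "(LINT x|lborel. \<bar>F' x\<bar>) = 0"
    using s0 by (simp only: abs_sgn)
  then have "AE x in lborel. F' x = 0"
    using integral_nonneg_eq_0_iff_AE[OF integrable_abs[OF F'int]] by simp
  with F'(2) have "AE x in lborel. x \<in> box a b \<longrightarrow> g x = 0"
    by eventually_elim (metis F_def bump_pos_iff less_irrefl mult_eq_0_iff)
  then show ?thesis by (rule AE_completion)
qed

text \<open>
  Boxes with closure in \<open>\<Omega>\<close> cover \<open>\<Omega>\<close>, and countably many of them suffice.
\<close>

lemma fundamental_lemma:
  fixes g :: "real ^ 'n::finite \<Rightarrow> real"
  assumes \<Omega>: "open \<Omega>" and g: "locally_integrable \<Omega> g"
    and orth: "\<And>\<phi>. \<phi> \<in> test_functions \<Omega> \<Longrightarrow> (LINT x|lebesgue. \<phi> x * g x) = 0"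
  shows "AE x in lebesgue. x \<in> \<Omega> \<longrightarrow> g x = 0"
proof -
  define \<F> where "\<F> = {box a b | a b. cbox a b \<subseteq> \<Omega>}"
  obtain \<F>' where \<F>': "\<F>' \<subseteq> \<F>" "countable \<F>'" "\<Union>\<F>' = \<Union>\<F>"
    by (rule Lindelof[of \<F>]) (auto simp: \<F>_def open_box)
  have cover: "\<Omega> \<subseteq> \<Union>\<F>"
  proof
    fix x assume "x \<in> \<Omega>"
    then obtain e where e: "e > 0" "cball x e \<subseteq> \<Omega>" using \<Omega> open_contains_cball by blast
    obtain a b where ab: "x \<in> box a b" "box a b \<subseteq> ball x e" using rational_boxes[OF e(1), of x] by metis
    then have "closure (box a b) \<subseteq> closure (ball x e)" by (intro closure_mono)
    moreover have "closure (box a b) = cbox a b" using ab(1) by (intro closure_box) auto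
    ultimately have "cbox a b \<subseteq> cball x e" using e(1) by simp
    then have "box a b \<in> \<F>" using e(2) unfolding \<F>_def by blast
    then show "x \<in> \<Union>\<F>" using ab(1) by (rule UnionI)
  qed
  have "AE x in lebesgue. \<forall>B\<in>\<F>'. x \<in> B \<longrightarrow> g x = 0"
    unfolding AE_ball_countable[OF \<F>'(2)]
  proof
    fix B assume "B \<in> \<F>'"
    then obtain a b where "B = box a b" "cbox a b \<subseteq> \<Omega>" using \<F>'(1) by (auto simp: \<F>_def)
    then show "AE x in lebesgue. x \<in> B \<longrightarrow> g x = 0" using fundamental_lemma_box[OF \<Omega> g orth] by simp
  qed
  then show ?thesis by eventually_elim (use cover \<F>'(3) in auto)
qed

lemma is_weak_deriv_pdiff_iff:
  fixes f :: "real ^ 'n::finite \<Rightarrow> 'b::euclidean_space"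
  assumes \<Omega>: "open \<Omega>"
  shows "is_weak_deriv \<Omega> [i] f g \<longleftrightarrow> locally_integrable \<Omega> f \<and> locally_integrable \<Omega> g \<and>
    (\<forall>\<phi>\<in>test_functions \<Omega>. (LINT x|lebesgue. pdiff i \<phi> x *\<^sub>R f x) = - (LINT x|lebesgue. \<phi> x *\<^sub>R g x))"
proof -
  have \<Omega>l: "\<Omega> \<in> sets lebesgue" using \<Omega> by auto
  have "((LINT x|lebesgue_on \<Omega>. pdiff i \<phi> x *\<^sub>R f x) = (LINT x|lebesgue. pdiff i \<phi> x *\<^sub>R f x)) \<and>
     ((LINT x|lebesgue_on \<Omega>. \<phi> x *\<^sub>R g x) = (LINT x|lebesgue. \<phi> x *\<^sub>R g x))"
    if \<phi>: "\<phi> \<in> test_functions \<Omega>" for \<phi>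
  proof -
    note zero = test_functions_eq_0[OF \<phi>] test_functions_eq_0[OF test_functions_pdiff[OF \<phi>]]
    show ?thesis by (intro conjI integral_lebesgue_on_support[OF \<Omega>l]) (simp_all add: zero)
  qed
  then show ?thesis by (auto simp: is_weak_deriv_def)
qed

lemma weak_deriv_unique_real:
  fixes f :: "real ^ 'n::finite \<Rightarrow> real"
  assumes \<Omega>: "open \<Omega>" and g: "is_weak_deriv \<Omega> [i] f g" and h: "is_weak_deriv \<Omega> [i] f h"
  shows "AE x in lebesgue_on \<Omega>. g x = h x"
proof -
  have gl: "locally_integrable \<Omega> g" "locally_integrable \<Omega> h"
    using g h by (auto simp: is_weak_deriv_def)
  have "AE x in lebesgue. x \<in> \<Omega> \<longrightarrow> g x - h x = 0"
  proof (rule fundamental_lemma[OF \<Omega>])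
    show "locally_integrable \<Omega> (\<lambda>x. g x - h x)"
      using gl unfolding locally_integrable_def by (auto intro: set_integral_diff)
    fix \<phi> assume \<phi>: "\<phi> \<in> test_functions \<Omega>"
    have "(LINT x|lebesgue. \<phi> x * g x) = (LINT x|lebesgue. \<phi> x * h x)"
      using g h \<phi> by (simp add: is_weak_deriv_pdiff_iff[OF \<Omega>])
    then show "(LINT x|lebesgue. \<phi> x * (g x - h x)) = 0"
      using test_times_locally_integrable[OF \<phi> gl(1)] test_times_locally_integrable[OF \<phi> gl(2)]
      by (simp add: right_diff_distrib Bochner_Integration.integral_diff)
  qed
  then show ?thesis using \<Omega> by (subst AE_restrict_space_iff) auto
qed

section \<open>The product rule\<close>

text \<open>
  Truncation makes the bound hold everywhere instead of almost everywhere.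
\<close>

lemma Linf_borel_representative:
  fixes g :: "real ^ 'n::finite \<Rightarrow> real"
  assumes \<Omega>: "open \<Omega>" and g: "g \<in> Linf_space \<Omega>"
  shows "\<exists>g' M. g' \<in> borel_measurable borel \<and> (\<forall>x. \<bar>g' x\<bar> \<le> M) \<and>
    (AE x in lborel. x \<in> \<Omega> \<longrightarrow> g x = g' x)"
proof -
  have \<Omega>l: "\<Omega> \<inter> space lebesgue \<in> sets lebesgue" using \<Omega> by auto
  obtain M where M: "AE x in lebesgue_on \<Omega>. norm (g x) \<le> M"
    using g by (auto simp: Linf_space_def)
  have "(\<lambda>x. indicator \<Omega> x *\<^sub>R g x) \<in> borel_measurable lebesgue"
    using g borel_measurable_restrict_space_iff[OF \<Omega>l, of g] by (simp add: Linf_space_def)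
  then obtain g0 where g0: "g0 \<in> borel_measurable borel" "AE x in lborel. indicator \<Omega> x *\<^sub>R g x = g0 x"
    by (rule borel_representative)
  note [measurable] = g0(1)
  define g' where "g' x = max (- \<bar>M\<bar>) (min \<bar>M\<bar> (g0 x))" for x
  have "AE x in lborel. x \<in> \<Omega> \<longrightarrow> norm (g x) \<le> M"
    using M AE_restrict_space_iff[OF \<Omega>l, of "\<lambda>x. norm (g x) \<le> M"] by (simp add: AE_completion_iff)
  with g0(2) have "AE x in lborel. x \<in> \<Omega> \<longrightarrow> g x = g' x"
    by eventually_elim (auto simp: g'_def)
  moreover have "g' \<in> borel_measurable borel" unfolding g'_def by measurable
  moreover have "\<bar>g' x\<bar> \<le> \<bar>M\<bar>" for x unfolding g'_def by auto
  ultimately show ?thesis by blast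
qed

lemma locally_integrable_mult_Linf:
  fixes f g :: "real ^ 'n::finite \<Rightarrow> real"
  assumes \<Omega>: "open \<Omega>" and f: "locally_integrable \<Omega> f" and g: "g \<in> Linf_space \<Omega>"
  shows "locally_integrable \<Omega> (\<lambda>x. f x * g x)"
  unfolding locally_integrable_def
proof (intro allI impI)
  fix C assume C: "compact C \<and> C \<subseteq> \<Omega>"
  obtain g' M where g': "g' \<in> borel_measurable borel" "\<And>x. \<bar>g' x\<bar> \<le> M"
    "AE x in lborel. x \<in> \<Omega> \<longrightarrow> g x = g' x" using Linf_borel_representative[OF \<Omega> g] by blast
  have g'l [measurable]: "g' \<in> borel_measurable lebesgue" using g'(1) by (simp add: measurable_completion)
  have f_int: "integrable lebesgue (\<lambda>x. indicator C x *\<^sub>R f x)"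
    using f C by (auto simp: locally_integrable_def set_integrable_def)
  have [measurable]: "(\<lambda>x. indicator C x *\<^sub>R f x) \<in> borel_measurable lebesgue"
    using f_int by (rule borel_measurable_integrable)
  have M0: "0 \<le> M" using g'(2)[of 0] by simp
  have int: "integrable lebesgue (\<lambda>x. (indicator C x *\<^sub>R f x) * g' x)"
  proof (rule Bochner_Integration.integrable_bound[OF integrable_mult_left[OF f_int, of M]])
    show "AE x in lebesgue. norm ((indicator C x *\<^sub>R f x) * g' x) \<le> norm ((indicator C x *\<^sub>R f x) * M)"
      using g'(2) M0 by (intro AE_I2) (auto simp: abs_mult intro!: mult_mono)
  qed measurable
  have ae: "AE x in lebesgue. (indicator C x *\<^sub>R f x) * g' x = indicator C x *\<^sub>R (f x * g x)"
    using AE_completion[OF g'(3)] by eventually_elim (use C in \<open>auto simp: indicator_def\<close>)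
  have "(\<lambda>x. indicator C x *\<^sub>R (f x * g x)) \<in> borel_measurable lebesgue"
    by (rule borel_measurable_AE[OF borel_measurable_integrable[OF int] ae])
  then have "integrable lebesgue (\<lambda>x. indicator C x *\<^sub>R (f x * g x))"
    by (rule integrable_cong_AE_imp[OF int]) (use ae in \<open>auto elim: eventually_mono\<close>)
  then show "(\<lambda>x. f x * g x) absolutely_integrable_on C"
    by (simp add: set_integrable_def)
qed

text \<open>
  Doubling of variables. Consider the pairing of \<open>\<partial>\<^sub>i\<phi> x * f x\<close> with \<open>g y\<close> for a mollifier \<open>\<eta>\<close>. For
  fixed \<open>y\<close>, the weak derivative of \<open>f\<close> is tested with \<open>\<phi> x * \<eta> (y - x)\<close>; this moves the derivative
  from \<open>\<phi>\<close> to \<open>f\<close> and to \<open>\<eta>\<close>. For fixed \<open>x\<close> in the support of \<open>\<phi>\<close>, the weak derivative of \<open>g\<close> is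
  tested with \<open>\<eta> (y - x)\<close>; this moves the derivative from \<open>\<eta>\<close> to \<open>g\<close>. The resulting identity of
  pairings turns into the product rule when the support of \<open>\<eta>\<close> shrinks.
\<close>

lemma weak_deriv_product:
  fixes f g :: "real ^ 'n::finite \<Rightarrow> real"
  assumes \<Omega>: "open \<Omega>"
    and f: "is_weak_deriv \<Omega> [i] f f'" and g: "is_weak_deriv \<Omega> [i] g g'"
    and gB: "g \<in> Linf_space \<Omega>" "g' \<in> Linf_space \<Omega>"
  shows "is_weak_deriv \<Omega> [i] (\<lambda>x. f x * g x) (\<lambda>x. f' x * g x + f x * g' x)"
  unfolding is_weak_deriv_pdiff_iff[OF \<Omega>]
proof (intro conjI ballI)
  have fl: "locally_integrable \<Omega> f" "locally_integrable \<Omega> f'"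
    using f by (auto simp: is_weak_deriv_def)
  show fgl: "locally_integrable \<Omega> (\<lambda>x. f x * g x)"
    by (rule locally_integrable_mult_Linf[OF \<Omega> fl(1) gB(1)])
  have fgl1: "locally_integrable \<Omega> (\<lambda>x. f' x * g x)"
    by (rule locally_integrable_mult_Linf[OF \<Omega> fl(2) gB(1)])
  have fgl2: "locally_integrable \<Omega> (\<lambda>x. f x * g' x)"
    by (rule locally_integrable_mult_Linf[OF \<Omega> fl(1) gB(2)])
  show "locally_integrable \<Omega> (\<lambda>x. f' x * g x + f x * g' x)"
    using fgl1 fgl2 unfolding locally_integrable_def by (auto intro: set_integral_add)
  fix \<phi> assume \<phi>: "\<phi> \<in> test_functions \<Omega>"
  obtain C where C: "compact C" "C \<subseteq> \<Omega>" "\<And>x. x \<notin> C \<Longrightarrow> \<phi> x = 0" and sm: "smooth \<phi>"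
    using \<phi> by (auto simp: test_functions_iff)
  note \<phi>' = test_functions_pdiff[OF \<phi>, of i]
  note int_test = test_times_locally_integrable[of _ \<Omega> "_ :: real ^ 'n \<Rightarrow> real", simplified]
  obtain G M where G: "G \<in> borel_measurable borel" "\<And>x. \<bar>G x\<bar> \<le> M"
    "AE x in lborel. x \<in> \<Omega> \<longrightarrow> g x = G x" using Linf_borel_representative[OF \<Omega> gB(1)] by blast
  obtain G' M' where G': "G' \<in> borel_measurable borel" "\<And>x. \<bar>G' x\<bar> \<le> M'"
    "AE x in lborel. x \<in> \<Omega> \<longrightarrow> g' x = G' x" using Linf_borel_representative[OF \<Omega> gB(2)] by blast
  define F0 F1 F2 where "F0 x = pdiff i \<phi> x * f x" and "F1 x = \<phi> x * f' x" and "F2 x = \<phi> x * f x" for x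
  have F0: "integrable lebesgue F0" unfolding F0_def by (rule int_test[OF \<phi>' fl(1)])
  have F1: "integrable lebesgue F1" unfolding F1_def by (rule int_test[OF \<phi> fl(2)])
  have F2: "integrable lebesgue F2" unfolding F2_def by (rule int_test[OF \<phi> fl(1)])
  have rep: "\<exists>B. integrable lborel B \<and> (AE x in lborel. F x = B x)"
    if "integrable lebesgue F" for F :: "real ^ 'n \<Rightarrow> real"
  proof -
    have Fm: "F \<in> borel_measurable lebesgue" using that by (rule borel_measurable_integrable)
    then obtain B where "B \<in> borel_measurable borel" "AE x in lborel. F x = B x"
      by (rule borel_representative)
    then show ?thesis using borel_representative_integral(2)[OF Fm] that by blast
  qed
  obtain B0 where B0: "integrable lborel B0" "AE x in lborel. F0 x = B0 x" using rep[OF F0] by blast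
  obtain B1 where B1: "integrable lborel B1" "AE x in lborel. F1 x = B1 x" using rep[OF F1] by blast
  obtain B2 where B2: "integrable lborel B2" "AE x in lborel. F2 x = B2 x" using rep[OF F2] by blast
  have Bm [measurable]: "B0 \<in> borel_measurable borel" "B1 \<in> borel_measurable borel" "B2 \<in> borel_measurable borel"
    using B0 B1 B2 by (auto dest: borel_measurable_integrable)
  note [measurable] = G(1) G'(1)
  \<comment> \<open>Points within distance \<open>d\<close> of the support \<open>C\<close> have to be in \<open>\<Omega>\<close> for \<open>\<eta> (y - x)\<close> to be a test function in \<open>y\<close>.\<close>
  have key: "kernel_pairing \<eta> B0 G =
     - kernel_pairing \<eta> B1 G
     - kernel_pairing \<eta> B2 G'"
    if \<eta>: "smooth \<eta>" "integrable lborel \<eta>" "\<And>x. d \<le> norm x \<Longrightarrow> \<eta> x = 0"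
      and d: "\<And>x y. x \<in> C \<Longrightarrow> norm (y - x) \<le> d \<Longrightarrow> y \<in> \<Omega>" for \<eta> and d :: real
  proof -
    note \<eta>' = smooth_pdiff[OF \<eta>(1), of i]
    have \<eta>'0: "pdiff i \<eta> x = 0" if "x \<notin> cball 0 d" for x
      using that \<eta>(3) by (intro pdiff_eq_0_outside[of "cball 0 d"]) auto
    have \<eta>'int: "integrable lborel (pdiff i \<eta>)"
    proof -
      have "integrable lborel (\<lambda>x. indicator (cball 0 d) x *\<^sub>R pdiff i \<eta> x)"
        by (intro borel_integrable_compact smooth_continuous \<eta>') auto
      moreover have "indicator (cball 0 d) x *\<^sub>R pdiff i \<eta> x = pdiff i \<eta> x" for x
        using \<eta>'0[of x] by (cases "x \<in> cball 0 d") auto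
      ultimately show ?thesis by (simp only:)
    qed
    have [measurable]: "\<eta> \<in> borel_measurable borel" "pdiff i \<eta> \<in> borel_measurable borel"
      using \<eta>(1) \<eta>' by (auto intro: smooth_measurable)
    have swap: "kernel_pairing k B H = (\<integral>y. H y * (\<integral>x. B x * k (y - x) \<partial>lborel) \<partial>lborel)"
      if "integrable lborel B" "H \<in> borel_measurable borel" "\<And>x. \<bar>H x\<bar> \<le> N" "integrable lborel k"
      for B H k :: "real ^ 'n \<Rightarrow> real" and N
      using lborel_pair.Fubini_integral[OF kernel_integrable[OF that]]
      by (simp add: mult_ac flip: integral_mult_right_zero)
    have leb: "(\<integral>x. B x * k (y - x) \<partial>lborel) = (LINT x|lebesgue. F x * k (y - x))"
      "integrable lebesgue (\<lambda>x. F x * k (y - x))"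
      if B: "integrable lborel B" "AE x in lborel. F x = B x" and F: "integrable lebesgue F"
        and k: "smooth k" "\<And>x. x \<notin> cball 0 d \<Longrightarrow> k x = 0"
      for B F k :: "real ^ 'n \<Rightarrow> real" and y
    proof -
      have km: "(\<lambda>x. k (y - x)) \<in> borel_measurable borel"
        by (rule smooth_measurable[OF smooth_reflect[OF k(1)]])
      have kl: "(\<lambda>x. k (y - x)) \<in> borel_measurable lebesgue" using km by (simp add: measurable_completion)
      have Fm: "F \<in> borel_measurable lebesgue" using F by (rule borel_measurable_integrable)
      show "(\<integral>x. B x * k (y - x) \<partial>lborel) = (LINT x|lebesgue. F x * k (y - x))"
        by (rule borel_representative_integral(1)[symmetric])
          (use B Fm km kl in \<open>auto dest: borel_measurable_integrable elim!: eventually_mono\<close>)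
      obtain N where N: "\<And>x. \<bar>k x\<bar> \<le> N" "0 \<le> N"
        using compact_support_bounded[OF smooth_continuous[OF k(1)] compact_cball k(2)] by metis
      show "integrable lebesgue (\<lambda>x. F x * k (y - x))"
        by (rule Bochner_Integration.integrable_bound[OF integrable_mult_left[OF F, of N]])
          (use Fm kl N in \<open>auto intro!: AE_I2 mult_left_mono simp: abs_mult\<close>)
    qed
    \<comment> \<open>The weak derivative of \<open>f\<close>, tested in \<open>x\<close> with \<open>y\<close> fixed.\<close>
    have inner: "(\<integral>x. B0 x * \<eta> (y - x) \<partial>lborel) =
        - (\<integral>x. B1 x * \<eta> (y - x) \<partial>lborel) + (\<integral>x. B2 x * pdiff i \<eta> (y - x) \<partial>lborel)" for y
    proof -
      have \<eta>0: "\<And>x. x \<notin> cball 0 d \<Longrightarrow> \<eta> x = 0" using \<eta>(3) by auto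
      have "(LINT x|lebesgue. pdiff i (\<lambda>x. \<phi> x * \<eta> (y - x)) x * f x) = - (LINT x|lebesgue. (\<phi> x * \<eta> (y - x)) * f' x)"
        using f test_functions_mult_smooth[OF \<phi> smooth_reflect[OF \<eta>(1), of y]]
        by (simp add: is_weak_deriv_pdiff_iff[OF \<Omega>])
      moreover have "pdiff i (\<lambda>x. \<phi> x * \<eta> (y - x)) x * f x = F0 x * \<eta> (y - x) - F2 x * pdiff i \<eta> (y - x)" for x
        by (subst pdiff_mult) (simp_all add: smooth_differentiable sm smooth_reflect \<eta>(1) pdiff_reflect
            F0_def F2_def algebra_simps)
      moreover have "(\<phi> x * \<eta> (y - x)) * f' x = F1 x * \<eta> (y - x)" for x
        by (simp add: F1_def mult_ac)
      ultimately have "(LINT x|lebesgue. F0 x * \<eta> (y - x)) - (LINT x|lebesgue. F2 x * pdiff i \<eta> (y - x))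
          = - (LINT x|lebesgue. F1 x * \<eta> (y - x))"
        using leb(2)[OF B0 F0 \<eta>(1) \<eta>0, of y] leb(2)[OF B2 F2 \<eta>' \<eta>'0, of y]
        by (simp add: Bochner_Integration.integral_diff)
      then show ?thesis
        using leb(1)[OF B0 F0 \<eta>(1) \<eta>0, of y] leb(1)[OF B1 F1 \<eta>(1) \<eta>0, of y] leb(1)[OF B2 F2 \<eta>' \<eta>'0, of y]
        by simp
    qed
    have int_y: "integrable lborel (\<lambda>y. G y * (\<integral>x. B x * k (y - x) \<partial>lborel))"
      if "integrable lborel B" "integrable lborel k" for B k :: "real ^ 'n \<Rightarrow> real"
      using lborel_pair.integrable_snd[OF kernel_integrable[OF that(1) G(1,2) that(2)]]
      by (simp add: mult_ac flip: integral_mult_right_zero)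
    have "kernel_pairing \<eta> B0 G =
       (\<integral>y. - (G y * (\<integral>x. B1 x * \<eta> (y - x) \<partial>lborel)) + G y * (\<integral>x. B2 x * pdiff i \<eta> (y - x) \<partial>lborel) \<partial>lborel)"
      unfolding swap[OF B0(1) G(1,2) \<eta>(2)] inner by (simp add: algebra_simps)
    also have "\<dots> = - (\<integral>y. G y * (\<integral>x. B1 x * \<eta> (y - x) \<partial>lborel) \<partial>lborel)
        + (\<integral>y. G y * (\<integral>x. B2 x * pdiff i \<eta> (y - x) \<partial>lborel) \<partial>lborel)"
      using int_y[OF B1(1) \<eta>(2)] int_y[OF B2(1) \<eta>'int]
      by (subst Bochner_Integration.integral_add) auto
    also have "\<dots> = - kernel_pairing \<eta> B1 G
        + kernel_pairing (pdiff i \<eta>) B2 G"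
      by (simp add: swap[OF B1(1) G(1,2) \<eta>(2)] swap[OF B2(1) G(1,2) \<eta>'int])
    also have "kernel_pairing (pdiff i \<eta>) B2 G =
        (\<integral>x. - (\<integral>y. B2 x * G' y * \<eta> (y - x) \<partial>lborel) \<partial>lborel)"
    proof (rule integral_cong_AE)
      have *: "(\<integral>y. B2 x * G y * pdiff i \<eta> (y - x) \<partial>lborel) = - (\<integral>y. B2 x * G' y * \<eta> (y - x) \<partial>lborel)"
        if "F2 x = B2 x" for x
      proof (cases "x \<in> C")
        case False
        then have "B2 x = 0" using that C(3) by (simp add: F2_def)
        then show ?thesis by simp
      next
        case True
        \<comment> \<open>The weak derivative of \<open>g\<close>, tested in \<open>y\<close> with \<open>x\<close> fixed.\<close>
        have test: "(\<lambda>y. \<eta> (y - x)) \<in> test_functions \<Omega>"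
          unfolding test_functions_iff
        proof (intro conjI exI[of _ "cball x d"] allI impI smooth_translate \<eta>(1))
          show "cball x d \<subseteq> \<Omega>" using d[OF True] by (auto simp: dist_norm norm_minus_commute)
          show "\<eta> (y - x) = 0" if "y \<notin> cball x d" for y
            using \<eta>(3)[of "y - x"] that by (simp add: dist_norm norm_minus_commute)
        qed simp
        have sup: "\<eta> (y - x) = 0 \<and> pdiff i \<eta> (y - x) = 0" if "y \<notin> \<Omega>" for y
        proof -
          have "\<not> norm (y - x) \<le> d" using d[OF True, of y] that by blast
          then show ?thesis using \<eta>(3)[of "y - x"] \<eta>'0[of "y - x"] by simp
        qed
        have rep_int: "(\<integral>y. k (y - x) * G y \<partial>lborel) = (LINT y|lebesgue. k (y - x) * g y)"
          if k: "smooth k" "\<And>y. y \<notin> \<Omega> \<Longrightarrow> k (y - x) = 0" and GG: "G \<in> borel_measurable borel"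
            "AE x in lborel. x \<in> \<Omega> \<longrightarrow> g x = G x" for k G g :: "real ^ 'n \<Rightarrow> real"
        proof -
          have km: "(\<lambda>y. k (y - x)) \<in> borel_measurable borel"
            by (rule smooth_measurable[OF smooth_translate[OF k(1)]])
          have ae: "AE y in lborel. k (y - x) * G y = k (y - x) * g y"
            using GG(2) by eventually_elim (use k(2) in force)
          have Gm: "(\<lambda>y. k (y - x) * G y) \<in> borel_measurable borel" using km GG(1) by measurable
          then have Gl: "(\<lambda>y. k (y - x) * G y) \<in> borel_measurable lebesgue" by (simp add: measurable_completion)
          have "(\<lambda>y. k (y - x) * g y) \<in> borel_measurable lebesgue"
            by (rule borel_measurable_AE[OF Gl AE_completion[OF ae]])
          moreover have "AE y in lborel. k (y - x) * g y = k (y - x) * G y"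
            using ae by eventually_elim auto
          ultimately show ?thesis using borel_representative_integral(1)[OF _ Gm] by simp
        qed
        have "(\<integral>y. pdiff i \<eta> (y - x) * G y \<partial>lborel) = - (\<integral>y. \<eta> (y - x) * G' y \<partial>lborel)"
        proof -
          have "(\<integral>y. pdiff i \<eta> (y - x) * G y \<partial>lborel) = (LINT y|lebesgue. pdiff i \<eta> (y - x) * g y)"
            by (rule rep_int[OF \<eta>' _ G(1,3)]) (use sup in blast)
          moreover have "(\<integral>y. \<eta> (y - x) * G' y \<partial>lborel) = (LINT y|lebesgue. \<eta> (y - x) * g' y)"
            by (rule rep_int[OF \<eta>(1) _ G'(1,3)]) (use sup in blast)
          moreover have "(LINT y|lebesgue. pdiff i (\<lambda>y. \<eta> (y - x)) y * g y) = - (LINT y|lebesgue. \<eta> (y - x) * g' y)"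
            using g test by (simp add: is_weak_deriv_pdiff_iff[OF \<Omega>])
          ultimately show ?thesis by (simp add: pdiff_translate[OF \<eta>(1)])
        qed
        then have "B2 x * (\<integral>y. pdiff i \<eta> (y - x) * G y \<partial>lborel) = - (B2 x * (\<integral>y. \<eta> (y - x) * G' y \<partial>lborel))"
          by simp
        then show ?thesis by (simp add: mult_ac flip: integral_mult_right_zero)
      qed
      show "AE x in lborel. (\<integral>y. B2 x * G y * pdiff i \<eta> (y - x) \<partial>lborel) = - (\<integral>y. B2 x * G' y * \<eta> (y - x) \<partial>lborel)"
        using B2(2) by eventually_elim (rule *)
    qed measurable
    finally show ?thesis by simp
  qed
  have bound: "\<bar>(\<integral>x. B0 x * G x \<partial>lborel) + (\<integral>x. B1 x * G x \<partial>lborel) + (\<integral>x. B2 x * G' x \<partial>lborel)\<bar> \<le> 3 * e"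
    if e: "e > 0" for e
  proof -
    obtain d0 where d0: "d0 > 0" and c0: "\<forall>\<eta>. mollifier d0 \<eta> \<longrightarrow>
       \<bar>kernel_pairing \<eta> B0 G - (\<integral>x. B0 x * G x \<partial>lborel)\<bar> \<le> e"
      using kernel_approximation[OF B0(1) G(1,2) e] by (elim exE conjE)
    obtain d1 where d1: "d1 > 0" and c1: "\<forall>\<eta>. mollifier d1 \<eta> \<longrightarrow>
       \<bar>kernel_pairing \<eta> B1 G - (\<integral>x. B1 x * G x \<partial>lborel)\<bar> \<le> e"
      using kernel_approximation[OF B1(1) G(1,2) e] by (elim exE conjE)
    obtain d2 where d2: "d2 > 0" and c2: "\<forall>\<eta>. mollifier d2 \<eta> \<longrightarrow>
       \<bar>kernel_pairing \<eta> B2 G' - (\<integral>x. B2 x * G' x \<partial>lborel)\<bar> \<le> e"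
      using kernel_approximation[OF B2(1) G'(1,2) e] by (elim exE conjE)
    obtain d3 where d3: "d3 > 0" "\<And>x y. x \<in> C \<Longrightarrow> norm (y - x) < d3 \<Longrightarrow> y \<in> \<Omega>"
      using compact_in_open_separated[OF C(1) \<Omega> C(2)] by metis
    \<comment> \<open>Half of \<open>d3\<close>, because the closed ball of radius \<open>d\<close> has to stay inside \<open>\<Omega>\<close>.\<close>
    define d where "d = min (min d0 d1) (min d2 (d3 / 2))"
    have d: "d > 0" "d \<le> d0" "d \<le> d1" "d \<le> d2" "d < d3" using d0 d1 d2 d3(1) by (auto simp: d_def)
    obtain \<eta> :: "real ^ 'n \<Rightarrow> real" where \<eta>: "smooth \<eta>" "mollifier d \<eta>"
      using mollifier_exists[OF d(1)] by (elim exE conjE)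
    have "kernel_pairing \<eta> B0 G =
     - kernel_pairing \<eta> B1 G
     - kernel_pairing \<eta> B2 G'"
    proof (rule key[OF \<eta>(1)])
      show "integrable lborel \<eta>" using \<eta>(2) by (simp add: mollifier_def)
      show "\<eta> x = 0" if "d \<le> norm x" for x using \<eta>(2) that by (simp add: mollifier_def)
      show "y \<in> \<Omega>" if "x \<in> C" "norm (y - x) \<le> d" for x y using d3(2)[OF that(1)] that(2) d(5) by auto
    qed
    then show ?thesis
      using c0[THEN spec, THEN mp, OF mollifier_mono[OF \<eta>(2) d(2)]]
        c1[THEN spec, THEN mp, OF mollifier_mono[OF \<eta>(2) d(3)]]
        c2[THEN spec, THEN mp, OF mollifier_mono[OF \<eta>(2) d(4)]]
      by linarith
  qed
  have "\<bar>(\<integral>x. B0 x * G x \<partial>lborel) + (\<integral>x. B1 x * G x \<partial>lborel) + (\<integral>x. B2 x * G' x \<partial>lborel)\<bar> \<le> 0"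
  proof (rule field_le_epsilon)
    show "\<bar>(\<integral>x. B0 x * G x \<partial>lborel) + (\<integral>x. B1 x * G x \<partial>lborel) + (\<integral>x. B2 x * G' x \<partial>lborel)\<bar> \<le> 0 + e"
      if "e > 0" for e using bound[of "e / 3"] that by simp
  qed
  then have lim: "(\<integral>x. B0 x * G x \<partial>lborel) = - (\<integral>x. B1 x * G x \<partial>lborel) - (\<integral>x. B2 x * G' x \<partial>lborel)"
    by simp
  have to_lebesgue: "(\<integral>x. B x * H x \<partial>lborel) = (LINT x|lebesgue. \<psi> x * (p x * q x))"
    if B: "B \<in> borel_measurable borel" "AE x in lborel. \<psi> x * p x = B x"
      and H: "H \<in> borel_measurable borel" "AE x in lborel. x \<in> \<Omega> \<longrightarrow> q x = H x"
      and \<psi>: "\<psi> \<in> test_functions \<Omega>" for B H \<psi> p q :: "real ^ 'n \<Rightarrow> real"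
  proof -
    have BH: "(\<lambda>x. B x * H x) \<in> borel_measurable borel" using B H by measurable
    have ae: "AE x in lborel. B x * H x = \<psi> x * (p x * q x)"
      using B(2) H(2) by eventually_elim (metis test_functions_eq_0[OF \<psi>] mult.assoc mult_zero_left)
    have "(\<lambda>x. B x * H x) \<in> borel_measurable lebesgue" using BH by (simp add: measurable_completion)
    then have "(\<lambda>x. \<psi> x * (p x * q x)) \<in> borel_measurable lebesgue"
      by (rule borel_measurable_AE[OF _ AE_completion[OF ae]])
    moreover have "AE x in lborel. \<psi> x * (p x * q x) = B x * H x"
      using ae by eventually_elim auto
    ultimately show ?thesis using borel_representative_integral(1)[OF _ BH] by simp
  qed
  have "(LINT x|lebesgue. \<phi> x * (f' x * g x + f x * g' x)) =
      (LINT x|lebesgue. \<phi> x * (f' x * g x)) + (LINT x|lebesgue. \<phi> x * (f x * g' x))"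
    using int_test[OF \<phi> fgl1] int_test[OF \<phi> fgl2]
    by (simp add: distrib_left Bochner_Integration.integral_add)
  then show "(LINT x|lebesgue. pdiff i \<phi> x *\<^sub>R (f x * g x)) = - (LINT x|lebesgue. \<phi> x *\<^sub>R (f' x * g x + f x * g' x))"
    using lim to_lebesgue[OF Bm(1) B0(2)[unfolded F0_def] G(1,3) \<phi>'] to_lebesgue[OF Bm(2) B1(2)[unfolded F1_def] G(1,3) \<phi>]
      to_lebesgue[OF Bm(3) B2(2)[unfolded F2_def] G'(1,3) \<phi>] by simp
qed

section \<open>The Sobolev space of order one\<close>

lemma locally_integrable_componentwise:
  fixes f :: "real ^ 'n::finite \<Rightarrow> 'b::euclidean_space"
  shows "locally_integrable \<Omega> f \<longleftrightarrow> (\<forall>b\<in>Basis. locally_integrable \<Omega> (\<lambda>x. f x \<bullet> b))"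
  unfolding locally_integrable_def absolutely_integrable_componentwise_iff[where f = f] by blast

lemma is_weak_deriv_componentwise:
  fixes f g :: "real ^ 'n::finite \<Rightarrow> 'b::euclidean_space"
  assumes \<Omega>: "open \<Omega>"
  shows "is_weak_deriv \<Omega> [i] f g \<longleftrightarrow>
    (\<forall>b\<in>Basis. is_weak_deriv \<Omega> [i] (\<lambda>x. f x \<bullet> b) (\<lambda>x. g x \<bullet> b))"
proof -
  have *: "(LINT x|lebesgue. pdiff i \<phi> x *\<^sub>R f x) = - (LINT x|lebesgue. \<phi> x *\<^sub>R g x) \<longleftrightarrow>
     (\<forall>b\<in>Basis. (LINT x|lebesgue. pdiff i \<phi> x *\<^sub>R (f x \<bullet> b)) = - (LINT x|lebesgue. \<phi> x *\<^sub>R (g x \<bullet> b)))"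
    if fg: "locally_integrable \<Omega> f" "locally_integrable \<Omega> g" and \<phi>: "\<phi> \<in> test_functions \<Omega>" for \<phi>
  proof -
    note int = test_times_locally_integrable[OF test_functions_pdiff[OF \<phi>] fg(1), of i]
      test_times_locally_integrable[OF \<phi> fg(2)]
    have "(LINT x|lebesgue. pdiff i \<phi> x *\<^sub>R (f x \<bullet> b)) = (LINT x|lebesgue. pdiff i \<phi> x *\<^sub>R f x) \<bullet> b"
      "(LINT x|lebesgue. \<phi> x *\<^sub>R (g x \<bullet> b)) = (LINT x|lebesgue. \<phi> x *\<^sub>R g x) \<bullet> b" for b
      using integral_inner_left[of b, OF int(1)] integral_inner_left[of b, OF int(2)] by simp_all
    then show ?thesis by (subst euclidean_eq_iff) (simp add: inner_minus_left)
  qed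
  show ?thesis
    unfolding is_weak_deriv_pdiff_iff[OF \<Omega>] locally_integrable_componentwise[of _ f]
      locally_integrable_componentwise[of _ g]
    using * locally_integrable_componentwise[of _ f] locally_integrable_componentwise[of _ g] by blast
qed

lemma weak_deriv_unique:
  fixes f :: "real ^ 'n::finite \<Rightarrow> 'b::euclidean_space"
  assumes \<Omega>: "open \<Omega>" and g: "is_weak_deriv \<Omega> [i] f g" and h: "is_weak_deriv \<Omega> [i] f h"
  shows "AE x in lebesgue_on \<Omega>. g x = h x"
proof -
  have "AE x in lebesgue_on \<Omega>. \<forall>b\<in>Basis. g x \<bullet> b = h x \<bullet> b"
  proof (rule AE_finite_allI)
    show "AE x in lebesgue_on \<Omega>. g x \<bullet> b = h x \<bullet> b" if "b \<in> Basis" for b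
    proof (rule weak_deriv_unique_real[OF \<Omega>])
      show "is_weak_deriv \<Omega> [i] (\<lambda>x. f x \<bullet> b) (\<lambda>x. g x \<bullet> b)"
        "is_weak_deriv \<Omega> [i] (\<lambda>x. f x \<bullet> b) (\<lambda>x. h x \<bullet> b)"
        using g h that is_weak_deriv_componentwise[OF \<Omega>] by blast+
    qed
  qed simp
  then show ?thesis by eventually_elim (rule euclidean_eqI, blast)
qed

lemma is_weak_deriv_add:
  fixes f f' g g' :: "real ^ 'n::finite \<Rightarrow> 'b::euclidean_space"
  assumes \<Omega>: "open \<Omega>" and f: "is_weak_deriv \<Omega> [i] f f'" and g: "is_weak_deriv \<Omega> [i] g g'"
  shows "is_weak_deriv \<Omega> [i] (\<lambda>x. f x + g x) (\<lambda>x. f' x + g' x)"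
  unfolding is_weak_deriv_pdiff_iff[OF \<Omega>]
proof (intro conjI ballI)
  have l: "locally_integrable \<Omega> f" "locally_integrable \<Omega> f'" "locally_integrable \<Omega> g" "locally_integrable \<Omega> g'"
    using f g by (auto simp: is_weak_deriv_def)
  then show "locally_integrable \<Omega> (\<lambda>x. f x + g x)" "locally_integrable \<Omega> (\<lambda>x. f' x + g' x)"
    unfolding locally_integrable_def by (auto intro: set_integral_add)
  fix \<phi> assume \<phi>: "\<phi> \<in> test_functions \<Omega>"
  note i0 = test_times_locally_integrable[OF \<phi>]
    and i1 = test_times_locally_integrable[OF test_functions_pdiff[OF \<phi>, of i]]
  show "(LINT x|lebesgue. pdiff i \<phi> x *\<^sub>R (f x + g x)) = - (LINT x|lebesgue. \<phi> x *\<^sub>R (f' x + g' x))"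
    using f g \<phi> i0[OF l(2)] i0[OF l(4)] i1[OF l(1)] i1[OF l(3)]
    by (simp add: is_weak_deriv_pdiff_iff[OF \<Omega>] scaleR_add_right Bochner_Integration.integral_add)
qed

lemma is_weak_deriv_scale:
  fixes f f' :: "real ^ 'n::finite \<Rightarrow> 'b::euclidean_space"
  assumes \<Omega>: "open \<Omega>" and f: "is_weak_deriv \<Omega> [i] f f'"
  shows "is_weak_deriv \<Omega> [i] (\<lambda>x. c *\<^sub>R f x) (\<lambda>x. c *\<^sub>R f' x)"
proof -
  have "locally_integrable \<Omega> (\<lambda>x. c *\<^sub>R f x)" "locally_integrable \<Omega> (\<lambda>x. c *\<^sub>R f' x)"
    using f unfolding locally_integrable_def is_weak_deriv_def
    by (auto intro: absolutely_integrable_scaleR_left)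
  moreover have "(LINT x|lebesgue. a x *\<^sub>R c *\<^sub>R h x) = c *\<^sub>R (LINT x|lebesgue. a x *\<^sub>R h x)"
    for a and h :: "real ^ 'n \<Rightarrow> 'b"
    unfolding scaleR_left_commute[of _ c] by (rule integral_scaleR_right) 
  ultimately show ?thesis
    using f by (simp add: is_weak_deriv_pdiff_iff[OF \<Omega>])
qed

text \<open>
  The representatives of the zero element; Sobolev and finite element spaces are vector spaces modulo
  this set.
\<close>

definition ae_zero :: "(real ^ 'n::finite) set \<Rightarrow> (real ^ 'n \<Rightarrow> 'b::euclidean_space) set" where
  "ae_zero \<Omega> = {f. AE x in lebesgue_on \<Omega>. f x = 0}"

lemma measurable_lebesgue_on_AE:
  fixes f g :: "real ^ 'n::finite \<Rightarrow> 'b::euclidean_space"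
  assumes \<Omega>: "open \<Omega>" and f: "f \<in> borel_measurable (lebesgue_on \<Omega>)"
    and ae: "AE x in lebesgue_on \<Omega>. f x = g x"
  shows "g \<in> borel_measurable (lebesgue_on \<Omega>)"
proof -
  have \<Omega>l: "\<Omega> \<inter> space lebesgue \<in> sets lebesgue" using \<Omega> by auto
  have "AE x in lebesgue. x \<in> \<Omega> \<longrightarrow> f x = g x" by (rule iffD1[OF AE_restrict_space_iff[OF \<Omega>l] ae])
  then have "AE x in lebesgue. indicator \<Omega> x *\<^sub>R f x = indicator \<Omega> x *\<^sub>R g x"
    by eventually_elim (auto simp: indicator_def)
  with f[unfolded borel_measurable_restrict_space_iff[OF \<Omega>l]]
  show ?thesis
    unfolding borel_measurable_restrict_space_iff[OF \<Omega>l] by (rule borel_measurable_AE)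
qed

lemma L2_AE_cong:
  assumes \<Omega>: "open \<Omega>" and f: "f \<in> L2_space \<Omega>" and ae: "AE x in lebesgue_on \<Omega>. f x = g x"
  shows "g \<in> L2_space \<Omega>"
proof -
  have fm: "f \<in> borel_measurable (lebesgue_on \<Omega>)" and fi: "integrable (lebesgue_on \<Omega>) (\<lambda>x. (norm (f x))\<^sup>2)"
    using f by (auto simp: L2_space_def)
  have gm: "g \<in> borel_measurable (lebesgue_on \<Omega>)" using measurable_lebesgue_on_AE[OF \<Omega> fm ae] .
  have "integrable (lebesgue_on \<Omega>) (\<lambda>x. (norm (g x))\<^sup>2)"
    using fi by (rule integrable_cong_AE_imp) (use gm ae in \<open>auto elim: eventually_mono\<close>)
  then show ?thesis using gm by (simp add: L2_space_def)
qed

lemma L2_inner_integrable: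
  assumes f: "f \<in> L2_space \<Omega>" and g: "g \<in> L2_space \<Omega>"
  shows "integrable (lebesgue_on \<Omega>) (\<lambda>x. f x \<bullet> g x)"
proof (rule Bochner_Integration.integrable_bound)
  show "integrable (lebesgue_on \<Omega>) (\<lambda>x. (norm (f x))\<^sup>2 + (norm (g x))\<^sup>2)"
    using f g by (auto simp: L2_space_def)
  show "(\<lambda>x. f x \<bullet> g x) \<in> borel_measurable (lebesgue_on \<Omega>)"
    using f g by (auto simp: L2_space_def)
  show "AE x in lebesgue_on \<Omega>. norm (f x \<bullet> g x) \<le> norm ((norm (f x))\<^sup>2 + (norm (g x))\<^sup>2)"
  proof (rule AE_I2)
    fix x
    have "norm (f x \<bullet> g x) \<le> norm (f x) * norm (g x)" by (simp add: Cauchy_Schwarz_ineq2)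
    also have "\<dots> \<le> (norm (f x))\<^sup>2 + (norm (g x))\<^sup>2"
      using sum_squares_bound[of "norm (f x)" "norm (g x)"]
        mult_nonneg_nonneg[OF norm_ge_zero[of "f x"] norm_ge_zero[of "g x"]] by linarith
    finally show "norm (f x \<bullet> g x) \<le> norm ((norm (f x))\<^sup>2 + (norm (g x))\<^sup>2)" by simp
  qed
qed

lemma L2_add: "f \<in> L2_space \<Omega> \<Longrightarrow> g \<in> L2_space \<Omega> \<Longrightarrow> (\<lambda>x. f x + g x) \<in> L2_space \<Omega>"
proof -
  assume fg: "f \<in> L2_space \<Omega>" "g \<in> L2_space \<Omega>"
  have "integrable (lebesgue_on \<Omega>) (\<lambda>x. f x \<bullet> f x + 2 * (f x \<bullet> g x) + g x \<bullet> g x)"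
    by (intro Bochner_Integration.integrable_add integrable_mult_right L2_inner_integrable fg)
  moreover have "(\<lambda>x. f x \<bullet> f x + 2 * (f x \<bullet> g x) + g x \<bullet> g x) = (\<lambda>x. (norm (f x + g x))\<^sup>2)"
    by (simp add: fun_eq_iff power2_norm_eq_inner inner_add inner_commute)
  ultimately show ?thesis using fg by (auto simp: L2_space_def)
qed

lemma L2_scale: "f \<in> L2_space \<Omega> \<Longrightarrow> (\<lambda>x. c *\<^sub>R f x) \<in> L2_space \<Omega>"
  by (auto simp: L2_space_def power_mult_distrib)

lemma L2_locally_integrable:
  assumes \<Omega>: "open \<Omega>" and f: "f \<in> L2_space \<Omega>"
  shows "locally_integrable \<Omega> f"
  unfolding locally_integrable_def
proof (intro allI impI)
  fix C assume C: "compact C \<and> C \<subseteq> \<Omega>"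
  have \<Omega>l: "\<Omega> \<inter> space lebesgue \<in> sets lebesgue" using \<Omega> by auto
  have fm: "(\<lambda>x. indicator \<Omega> x *\<^sub>R f x) \<in> borel_measurable lebesgue"
    and fi: "integrable lebesgue (\<lambda>x. indicator \<Omega> x *\<^sub>R (norm (f x))\<^sup>2)"
    using f unfolding L2_space_def
    by (auto simp: borel_measurable_restrict_space_iff[OF \<Omega>l] integrable_restrict_space[OF \<Omega>l])
  have Cl: "C \<in> lmeasurable" using C lmeasurable_compact by blast
  have "integrable lebesgue (\<lambda>x. indicator C x *\<^sub>R (indicator \<Omega> x *\<^sub>R f x))"
  proof (rule Bochner_Integration.integrable_bound)
    show "integrable lebesgue (\<lambda>x. indicator C x + indicator \<Omega> x *\<^sub>R (norm (f x))\<^sup>2)"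
      using fi Cl by (intro Bochner_Integration.integrable_add) (auto simp: fmeasurable_def)
    show "AE x in lebesgue. norm (indicator C x *\<^sub>R (indicator \<Omega> x *\<^sub>R f x))
        \<le> norm (indicator C x + indicator \<Omega> x *\<^sub>R (norm (f x))\<^sup>2)"
    proof (rule AE_I2)
      fix x
      have "norm (f x) \<le> 1 + (norm (f x))\<^sup>2"
      proof -
        have "2 * norm (f x) \<le> 1 + (norm (f x))\<^sup>2" using sum_squares_bound[of 1 "norm (f x)"] by simp
        then show ?thesis using norm_ge_zero[of "f x"] by linarith
      qed
      then show "norm (indicator C x *\<^sub>R (indicator \<Omega> x *\<^sub>R f x))
        \<le> norm (indicator C x + indicator \<Omega> x *\<^sub>R (norm (f x))\<^sup>2)"
        by (auto simp: indicator_def)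
    qed
    show "(\<lambda>x. indicator C x *\<^sub>R (indicator \<Omega> x *\<^sub>R f x)) \<in> borel_measurable lebesgue"
      by (rule borel_measurable_scaleR[OF borel_measurable_indicator fm]) (use Cl in auto)
  qed
  moreover have "indicator C x *\<^sub>R (indicator \<Omega> x *\<^sub>R f x) = indicator C x *\<^sub>R f x" for x
    using C by (auto simp: indicator_def)
  ultimately show "f absolutely_integrable_on C" by (simp only: set_integrable_def)
qed

text \<open>
  The derivative of order zero of \<open>f\<close> is \<open>f\<close> itself; it counts as a weak derivative because square
  integrable functions are locally integrable.
\<close>

lemma H1_iff:
  fixes f :: "real ^ 'n::finite \<Rightarrow> 'b::euclidean_space"
  assumes \<Omega>: "open \<Omega>"
  shows "f \<in> H1 \<Omega> \<longleftrightarrow> f \<in> L2_space \<Omega> \<and> (\<forall>i. \<exists>g\<in>L2_space \<Omega>. is_weak_deriv \<Omega> [i] f g)"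
proof
  assume "f \<in> H1 \<Omega>"
  then show "f \<in> L2_space \<Omega> \<and> (\<forall>i. \<exists>g\<in>L2_space \<Omega>. is_weak_deriv \<Omega> [i] f g)"
    by (simp add: H1_def sobolev_def)
next
  assume *: "f \<in> L2_space \<Omega> \<and> (\<forall>i. \<exists>g\<in>L2_space \<Omega>. is_weak_deriv \<Omega> [i] f g)"
  have "is_weak_deriv \<Omega> [] f f"
    using L2_locally_integrable[OF \<Omega>] * by (simp add: is_weak_deriv_def)
  then have "\<exists>g\<in>L2_space \<Omega>. is_weak_deriv \<Omega> \<alpha> f g" if "length \<alpha> \<le> 1" for \<alpha>
    using * that by (cases \<alpha>) auto
  then show "f \<in> H1 \<Omega>" using * by (simp add: H1_def sobolev_def)
qed

lemma weak_pd_deriv: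
  assumes "is_weak_deriv \<Omega> [i] f g"
  shows "is_weak_deriv \<Omega> [i] f (weak_pd \<Omega> i f)"
  unfolding weak_pd_def by (rule someI[of "is_weak_deriv \<Omega> [i] f", OF assms])

text \<open>
  The choice in \<open>weak_pd\<close> is immaterial up to null sets. Computations use some explicit
  weak derivative and transfer the result to \<open>weak_pd\<close> through this lemma.
\<close>

lemma weak_pd_AE:
  assumes \<Omega>: "open \<Omega>" and g: "is_weak_deriv \<Omega> [i] f g"
  shows "AE x in lebesgue_on \<Omega>. weak_pd \<Omega> i f x = g x"
  using weak_deriv_unique[OF \<Omega> weak_pd_deriv[OF g] g] .

lemma H1_weak_pd:
  assumes \<Omega>: "open \<Omega>" and f: "f \<in> H1 \<Omega>"
  shows "is_weak_deriv \<Omega> [i] f (weak_pd \<Omega> i f)" and "weak_pd \<Omega> i f \<in> L2_space \<Omega>"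
proof -
  obtain g where g: "g \<in> L2_space \<Omega>" "is_weak_deriv \<Omega> [i] f g" using f H1_iff[OF \<Omega>] by blast
  show "is_weak_deriv \<Omega> [i] f (weak_pd \<Omega> i f)" using g by (intro weak_pd_deriv)
  show "weak_pd \<Omega> i f \<in> L2_space \<Omega>"
    by (rule L2_AE_cong[OF \<Omega> g(1)]) (use weak_pd_AE[OF \<Omega> g(2)] in eventually_elim, simp)
qed

lemma H1_L2: "open \<Omega> \<Longrightarrow> f \<in> H1 \<Omega> \<Longrightarrow> f \<in> L2_space \<Omega>"
  using H1_iff by blast

lemma H1_add:
  assumes \<Omega>: "open \<Omega>" and f: "f \<in> H1 \<Omega>" and g: "g \<in> H1 \<Omega>"
  shows "(\<lambda>x. f x + g x) \<in> H1 \<Omega>"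
    and "AE x in lebesgue_on \<Omega>. weak_pd \<Omega> i (\<lambda>x. f x + g x) x = weak_pd \<Omega> i f x + weak_pd \<Omega> i g x"
proof -
  note d = is_weak_deriv_add[OF \<Omega> H1_weak_pd(1)[OF \<Omega> f] H1_weak_pd(1)[OF \<Omega> g]]
  show "(\<lambda>x. f x + g x) \<in> H1 \<Omega>"
    using d L2_add[OF H1_weak_pd(2)[OF \<Omega> f] H1_weak_pd(2)[OF \<Omega> g]] L2_add[OF H1_L2[OF \<Omega> f] H1_L2[OF \<Omega> g]]
    by (subst H1_iff[OF \<Omega>]) blast
  show "AE x in lebesgue_on \<Omega>. weak_pd \<Omega> i (\<lambda>x. f x + g x) x = weak_pd \<Omega> i f x + weak_pd \<Omega> i g x"
    using weak_pd_AE[OF \<Omega> d] .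
qed

lemma H1_scale:
  assumes \<Omega>: "open \<Omega>" and f: "f \<in> H1 \<Omega>"
  shows "(\<lambda>x. c *\<^sub>R f x) \<in> H1 \<Omega>"
    and "AE x in lebesgue_on \<Omega>. weak_pd \<Omega> i (\<lambda>x. c *\<^sub>R f x) x = c *\<^sub>R weak_pd \<Omega> i f x"
proof -
  note d = is_weak_deriv_scale[OF \<Omega> H1_weak_pd(1)[OF \<Omega> f]]
  show "(\<lambda>x. c *\<^sub>R f x) \<in> H1 \<Omega>"
    using d L2_scale[OF H1_weak_pd(2)[OF \<Omega> f]] L2_scale[OF H1_L2[OF \<Omega> f]]
    by (subst H1_iff[OF \<Omega>]) blast
  show "AE x in lebesgue_on \<Omega>. weak_pd \<Omega> i (\<lambda>x. c *\<^sub>R f x) x = c *\<^sub>R weak_pd \<Omega> i f x"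
    using weak_pd_AE[OF \<Omega> d] .
qed

lemma ae_zero_H1:
  fixes f :: "real ^ 'n::finite \<Rightarrow> 'b::euclidean_space"
  assumes \<Omega>: "open \<Omega>" and f: "f \<in> ae_zero \<Omega>"
  shows "f \<in> H1 \<Omega>" and "AE x in lebesgue_on \<Omega>. weak_pd \<Omega> i f x = 0"
proof -
  have \<Omega>l: "\<Omega> \<inter> space lebesgue \<in> sets lebesgue" using \<Omega> by auto
  have ae: "AE x in lebesgue_on \<Omega>. f x = 0" using f by (simp add: ae_zero_def)
  have z: "(\<lambda>x. 0) \<in> L2_space \<Omega>" by (simp add: L2_space_def)
  have fL: "f \<in> L2_space \<Omega>" by (rule L2_AE_cong[OF \<Omega> z]) (use ae in eventually_elim, simp)
  have d: "is_weak_deriv \<Omega> [i] f (\<lambda>x. 0)" for i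
  proof -
    have "(LINT x|lebesgue_on \<Omega>. \<psi> x *\<^sub>R f x) = 0" for \<psi>
      by (rule integral_eq_zero_AE) (use ae in eventually_elim, simp)
    then show ?thesis
      using L2_locally_integrable[OF \<Omega> fL] L2_locally_integrable[OF \<Omega> z] by (simp add: is_weak_deriv_def)
  qed
  show "f \<in> H1 \<Omega>" using fL d z by (subst H1_iff[OF \<Omega>]) blast
  show "AE x in lebesgue_on \<Omega>. weak_pd \<Omega> i f x = 0" using weak_pd_AE[OF \<Omega> d] .
qed

lemma semi_inner_H1:
  assumes \<Omega>: "open \<Omega>"
  shows "semi_inner (H1 \<Omega> :: (real ^ 'n::finite \<Rightarrow> 'b::euclidean_space) set) (h1_inner \<Omega>)"
proof
  note L2 = H1_L2[OF \<Omega>] H1_weak_pd(2)[OF \<Omega>]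
  note int = L2_inner_integrable
  have zero: "(\<lambda>x. 0) \<in> H1 \<Omega>" by (rule ae_zero_H1(1)[OF \<Omega>]) (simp add: ae_zero_def)
  show "subspace (H1 \<Omega> :: (real ^ 'n \<Rightarrow> 'b) set)"
    unfolding subspace_def using zero H1_add(1)[OF \<Omega>] H1_scale(1)[OF \<Omega>]
    by (auto simp: zero_fun_def plus_fun_def scaleR_fun_def)
  fix u v w :: "real ^ 'n \<Rightarrow> 'b" and c
  assume u: "u \<in> H1 \<Omega>"
  show "0 \<le> h1_inner \<Omega> u u"
    unfolding h1_inner_def by (intro add_nonneg_nonneg sum_nonneg integral_nonneg_AE) auto
  assume w: "w \<in> H1 \<Omega>"
  show "h1_inner \<Omega> u w = h1_inner \<Omega> w u"
    unfolding h1_inner_def by (simp add: inner_commute)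
  have m: "(\<lambda>x. f x \<bullet> g x) \<in> borel_measurable (lebesgue_on \<Omega>)" if "f \<in> L2_space \<Omega>" "g \<in> L2_space \<Omega>"
    for f g :: "real ^ 'n \<Rightarrow> 'b"
    using int[OF that] by (rule borel_measurable_integrable)
  have "(LINT x|lebesgue_on \<Omega>. weak_pd \<Omega> i (\<lambda>x. c *\<^sub>R u x) x \<bullet> weak_pd \<Omega> i w x) =
      c * (LINT x|lebesgue_on \<Omega>. weak_pd \<Omega> i u x \<bullet> weak_pd \<Omega> i w x)" for i
  proof -
    have "(LINT x|lebesgue_on \<Omega>. weak_pd \<Omega> i (\<lambda>x. c *\<^sub>R u x) x \<bullet> weak_pd \<Omega> i w x) =
      (LINT x|lebesgue_on \<Omega>. c * (weak_pd \<Omega> i u x \<bullet> weak_pd \<Omega> i w x))"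
      using H1_scale(2)[OF \<Omega> u, where c = c and i = i]
      by (intro integral_cong_AE m L2 H1_scale(1)[OF \<Omega>] borel_measurable_times borel_measurable_const u w)
        (auto elim!: eventually_mono)
    then show ?thesis by simp
  qed
  then show "h1_inner \<Omega> (c *\<^sub>R u) w = c * h1_inner \<Omega> u w"
    by (simp add: h1_inner_def scaleR_fun_def algebra_simps sum_distrib_left)
  assume v: "v \<in> H1 \<Omega>"
  have "(LINT x|lebesgue_on \<Omega>. weak_pd \<Omega> i (\<lambda>x. u x + v x) x \<bullet> weak_pd \<Omega> i w x) =
      (LINT x|lebesgue_on \<Omega>. weak_pd \<Omega> i u x \<bullet> weak_pd \<Omega> i w x) +
      (LINT x|lebesgue_on \<Omega>. weak_pd \<Omega> i v x \<bullet> weak_pd \<Omega> i w x)" for i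
  proof -
    have "(LINT x|lebesgue_on \<Omega>. weak_pd \<Omega> i (\<lambda>x. u x + v x) x \<bullet> weak_pd \<Omega> i w x) =
      (LINT x|lebesgue_on \<Omega>. weak_pd \<Omega> i u x \<bullet> weak_pd \<Omega> i w x + weak_pd \<Omega> i v x \<bullet> weak_pd \<Omega> i w x)"
      using H1_add(2)[OF \<Omega> u v, where i = i]
      by (intro integral_cong_AE m L2 H1_add(1)[OF \<Omega>] borel_measurable_add u v w)
        (auto elim!: eventually_mono simp: inner_add_left)
    also have "\<dots> = (LINT x|lebesgue_on \<Omega>. weak_pd \<Omega> i u x \<bullet> weak_pd \<Omega> i w x) +
      (LINT x|lebesgue_on \<Omega>. weak_pd \<Omega> i v x \<bullet> weak_pd \<Omega> i w x)"
      by (intro Bochner_Integration.integral_add int L2 u v w)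
    finally show ?thesis .
  qed
  then show "h1_inner \<Omega> (u + v) w = h1_inner \<Omega> u w + h1_inner \<Omega> v w"
    using Bochner_Integration.integral_add[OF int[OF L2(1)[OF u] L2(1)[OF w]] int[OF L2(1)[OF v] L2(1)[OF w]]]
    by (simp add: h1_inner_def plus_fun_def inner_add_left sum.distrib)
qed

lemma h1_inner_ae_zero:
  assumes \<Omega>: "open \<Omega>" and f: "f \<in> ae_zero \<Omega>"
  shows "h1_inner \<Omega> f f = 0"
proof -
  have ae: "AE x in lebesgue_on \<Omega>. f x = 0" using f by (simp add: ae_zero_def)
  have "(LINT x|lebesgue_on \<Omega>. f x \<bullet> f x) = 0"
    using ae by (intro integral_eq_zero_AE) (auto elim: eventually_mono)
  moreover have "(LINT x|lebesgue_on \<Omega>. weak_pd \<Omega> i f x \<bullet> weak_pd \<Omega> i f x) = 0" for i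
    using ae_zero_H1(2)[OF \<Omega> f, of i] by (intro integral_eq_zero_AE) (auto elim: eventually_mono)
  ultimately show ?thesis by (simp add: h1_inner_def)
qed

lemma L2_norm_le_h1_inner:
  fixes f :: "real ^ 'n::finite \<Rightarrow> 'b::euclidean_space"
  assumes \<Omega>: "open \<Omega>" and f: "f \<in> H1 \<Omega>"
  shows "(LINT x|lebesgue_on \<Omega>. (norm (f x))\<^sup>2) \<le> h1_inner \<Omega> f f"
    and "(LINT x|lebesgue_on \<Omega>. (norm (weak_pd \<Omega> i f x))\<^sup>2) \<le> h1_inner \<Omega> f f"
proof -
  define S where "S = (\<Sum>i\<in>UNIV. LINT x|lebesgue_on \<Omega>. weak_pd \<Omega> i f x \<bullet> weak_pd \<Omega> i f x)"
  have n: "0 \<le> (LINT x|lebesgue_on \<Omega>. g x \<bullet> g x)" for g :: "real ^ 'n \<Rightarrow> 'b"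
    by (rule integral_nonneg_AE) auto
  have S: "0 \<le> S" "(LINT x|lebesgue_on \<Omega>. weak_pd \<Omega> i f x \<bullet> weak_pd \<Omega> i f x) \<le> S"
    unfolding S_def using n by (auto intro!: sum_nonneg member_le_sum)
  show "(LINT x|lebesgue_on \<Omega>. (norm (f x))\<^sup>2) \<le> h1_inner \<Omega> f f"
    using S(1) by (simp add: h1_inner_def S_def power2_norm_eq_inner)
  show "(LINT x|lebesgue_on \<Omega>. (norm (weak_pd \<Omega> i f x))\<^sup>2) \<le> h1_inner \<Omega> f f"
    unfolding h1_inner_def S_def[symmetric] power2_norm_eq_inner using S(2) n[of f] by linarith
qed

lemma h1_inner_eq_0_imp:
  assumes \<Omega>: "open \<Omega>" and f: "f \<in> H1 \<Omega>" and z: "h1_inner \<Omega> f f = 0"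
  shows "f \<in> ae_zero \<Omega>"
proof -
  have "integrable (lebesgue_on \<Omega>) (\<lambda>x. (norm (f x))\<^sup>2)" using H1_L2[OF \<Omega> f] by (simp add: L2_space_def)
  moreover have "0 \<le> (LINT x|lebesgue_on \<Omega>. (norm (f x))\<^sup>2)"
    by (rule integral_nonneg_AE) simp
  then have "(LINT x|lebesgue_on \<Omega>. (norm (f x))\<^sup>2) = 0"
    using L2_norm_le_h1_inner(1)[OF \<Omega> f] z by linarith
  ultimately have "AE x in lebesgue_on \<Omega>. (norm (f x))\<^sup>2 = 0"
    by (subst (asm) integral_nonneg_eq_0_iff_AE) auto
  then show ?thesis by (simp add: ae_zero_def)
qed

lemma H1_AE_cong:
  fixes f g :: "real ^ 'n::finite \<Rightarrow> 'b::euclidean_space"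
  assumes \<Omega>: "open \<Omega>" and f: "f \<in> H1 \<Omega>" and ae: "AE x in lebesgue_on \<Omega>. g x = f x"
  shows "g \<in> H1 \<Omega>"
proof -
  have "(\<lambda>x. g x - f x) \<in> ae_zero \<Omega>" unfolding ae_zero_def using ae by (simp add: eventually_mono)
  from H1_add(1)[OF \<Omega> f ae_zero_H1(1)[OF \<Omega> this]] show ?thesis by simp
qed

lemma H1_componentwise:
  fixes f :: "real ^ 'n::finite \<Rightarrow> 'b::euclidean_space"
  assumes \<Omega>: "open \<Omega>" and f: "\<And>b. b \<in> Basis \<Longrightarrow> (\<lambda>x. f x \<bullet> b) \<in> H1 \<Omega>"
  shows "f \<in> H1 \<Omega>"
proof -
  have L2: "g \<in> L2_space \<Omega>" if g: "\<And>b. b \<in> Basis \<Longrightarrow> (\<lambda>x. g x \<bullet> b) \<in> L2_space \<Omega>"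
    for g :: "real ^ 'n \<Rightarrow> 'b"
  proof -
    have m: "g \<in> borel_measurable (lebesgue_on \<Omega>)"
      using g by (subst borel_measurable_euclidean_space) (auto simp: L2_space_def)
    have "integrable (lebesgue_on \<Omega>) (\<lambda>x. \<Sum>b\<in>Basis. (g x \<bullet> b)\<^sup>2)"
      using g by (intro Bochner_Integration.integrable_sum) (auto simp: L2_space_def)
    moreover have "(\<Sum>b\<in>Basis. (g x \<bullet> b)\<^sup>2) = (norm (g x))\<^sup>2" for x
      unfolding power2_norm_eq_inner by (subst (2) euclidean_inner) (simp add: power2_eq_square)
    ultimately have "integrable (lebesgue_on \<Omega>) (\<lambda>x. (norm (g x))\<^sup>2)" by (simp only:)
    with m show ?thesis by (simp add: L2_space_def)
  qed
  have "\<exists>g\<in>L2_space \<Omega>. is_weak_deriv \<Omega> [i] f g" for i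
  proof -
    define g where "g x = (\<Sum>b\<in>Basis. weak_pd \<Omega> i (\<lambda>x. f x \<bullet> b) x *\<^sub>R b)" for x
    have gb: "g x \<bullet> b = weak_pd \<Omega> i (\<lambda>x. f x \<bullet> b) x" if "b \<in> Basis" for b x
      using that by (simp add: g_def)
    have "is_weak_deriv \<Omega> [i] f g"
    proof (rule iffD2[OF is_weak_deriv_componentwise[OF \<Omega>]], rule ballI)
      fix b :: 'b assume b: "b \<in> Basis"
      show "is_weak_deriv \<Omega> [i] (\<lambda>x. f x \<bullet> b) (\<lambda>x. g x \<bullet> b)"
        unfolding gb[OF b] by (rule H1_weak_pd(1)[OF \<Omega> f[OF b]])
    qed
    moreover have "g \<in> L2_space \<Omega>"
    proof (rule L2)
      fix b :: 'b assume b: "b \<in> Basis"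
      show "(\<lambda>x. g x \<bullet> b) \<in> L2_space \<Omega>" unfolding gb[OF b] by (rule H1_weak_pd(2)[OF \<Omega> f[OF b]])
    qed
    ultimately show ?thesis by blast
  qed
  moreover have "f \<in> L2_space \<Omega>" using H1_L2[OF \<Omega> f] by (rule L2)
  ultimately show ?thesis by (subst H1_iff[OF \<Omega>]) blast
qed

section \<open>Continuous piecewise smooth functions\<close>

lemma Linf_L2:
  assumes \<Omega>: "open \<Omega>" "bounded \<Omega>" and f: "f \<in> Linf_space \<Omega>"
  shows "f \<in> L2_space \<Omega>"
proof -
  have \<Omega>l: "\<Omega> \<in> sets lebesgue" using \<Omega> by auto
  obtain M where M: "AE x in lebesgue_on \<Omega>. norm (f x) \<le> M" using f by (auto simp: Linf_space_def)
  have fm: "f \<in> borel_measurable (lebesgue_on \<Omega>)" using f by (simp add: Linf_space_def)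
  have "finite_measure (lebesgue_on \<Omega>)"
    using bounded_set_imp_lmeasurable[OF \<Omega>(2) \<Omega>l] by (rule finite_measure_lebesgue_on)
  then have "integrable (lebesgue_on \<Omega>) (\<lambda>x. M\<^sup>2)" by (simp add: finite_measure.integrable_const)
  then have "integrable (lebesgue_on \<Omega>) (\<lambda>x. (norm (f x))\<^sup>2)"
  proof (rule Bochner_Integration.integrable_bound)
    show "AE x in lebesgue_on \<Omega>. norm ((norm (f x))\<^sup>2) \<le> norm (M\<^sup>2)"
      using M by eventually_elim (simp add: power_mono)
  qed (use fm in measurable)
  then show ?thesis using fm by (simp add: L2_space_def)
qed

lemma smooth_line_deriv:
  assumes "smooth f"
  shows "((\<lambda>s. f (x + s *\<^sub>R axis i 1)) has_field_derivative pdiff i f (x + s *\<^sub>R axis i 1)) (at s within S)"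
proof -
  let ?y = "x + s *\<^sub>R axis i 1"
  have inner: "((\<lambda>s. x + s *\<^sub>R axis i 1) has_derivative (\<lambda>h. h *\<^sub>R axis i 1)) (at s)"
    by (auto intro!: derivative_eq_intros)
  have "((\<lambda>s. f (x + s *\<^sub>R axis i 1)) has_derivative (\<lambda>h. frechet_derivative f (at ?y) (h *\<^sub>R axis i 1))) (at s)"
    using has_derivative_compose[OF inner smooth_has_derivative[OF assms]] .
  moreover have "(\<lambda>h. frechet_derivative f (at ?y) (h *\<^sub>R axis i 1)) = (*) (pdiff i f ?y)"
    using linear_scale[OF linear_frechet_derivative[OF smooth_differentiable[OF assms]]]
    by (simp add: fun_eq_iff pdiff_def mult.commute)
  ultimately have "((\<lambda>s. f (x + s *\<^sub>R axis i 1)) has_field_derivative pdiff i f ?y) (at s)"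
    by (simp add: has_field_derivative_def)
  then show ?thesis by (rule has_field_derivative_at_within)
qed

lemma smooth_line_lipschitz:
  assumes f: "smooth f" and S: "convex S" and L: "\<And>s. s \<in> S \<Longrightarrow> \<bar>pdiff i f (x + s *\<^sub>R axis i 1)\<bar> \<le> L"
    and "a \<in> S" "b \<in> S"
  shows "\<bar>f (x + a *\<^sub>R axis i 1) - f (x + b *\<^sub>R axis i 1)\<bar> \<le> L * \<bar>a - b\<bar>"
  using field_differentiable_bound[OF S smooth_line_deriv[OF f] _ assms(4,5), of i x L] L by simp

lemma smooth_bounded_on_family:
  fixes p :: "'t \<Rightarrow> real ^ 'n::finite \<Rightarrow> real"
  assumes "finite T" and K: "\<And>t. t \<in> T \<Longrightarrow> compact (K t)" and p: "\<And>t. t \<in> T \<Longrightarrow> smooth (p t)"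
  shows "\<exists>L\<ge>0. \<forall>t\<in>T. \<forall>x\<in>K t. \<bar>p t x\<bar> \<le> L"
proof -
  have "\<exists>L. \<forall>x\<in>K t. \<bar>p t x\<bar> \<le> L" if "t \<in> T" for t
  proof -
    have "bounded (p t ` K t)"
      using K[OF that] p[OF that] by (intro compact_imp_bounded compact_continuous_image smooth_continuous)
    then show ?thesis by (auto simp: bounded_iff)
  qed
  then obtain L where L: "\<And>t x. t \<in> T \<Longrightarrow> x \<in> K t \<Longrightarrow> \<bar>p t x\<bar> \<le> L t" by metis
  have "\<bar>p t x\<bar> \<le> (\<Sum>t\<in>T. \<bar>L t\<bar>)" if "t \<in> T" "x \<in> K t" for t x
  proof -
    have "\<bar>p t x\<bar> \<le> \<bar>L t\<bar>" using L[OF that] by simp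
    also have "\<dots> \<le> (\<Sum>t\<in>T. \<bar>L t\<bar>)" using \<open>finite T\<close> that by (intro member_le_sum) auto
    finally show ?thesis .
  qed
  moreover have "0 \<le> (\<Sum>t\<in>T. \<bar>L t\<bar>)" by (intro sum_nonneg) simp
  ultimately show ?thesis by blast
qed

lemma diff_quotient_tendsto:
  fixes f :: "real \<Rightarrow> real"
  assumes "(f has_field_derivative d) (at 0)" "h \<longlonglongrightarrow> 0" "\<And>n. h n \<noteq> 0"
  shows "(\<lambda>n. (f (h n) - f 0) / h n) \<longlonglongrightarrow> d"
proof -
  have "((\<lambda>s. (f (0 + s) - f 0) / s) \<longlongrightarrow> d) (at 0)" using assms(1) by (simp add: DERIV_def)
  moreover have "filterlim h (at 0) sequentially" using assms(2,3) by (simp add: filterlim_at)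
  ultimately have "((\<lambda>n. (f (0 + h n) - f 0) / h n) \<longlongrightarrow> d) sequentially"
    by (rule filterlim_compose)
  then show ?thesis by simp
qed

text \<open>
  The pieces may overlap, as simplices of a triangulation do in their faces.
\<close>

locale piecewise_smooth =
  fixes \<Omega> :: "(real ^ 'n::finite) set" and T :: "(real ^ 'n) set set"
    and w :: "real ^ 'n \<Rightarrow> real" and p :: "(real ^ 'n) set \<Rightarrow> real ^ 'n \<Rightarrow> real"
  assumes \<Omega>_open: "open \<Omega>" and \<Omega>_bounded: "bounded \<Omega>" and finite_T: "finite T"
    and T_compact: "\<And>t. t \<in> T \<Longrightarrow> compact t" and T_convex: "\<And>t. t \<in> T \<Longrightarrow> convex t"
    and T_cover: "\<Omega> \<subseteq> \<Union>T" and w_cont: "continuous_on \<Omega> w"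
    and p_smooth: "\<And>t. t \<in> T \<Longrightarrow> smooth (p t)" and w_p: "\<And>t x. t \<in> T \<Longrightarrow> x \<in> t \<Longrightarrow> w x = p t x"
begin

definition w0 :: "real ^ 'n \<Rightarrow> real" where
  "w0 x = indicator \<Omega> x * w x"

text \<open>
  The partial derivative of \<open>w\<close> as a limit of difference quotients along a fixed sequence: in this form
  it is Borel measurable by construction. Off the boundaries of the pieces it is the classical
  derivative.
\<close>

definition dw :: "'n \<Rightarrow> real ^ 'n \<Rightarrow> real" where
  "dw i x = lim (\<lambda>n. (w0 (x + inverse (real (Suc n)) *\<^sub>R axis i 1) - w0 x) / inverse (real (Suc n)))"

lemma w0_measurable [measurable]: "w0 \<in> borel_measurable borel"
  using borel_measurable_continuous_on_indicator[OF _ w_cont] \<Omega>_open by (simp add: w0_def[abs_def])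

lemma dw_measurable [measurable]: "dw i \<in> borel_measurable borel"
  unfolding dw_def[abs_def] by measurable

lemma w0_bounded: "\<exists>B\<ge>0. \<forall>x. \<bar>w0 x\<bar> \<le> B"
proof -
  obtain B where B: "B \<ge> 0" "\<And>t x. t \<in> T \<Longrightarrow> x \<in> t \<Longrightarrow> \<bar>p t x\<bar> \<le> B"
    using smooth_bounded_on_family[OF finite_T, of "\<lambda>t. t" p] T_compact p_smooth by metis
  have "\<bar>w0 x\<bar> \<le> B" for x
  proof (cases "x \<in> \<Omega>")
    case True
    then obtain t where "t \<in> T" "x \<in> t" using T_cover by auto
    then show ?thesis using B(2)[of t x] w_p[of t x] True by (simp add: w0_def)
  qed (use B(1) in \<open>simp add: w0_def\<close>)
  then show ?thesis using B(1) by blast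
qed

lemma pdiff_p_bounded: "\<exists>L\<ge>0. \<forall>t\<in>T. \<forall>x\<in>t. \<bar>pdiff i (p t) x\<bar> \<le> L"
  using smooth_bounded_on_family[OF finite_T, of "\<lambda>t. t" "\<lambda>t. pdiff i (p t)"] T_compact p_smooth smooth_pdiff
  by metis

text \<open>
  The pieces cut a segment into finitely many closed intervals, on each of which \<open>w\<close> is Lipschitz with
  constant \<open>L\<close> by the mean value theorem.
\<close>

lemma w_lipschitz_segment:
  assumes L: "L \<ge> 0" "\<And>t x. t \<in> T \<Longrightarrow> x \<in> t \<Longrightarrow> \<bar>pdiff i (p t) x\<bar> \<le> L"
    and h: "0 \<le> h" and seg: "\<And>s. 0 \<le> s \<Longrightarrow> s \<le> h \<Longrightarrow> x + s *\<^sub>R axis i 1 \<in> \<Omega>"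
  shows "\<bar>w (x + h *\<^sub>R axis i 1) - w x\<bar> \<le> L * h"
proof -
  define U where "U t = {s. x + s *\<^sub>R axis i 1 \<in> t}" for t
  have U_eq: "U t = (\<lambda>s. x + s *\<^sub>R axis i 1) -` t" for t by (auto simp: U_def)
  have "L-lipschitz_on {0..h} (\<lambda>s. w (x + s *\<^sub>R axis i 1))"
  proof (rule lipschitz_on_closed_Union[where U = U and I = T])
    show "L-lipschitz_on (U t) (\<lambda>s. w (x + s *\<^sub>R axis i 1))" if t: "t \<in> T" for t
    proof (rule lipschitz_onI)
      have conv: "convex (U t)"
      proof (rule convexI)
        fix a b and u v :: real assume ab: "a \<in> U t" "b \<in> U t" and uv: "0 \<le> u" "0 \<le> v" "u + v = 1"
        have "u *\<^sub>R (x + a *\<^sub>R axis i 1) + v *\<^sub>R (x + b *\<^sub>R axis i 1) \<in> t"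
          using convexD[OF T_convex[OF t]] ab uv by (auto simp: U_def)
        moreover have "u *\<^sub>R (x + a *\<^sub>R axis i 1) + v *\<^sub>R (x + b *\<^sub>R axis i 1)
            = (u + v) *\<^sub>R x + (u * a + v * b) *\<^sub>R axis i 1" by (simp add: algebra_simps)
        ultimately show "u *\<^sub>R a + v *\<^sub>R b \<in> U t" using uv by (simp add: U_def)
      qed
      fix a b assume ab: "a \<in> U t" "b \<in> U t"
      have "\<bar>p t (x + a *\<^sub>R axis i 1) - p t (x + b *\<^sub>R axis i 1)\<bar> \<le> L * \<bar>a - b\<bar>"
        by (rule smooth_line_lipschitz[OF p_smooth[OF t] conv _ ab]) (use L(2)[OF t] in \<open>auto simp: U_def\<close>)
      then show "dist (w (x + a *\<^sub>R axis i 1)) (w (x + b *\<^sub>R axis i 1)) \<le> L * dist a b"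
        using ab w_p[OF t] by (simp add: U_def dist_real_def)
    qed (rule L(1))
    show "closed (U t)" if "t \<in> T" for t
      unfolding U_eq using T_compact[OF that] by (intro closed_vimage compact_imp_closed continuous_intros)
    show "{0..h} \<subseteq> (\<Union>t\<in>T. U t)"
      using seg T_cover by (fastforce simp: U_def)
  qed (use finite_T L in auto)
  from lipschitz_onD[OF this, of h 0] h show ?thesis by (simp add: dist_real_def)
qed

text \<open>
  The frontier of a convex set is negligible.
\<close>

lemma AE_interior: "AE x in lborel. x \<in> \<Omega> \<longrightarrow> (\<exists>t\<in>T. x \<in> interior t)"
proof -
  have "negligible (\<Union>t\<in>T. frontier t)"
    using finite_T T_convex by (intro negligible_Union) (auto intro: negligible_convex_frontier)
  then have "(\<Union>t\<in>T. frontier t) \<in> null_sets lebesgue" by (simp add: negligible_iff_null_sets)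
  then have "AE x in lebesgue. x \<notin> (\<Union>t\<in>T. frontier t)" by (rule AE_not_in)
  then have "AE x in lborel. x \<notin> (\<Union>t\<in>T. frontier t)" by (simp only: AE_completion_iff)
  then show ?thesis
  proof eventually_elim
    fix x assume x: "x \<notin> (\<Union>t\<in>T. frontier t)"
    show "x \<in> \<Omega> \<longrightarrow> (\<exists>t\<in>T. x \<in> interior t)"
    proof
      assume "x \<in> \<Omega>"
      then obtain t where t: "t \<in> T" "x \<in> t" using T_cover by auto
      then have "x \<in> interior t" using x closure_subset[of t] by (auto simp: frontier_def)
      then show "\<exists>t\<in>T. x \<in> interior t" using t(1) by blast
    qed
  qed
qed

lemma w0_quotient_tendsto:
  assumes x: "x \<in> \<Omega>" and t: "t \<in> T" "x \<in> interior t" and h: "h \<longlonglongrightarrow> 0" "\<And>n. h n \<noteq> 0"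
  shows "(\<lambda>n. (w0 (x + h n *\<^sub>R axis i 1) - w0 x) / h n) \<longlonglongrightarrow> pdiff i (p t) x"
proof -
  define S where "S = (\<lambda>s. x + s *\<^sub>R axis i 1) -` (\<Omega> \<inter> interior t)"
  have "((\<lambda>s. p t (x + s *\<^sub>R axis i 1)) has_field_derivative pdiff i (p t) (x + 0 *\<^sub>R axis i 1)) (at 0)"
    by (rule smooth_line_deriv[OF p_smooth[OF t(1)]])
  then have "((\<lambda>s. w0 (x + s *\<^sub>R axis i 1)) has_field_derivative pdiff i (p t) (x + 0 *\<^sub>R axis i 1)) (at 0)"
  proof (rule has_field_derivative_transform_within_open[where S = S])
    show "open S" unfolding S_def using \<Omega>_open by (intro open_vimage continuous_intros open_Int) auto
    show "0 \<in> S" using x t by (simp add: S_def)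
    show "p t (x + s *\<^sub>R axis i 1) = w0 (x + s *\<^sub>R axis i 1)" if "s \<in> S" for s
      using that w_p[OF t(1)] interior_subset[of t] by (auto simp: S_def w0_def)
  qed
  from diff_quotient_tendsto[OF this h] show ?thesis by simp
qed

lemma dw_eq:
  assumes x: "x \<in> \<Omega>" and t: "t \<in> T" "x \<in> interior t"
  shows "dw i x = pdiff i (p t) x"
proof -
  have "(\<lambda>n. inverse (real (Suc n))) \<longlonglongrightarrow> 0" by (rule LIMSEQ_inverse_real_of_nat)
  from w0_quotient_tendsto[OF x t this, of i] show ?thesis unfolding dw_def by (intro limI) simp
qed

lemma dw_bounded: "\<exists>L. AE x in lborel. x \<in> \<Omega> \<longrightarrow> \<bar>dw i x\<bar> \<le> L"
proof -
  obtain L where L: "\<And>t x. t \<in> T \<Longrightarrow> x \<in> t \<Longrightarrow> \<bar>pdiff i (p t) x\<bar> \<le> L"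
    using pdiff_p_bounded by metis
  have "AE x in lborel. x \<in> \<Omega> \<longrightarrow> \<bar>dw i x\<bar> \<le> L"
    using AE_interior
  proof eventually_elim
    fix x assume *: "x \<in> \<Omega> \<longrightarrow> (\<exists>t\<in>T. x \<in> interior t)"
    show "x \<in> \<Omega> \<longrightarrow> \<bar>dw i x\<bar> \<le> L"
    proof
      assume x: "x \<in> \<Omega>"
      then obtain t where t: "t \<in> T" "x \<in> interior t" using * by blast
      then show "\<bar>dw i x\<bar> \<le> L" using L[of t x] dw_eq[OF x t] interior_subset[of t] by auto
    qed
  qed
  then show ?thesis by blast
qed

lemma Linf_borelI:
  assumes f: "f \<in> borel_measurable borel" and bound: "AE x in lborel. x \<in> \<Omega> \<longrightarrow> \<bar>f x\<bar> \<le> B"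
    and eq: "\<And>x. x \<in> \<Omega> \<Longrightarrow> g x = f x"
  shows "(g :: real ^ 'n \<Rightarrow> real) \<in> Linf_space \<Omega>"
proof -
  have \<Omega>l: "\<Omega> \<inter> space lebesgue \<in> sets lebesgue" using \<Omega>_open by auto
  have "f \<in> borel_measurable lebesgue" using f by (simp add: measurable_completion)
  then have "f \<in> borel_measurable (lebesgue_on \<Omega>)" by (rule measurable_restrict_space1)
  then have "g \<in> borel_measurable (lebesgue_on \<Omega>)"
    by (rule measurable_cong[THEN iffD1, rotated]) (simp add: eq space_restrict_space)
  moreover have "AE x in lebesgue_on \<Omega>. norm (g x) \<le> B"
    unfolding AE_restrict_space_iff[OF \<Omega>l] using AE_completion[OF bound]
    by eventually_elim (simp add: eq)
  ultimately show ?thesis by (auto simp: Linf_space_def)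
qed

lemma w_Linf: "w \<in> Linf_space \<Omega>"
proof -
  obtain B where "\<And>x. \<bar>w0 x\<bar> \<le> B" using w0_bounded by metis
  then have "AE x in lborel. x \<in> \<Omega> \<longrightarrow> \<bar>w0 x\<bar> \<le> B" by simp
  from Linf_borelI[OF w0_measurable this] show ?thesis by (simp add: w0_def)
qed

lemma dw_Linf: "dw i \<in> Linf_space \<Omega>"
proof -
  obtain L where "AE x in lborel. x \<in> \<Omega> \<longrightarrow> \<bar>dw i x\<bar> \<le> L" using dw_bounded by metis
  then show ?thesis by (intro Linf_borelI[of "dw i" L]) auto
qed

text \<open>
  Let \<open>F = \<phi> * w\<close>, extended by zero. By translation invariance its difference quotients have integral
  zero. They are bounded and supported in a fixed ball, since a segment that ends in the support of
  \<open>\<phi>\<close> and is shorter than the distance from the support to the complement of \<open>\<Omega>\<close> stays in \<open>\<Omega>\<close>,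
  where both factors are Lipschitz. They converge to the derivative of the product almost everywhere,
  and dominated convergence gives the claim.
\<close>

lemma integration_by_parts:
  assumes \<phi>: "\<phi> \<in> test_functions \<Omega>"
  shows "(\<integral>x. \<phi> x * dw i x + pdiff i \<phi> x * w0 x \<partial>lborel) = 0"
proof -
  obtain C where C: "compact C" "C \<subseteq> \<Omega>" "\<And>x. x \<notin> C \<Longrightarrow> \<phi> x = 0" and sm: "smooth \<phi>"
    using \<phi> by (auto simp: test_functions_iff)
  note \<phi>' = test_functions_pdiff[OF \<phi>, of i]
  note [measurable] = test_functions_measurable[OF \<phi>] test_functions_measurable[OF \<phi>']
  obtain M where M: "M \<ge> 0" "\<And>x. \<bar>\<phi> x\<bar> \<le> M" using test_functions_bounded[OF \<phi>] by metis
  obtain M' where M': "M' \<ge> 0" "\<And>x. \<bar>pdiff i \<phi> x\<bar> \<le> M'" using test_functions_bounded[OF \<phi>'] by metis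
  obtain B where B: "B \<ge> 0" "\<And>x. \<bar>w0 x\<bar> \<le> B" using w0_bounded by metis
  obtain L where L: "L \<ge> 0" "\<And>t x. t \<in> T \<Longrightarrow> x \<in> t \<Longrightarrow> \<bar>pdiff i (p t) x\<bar> \<le> L"
    using pdiff_p_bounded by metis
  obtain d where d: "d > 0" "\<And>x y. x \<in> C \<Longrightarrow> norm (y - x) < d \<Longrightarrow> y \<in> \<Omega>"
    using compact_in_open_separated[OF C(1) \<Omega>_open C(2)] by metis
  obtain N where N: "inverse (real (Suc N)) < d" using reals_Archimedean[OF d(1)] by blast
  \<comment> \<open>The increments defining \<open>dw\<close>, from the index on where they are shorter than \<open>d\<close>.\<close>
  define h where "h n = inverse (real (Suc (n + N)))" for n
  have h_pos: "h n > 0" for n by (simp add: h_def)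
  have h_d: "h n < d" for n
  proof -
    have "h n \<le> inverse (real (Suc N))" unfolding h_def by (intro le_imp_inverse_le) auto
    then show ?thesis using N by simp
  qed
  have h_lim: "h \<longlonglongrightarrow> 0"
    unfolding h_def using LIMSEQ_ignore_initial_segment[OF LIMSEQ_inverse_real_of_nat, of N] by simp
  let ?e = "axis i 1 :: real ^ 'n"
  define F where "F x = \<phi> x * w0 x" for x
  have [measurable]: "F \<in> borel_measurable borel" unfolding F_def[abs_def] by measurable
  define D where "D n x = (F (x + h n *\<^sub>R ?e) - F x) / h n" for n x
  obtain R where R: "\<And>x. x \<in> \<Omega> \<Longrightarrow> norm x \<le> R" using \<Omega>_bounded by (auto simp: bounded_iff)
  have e1: "norm ?e = 1" by simp
  have F0: "F x = 0" if "x \<notin> C" for x using C(3)[OF that] by (simp add: F_def)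
  have F_int: "integrable lborel F"
  proof (rule Bochner_Integration.integrable_bound)
    show "integrable lborel (\<lambda>x. M * B * indicator (cball 0 R) x :: real)"
      by (intro integrable_mult_right integrable_real_indicator) (auto simp: emeasure_bounded_finite[OF bounded_cball, unfolded infinity_ennreal_def])
    show "AE x in lborel. norm (F x) \<le> norm (M * B * indicator (cball 0 R) x :: real)"
    proof (rule AE_I2)
      fix x
      have "\<bar>F x\<bar> \<le> M * B" using M B by (auto simp: F_def abs_mult intro!: mult_mono)
      then show "norm (F x) \<le> norm (M * B * indicator (cball 0 R) x :: real)"
        using F0[of x] C(2) R[of x] M(1) B(1) by (cases "x \<in> C") (auto simp: indicator_def abs_mult)
    qed
  qed measurable
  have D_int0: "(\<integral>x. D n x \<partial>lborel) = 0" for n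
  proof -
    have "(\<integral>x. D n x \<partial>lborel) = ((\<integral>x. F (x + h n *\<^sub>R ?e) \<partial>lborel) - (\<integral>x. F x \<partial>lborel)) / h n"
      unfolding D_def using F_int lborel_integrable_shift[of F "h n *\<^sub>R ?e"] by simp
    also have "\<dots> = 0" using lborel_integral_shift[of F "h n *\<^sub>R ?e"] by simp
    finally show ?thesis .
  qed
  define K where "K = M * L + M' * B"
  have D_bound: "\<bar>D n x\<bar> \<le> K * indicator (cball 0 (R + d)) x" for n x
  proof (cases "x \<in> C \<or> x + h n *\<^sub>R ?e \<in> C")
    case False
    then have "D n x = 0" using F0 by (simp add: D_def)
    moreover have "0 \<le> K" using M M' L B by (simp add: K_def)
    ultimately show ?thesis by (simp add: indicator_def)
  next
    case True
    have seg: "x + s *\<^sub>R ?e \<in> \<Omega>" if s: "0 \<le> s" "s \<le> h n" for s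
    proof (cases "x \<in> C")
      case True
      then show ?thesis using d(2)[of x "x + s *\<^sub>R ?e"] s h_d[of n] by simp
    next
      case False
      then have "x + h n *\<^sub>R ?e \<in> C" using True by simp
      moreover have "x + s *\<^sub>R ?e - (x + h n *\<^sub>R ?e) = (s - h n) *\<^sub>R ?e" by (simp add: algebra_simps)
      then have "norm (x + s *\<^sub>R ?e - (x + h n *\<^sub>R ?e)) < d" using s h_d[of n] h_pos[of n] by simp
      ultimately show ?thesis by (rule d(2))
    qed
    have x: "x \<in> \<Omega>" and xh: "x + h n *\<^sub>R ?e \<in> \<Omega>"
      using seg[of 0] seg[of "h n"] h_pos[of n] by auto
    have "\<bar>w0 (x + h n *\<^sub>R ?e) - w0 x\<bar> \<le> L * h n"
      using w_lipschitz_segment[OF L, of "h n" x] seg h_pos[of n] x xh by (simp add: w0_def)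
    moreover have "\<bar>\<phi> (x + h n *\<^sub>R ?e) - \<phi> x\<bar> \<le> M' * h n"
      using smooth_line_lipschitz[OF sm convex_UNIV, of i x M' "h n" 0] M'(2) h_pos[of n] by simp
    moreover have "F (x + h n *\<^sub>R ?e) - F x =
        \<phi> (x + h n *\<^sub>R ?e) * (w0 (x + h n *\<^sub>R ?e) - w0 x) + (\<phi> (x + h n *\<^sub>R ?e) - \<phi> x) * w0 x"
      by (simp add: F_def algebra_simps)
    ultimately have "\<bar>F (x + h n *\<^sub>R ?e) - F x\<bar> \<le> M * (L * h n) + (M' * h n) * B"
      using M M' L B h_pos[of n]
      by (auto simp: abs_mult intro!: order_trans[OF abs_triangle_ineq] add_mono mult_mono)
    then have "\<bar>D n x\<bar> \<le> K"
      using h_pos[of n] by (simp add: D_def K_def abs_divide field_simps)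
    moreover have "x \<in> cball 0 (R + d)" using R[OF x] d(1) by simp
    ultimately show ?thesis by simp
  qed
  have "(\<lambda>n. \<integral>x. D n x \<partial>lborel) \<longlonglongrightarrow> (\<integral>x. \<phi> x * dw i x + pdiff i \<phi> x * w0 x \<partial>lborel)"
  proof (rule integral_dominated_convergence)
    show "integrable lborel (\<lambda>x. K * indicator (cball 0 (R + d)) x :: real)"
      by (intro integrable_mult_right integrable_real_indicator) (auto simp: emeasure_bounded_finite[OF bounded_cball, unfolded infinity_ennreal_def])
    show "AE x in lborel. norm (D n x) \<le> K * indicator (cball 0 (R + d)) x" for n
      using D_bound by (intro AE_I2) simp
    show "(\<lambda>x. D n x) \<in> borel_measurable lborel" for n unfolding D_def by measurable
    show "AE x in lborel. (\<lambda>n. D n x) \<longlonglongrightarrow> \<phi> x * dw i x + pdiff i \<phi> x * w0 x"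
      using AE_interior
    proof eventually_elim
      fix x assume *: "x \<in> \<Omega> \<longrightarrow> (\<exists>t\<in>T. x \<in> interior t)"
      have xh: "(\<lambda>n. x + h n *\<^sub>R ?e) \<longlonglongrightarrow> x"
        using tendsto_add[OF tendsto_const tendsto_scaleR[OF h_lim tendsto_const], of x ?e] by simp
      show "(\<lambda>n. D n x) \<longlonglongrightarrow> \<phi> x * dw i x + pdiff i \<phi> x * w0 x"
      proof (cases "x \<in> \<Omega>")
        case True
        then obtain t where t: "t \<in> T" "x \<in> interior t" using * by blast
        have h0: "h n \<noteq> 0" for n using h_pos[of n] by simp
        have 1: "(\<lambda>n. (w0 (x + h n *\<^sub>R ?e) - w0 x) / h n) \<longlonglongrightarrow> dw i x"
          unfolding dw_eq[OF True t] by (rule w0_quotient_tendsto[OF True t h_lim h0])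
        have 2: "(\<lambda>n. (\<phi> (x + h n *\<^sub>R ?e) - \<phi> x) / h n) \<longlonglongrightarrow> pdiff i \<phi> x"
          using diff_quotient_tendsto[OF smooth_line_deriv[OF sm, of x i 0] h_lim h0] by simp
        have 3: "(\<lambda>n. \<phi> (x + h n *\<^sub>R ?e)) \<longlonglongrightarrow> \<phi> x"
          by (rule continuous_on_tendsto_compose[OF smooth_continuous[OF sm, of UNIV] xh]) auto
        have "(\<lambda>n. \<phi> (x + h n *\<^sub>R ?e) * ((w0 (x + h n *\<^sub>R ?e) - w0 x) / h n)
            + (\<phi> (x + h n *\<^sub>R ?e) - \<phi> x) / h n * w0 x) \<longlonglongrightarrow> \<phi> x * dw i x + pdiff i \<phi> x * w0 x"
          by (intro tendsto_add tendsto_mult 1 2 3 tendsto_const)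
        moreover have "\<phi> (x + h n *\<^sub>R ?e) * ((w0 (x + h n *\<^sub>R ?e) - w0 x) / h n)
            + (\<phi> (x + h n *\<^sub>R ?e) - \<phi> x) / h n * w0 x = D n x" for n
          using h0[of n] by (simp add: D_def F_def field_simps)
        ultimately show ?thesis by simp
      next
        case False
        then have xC: "x \<in> - C" using C(2) by auto
        have "open (- C)" using C(1) by (simp add: compact_imp_closed open_Compl)
        then have "\<forall>\<^sub>F n in sequentially. x + h n *\<^sub>R ?e \<in> - C"
          using topological_tendstoD[OF xh _ xC] by blast
        then have "\<forall>\<^sub>F n in sequentially. 0 = D n x"
          by eventually_elim (use F0 xC in \<open>simp add: D_def\<close>)
        then have "(\<lambda>n. D n x) \<longlonglongrightarrow> 0" by (rule Lim_transform_eventually[OF tendsto_const])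
        moreover have "\<phi> x * dw i x + pdiff i \<phi> x * w0 x = 0" using False test_functions_eq_0[OF \<phi>] test_functions_eq_0[OF \<phi>'] by simp
        ultimately show ?thesis by simp
      qed
    qed
  qed measurable
  then have "(\<lambda>n. 0::real) \<longlonglongrightarrow> (\<integral>x. \<phi> x * dw i x + pdiff i \<phi> x * w0 x \<partial>lborel)"
    by (simp only: D_int0)
  from LIMSEQ_unique[OF this tendsto_const] show ?thesis .
qed

lemma w_weak_deriv: "is_weak_deriv \<Omega> [i] w (dw i)"
  unfolding is_weak_deriv_pdiff_iff[OF \<Omega>_open]
proof (intro conjI ballI)
  have L2: "w \<in> L2_space \<Omega>" "dw i \<in> L2_space \<Omega>"
    using Linf_L2[OF \<Omega>_open \<Omega>_bounded] w_Linf dw_Linf by auto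
  note l = L2[THEN L2_locally_integrable[OF \<Omega>_open]]
  show "locally_integrable \<Omega> w" "locally_integrable \<Omega> (dw i)" by (rule l)+
  fix \<phi> assume \<phi>: "\<phi> \<in> test_functions \<Omega>"
  note \<phi>' = test_functions_pdiff[OF \<phi>, of i]
  note [measurable] = test_functions_measurable[OF \<phi>] test_functions_measurable[OF \<phi>']
  have w_eq: "pdiff i \<phi> x * w x = pdiff i \<phi> x * w0 x" for x
    using test_functions_eq_0[OF \<phi>', of x] by (cases "x \<in> \<Omega>") (auto simp: w0_def)
  have int1: "integrable lebesgue (\<lambda>x. pdiff i \<phi> x * w0 x)"
    using test_times_locally_integrable[OF \<phi>' l(1)] by (simp only: real_scaleR_def w_eq)
  have int2: "integrable lebesgue (\<lambda>x. \<phi> x * dw i x)"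
    using test_times_locally_integrable[OF \<phi> l(2)] by simp
  have "(LINT x|lebesgue. \<phi> x * dw i x) + (LINT x|lebesgue. pdiff i \<phi> x * w0 x) =
      (LINT x|lebesgue. \<phi> x * dw i x + pdiff i \<phi> x * w0 x)"
    using int1 int2 by simp
  also have "\<dots> = (\<integral>x. \<phi> x * dw i x + pdiff i \<phi> x * w0 x \<partial>lborel)"
    by (rule integral_completion) measurable
  also have "\<dots> = 0" by (rule integration_by_parts[OF \<phi>])
  finally show "(LINT x|lebesgue. pdiff i \<phi> x *\<^sub>R w x) = - (LINT x|lebesgue. \<phi> x *\<^sub>R dw i x)"
    by (simp add: w_eq)
qed

lemma w_H1: "w \<in> H1 \<Omega>"
  using Linf_L2[OF \<Omega>_open \<Omega>_bounded w_Linf] Linf_L2[OF \<Omega>_open \<Omega>_bounded dw_Linf] w_weak_deriv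
  by (subst H1_iff[OF \<Omega>_open]) blast

end

section \<open>Finite element spaces\<close>

lemma poly_of_degree_smooth:
  assumes "poly_of_degree k p"
  shows "smooth p"
proof -
  obtain c where c: "\<And>x. p x = (\<Sum>\<alpha> | (\<Sum>i\<in>UNIV. \<alpha> i) \<le> k. c \<alpha> * (\<Prod>i\<in>UNIV. (x $ i) ^ \<alpha> i))"
    using assms by (auto simp: poly_of_degree_def)
  have "p = (\<lambda>x. \<Sum>\<alpha> | (\<Sum>i\<in>UNIV. \<alpha> i) \<le> k. c \<alpha> * (\<Prod>i\<in>UNIV. (x $ i) ^ \<alpha> i))"
    using c by (rule ext)
  moreover have "smooth (\<lambda>x. \<Sum>\<alpha> | (\<Sum>i\<in>UNIV. \<alpha> i) \<le> k. c \<alpha> * (\<Prod>i\<in>UNIV. (x $ i) ^ \<alpha> i))"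
    by (intro smooth_sum smooth_mult smooth_const smooth_prod smooth_power smooth_vec_nth)
  ultimately show ?thesis by simp
qed

lemma poly_of_degree_add:
  assumes "poly_of_degree k p" "poly_of_degree k q"
  shows "poly_of_degree k (\<lambda>x. p x + q x)"
proof -
  obtain c where c: "\<And>x. p x = (\<Sum>\<alpha> | (\<Sum>i\<in>UNIV. \<alpha> i) \<le> k. c \<alpha> * (\<Prod>i\<in>UNIV. (x $ i) ^ \<alpha> i))"
    using assms(1) by (auto simp: poly_of_degree_def)
  obtain d where d: "\<And>x. q x = (\<Sum>\<alpha> | (\<Sum>i\<in>UNIV. \<alpha> i) \<le> k. d \<alpha> * (\<Prod>i\<in>UNIV. (x $ i) ^ \<alpha> i))"
    using assms(2) by (auto simp: poly_of_degree_def)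
  show ?thesis
    unfolding poly_of_degree_def
    by (intro exI[of _ "\<lambda>\<alpha>. c \<alpha> + d \<alpha>"]) (simp add: c d sum.distrib distrib_right)
qed

lemma poly_of_degree_scale:
  assumes "poly_of_degree k p"
  shows "poly_of_degree k (\<lambda>x. r * p x)"
proof -
  obtain c where c: "\<And>x. p x = (\<Sum>\<alpha> | (\<Sum>i\<in>UNIV. \<alpha> i) \<le> k. c \<alpha> * (\<Prod>i\<in>UNIV. (x $ i) ^ \<alpha> i))"
    using assms by (auto simp: poly_of_degree_def)
  show ?thesis
    unfolding poly_of_degree_def
    by (intro exI[of _ "\<lambda>\<alpha>. r * c \<alpha>"]) (simp add: c sum_distrib_left mult_ac)
qed

lemma poly_of_degree_0: "poly_of_degree k (\<lambda>x. 0)"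
  unfolding poly_of_degree_def by (intro exI[of _ "\<lambda>\<alpha>. 0"]) simp

lemma finite_multi_indices: "finite {\<alpha> :: 'n::finite \<Rightarrow> nat. (\<Sum>i\<in>UNIV. \<alpha> i) \<le> k}"
proof (rule finite_subset)
  show "{\<alpha> :: 'n \<Rightarrow> nat. (\<Sum>i\<in>UNIV. \<alpha> i) \<le> k} \<subseteq> {\<alpha>. \<forall>i. (i \<in> UNIV \<longrightarrow> \<alpha> i \<in> {..k}) \<and> (i \<notin> UNIV \<longrightarrow> \<alpha> i = 0)}"
  proof
    fix \<alpha> :: "'n \<Rightarrow> nat" assume "\<alpha> \<in> {\<alpha>. (\<Sum>i\<in>UNIV. \<alpha> i) \<le> k}"
    then have "\<alpha> i \<le> k" for i using member_le_sum[of i UNIV \<alpha>] by (simp add: order_trans)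
    then show "\<alpha> \<in> {\<alpha>. \<forall>i. (i \<in> UNIV \<longrightarrow> \<alpha> i \<in> {..k}) \<and> (i \<notin> UNIV \<longrightarrow> \<alpha> i = 0)}" by simp
  qed
  show "finite {\<alpha> :: 'n \<Rightarrow> nat. \<forall>i. (i \<in> UNIV \<longrightarrow> \<alpha> i \<in> {..k}) \<and> (i \<notin> UNIV \<longrightarrow> \<alpha> i = 0)}"
    by (rule finite_set_of_finite_funs) auto
qed

lemma sum_fun_apply: "(\<Sum>i\<in>I. f i) x = (\<Sum>i\<in>I. f i x :: 'b::comm_monoid_add)"
  by (induction I rule: infinite_finite_induct) simp_all

lemma scaleR_fun_apply [simp]: "(c *\<^sub>R f) x = c *\<^sub>R f x"
  by (simp add: scaleR_fun_def)

lemma ae_zero_subset_Vh: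
  fixes \<Omega> :: "(real ^ 'n::finite) set"
  shows "ae_zero \<Omega> \<subseteq> Vh \<Omega> k T"
proof
  fix f :: "real ^ 'n \<Rightarrow> real" assume "f \<in> ae_zero \<Omega>"
  then show "f \<in> Vh \<Omega> k T"
    unfolding Vh_def ae_zero_def using poly_of_degree_0
    by (intro CollectI exI[of _ "\<lambda>x. 0"] conjI ballI) auto
qed

lemma subspace_Vh: "subspace (Vh \<Omega> k T)"
proof (rule subspaceI)
  show "0 \<in> Vh \<Omega> k T" by (rule subsetD[OF ae_zero_subset_Vh]) (simp add: ae_zero_def)
next
  fix u v assume "u \<in> Vh \<Omega> k T" "v \<in> Vh \<Omega> k T"
  then obtain w w' where w: "continuous_on (closure \<Omega>) w" "\<And>t. t \<in> T \<Longrightarrow> \<exists>p. poly_of_degree k p \<and> (\<forall>x\<in>t. w x = p x)"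
      "AE x in lebesgue_on \<Omega>. u x = w x"
    and w': "continuous_on (closure \<Omega>) w'" "\<And>t. t \<in> T \<Longrightarrow> \<exists>p. poly_of_degree k p \<and> (\<forall>x\<in>t. w' x = p x)"
      "AE x in lebesgue_on \<Omega>. v x = w' x"
    by (auto simp: Vh_def)
  have "\<exists>p. poly_of_degree k p \<and> (\<forall>x\<in>t. w x + w' x = p x)" if t: "t \<in> T" for t
  proof -
    obtain p where "poly_of_degree k p" "\<forall>x\<in>t. w x = p x" using w(2)[OF t] by blast
    moreover obtain q where "poly_of_degree k q" "\<forall>x\<in>t. w' x = q x" using w'(2)[OF t] by blast
    ultimately show ?thesis by (intro exI[of _ "\<lambda>x. p x + q x"]) (simp add: poly_of_degree_add)
  qed
  moreover have "AE x in lebesgue_on \<Omega>. (u + v) x = w x + w' x"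
    using w(3) w'(3) by eventually_elim simp
  moreover have "continuous_on (closure \<Omega>) (\<lambda>x. w x + w' x)" using w(1) w'(1) by (rule continuous_on_add)
  ultimately show "u + v \<in> Vh \<Omega> k T"
    unfolding Vh_def by (intro CollectI exI[of _ "\<lambda>x. w x + w' x"]) blast
next
  fix r u assume "u \<in> Vh \<Omega> k T"
  then obtain w where w: "continuous_on (closure \<Omega>) w" "\<And>t. t \<in> T \<Longrightarrow> \<exists>p. poly_of_degree k p \<and> (\<forall>x\<in>t. w x = p x)"
      "AE x in lebesgue_on \<Omega>. u x = w x"
    by (auto simp: Vh_def)
  have "\<exists>p. poly_of_degree k p \<and> (\<forall>x\<in>t. r * w x = p x)" if t: "t \<in> T" for t
  proof -
    obtain p where "poly_of_degree k p" "\<forall>x\<in>t. w x = p x" using w(2)[OF t] by blast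
    then show ?thesis by (intro exI[of _ "\<lambda>x. r * p x"]) (simp add: poly_of_degree_scale)
  qed
  moreover have "AE x in lebesgue_on \<Omega>. (r *\<^sub>R u) x = r * w x"
    using w(3) by eventually_elim simp
  moreover have "continuous_on (closure \<Omega>) (\<lambda>x. r * w x)" using w(1) by (intro continuous_intros)
  ultimately show "r *\<^sub>R u \<in> Vh \<Omega> k T"
    unfolding Vh_def by (intro CollectI exI[of _ "\<lambda>x. r * w x"]) blast
qed

locale triangulated_domain =
  fixes \<Omega> :: "(real ^ 'n::finite) set" and T :: "(real ^ 'n) set set" and k :: nat
  assumes \<Omega>_open: "open \<Omega>" and \<Omega>_bounded: "bounded \<Omega>" and T: "triangulation_of \<Omega> T"
begin

lemma T_facts: "finite T" "\<And>t. t \<in> T \<Longrightarrow> compact t" "\<And>t. t \<in> T \<Longrightarrow> convex t" "\<Union>T = closure \<Omega>"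
proof -
  note T' = T[unfolded triangulation_of_def, THEN conjunct1]
    T[unfolded triangulation_of_def, THEN conjunct2, THEN conjunct1]
    T[unfolded triangulation_of_def, THEN conjunct2, THEN conjunct2]
  show "\<Union>T = closure \<Omega>" by (rule T'(3))
  show "finite T" using T'(1)[unfolded triangulation_def] by (rule conjunct1)
  show "compact t" "convex t" if t: "t \<in> T" for t
  proof -
    obtain C where "\<not> affine_dependent C" "t = convex hull C"
      using bspec[OF T'(2) t] unfolding simplex_def by (elim exE conjE)
    then show "compact t" "convex t"
      by (simp_all add: aff_independent_finite finite_imp_compact_convex_hull)
  qed
qed

lemma Vh_H1: "Vh \<Omega> k T \<subseteq> H1 \<Omega>"
proof
  fix v assume "v \<in> Vh \<Omega> k T"
  then obtain w where w: "continuous_on (closure \<Omega>) w" "\<forall>t\<in>T. \<exists>p. poly_of_degree k p \<and> (\<forall>x\<in>t. w x = p x)"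
      "AE x in lebesgue_on \<Omega>. v x = w x"
    by (auto simp: Vh_def)
  obtain p where p: "\<forall>t\<in>T. poly_of_degree k (p t) \<and> (\<forall>x\<in>t. w x = p t x)"
    using bchoice[OF w(2)] by blast
  have p_smooth: "smooth (p t)" if "t \<in> T" for t
    using p that by (intro poly_of_degree_smooth[of k]) blast
  interpret piecewise_smooth \<Omega> T w p
    using \<Omega>_open \<Omega>_bounded T_facts closure_subset[of \<Omega>] continuous_on_subset[OF w(1) closure_subset] p
      p_smooth by unfold_locales auto
  show "v \<in> H1 \<Omega>" by (rule H1_AE_cong[OF \<Omega>_open w_H1 w(3)])
qed

text \<open>
  A finite element function is determined almost everywhere by the coefficients of its polynomials.
  Neighbouring simplices overlap in faces, so \<open>\<tau>\<close> assigns each point to one simplex containing it, and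
  the spanning functions are the monomials cut off to the fibres of \<open>\<tau>\<close>.
\<close>

lemma finite_dim_Vh: "finite_dim_mod (ae_zero \<Omega>) (Vh \<Omega> k T)"
proof -
  define A where "A = {\<alpha> :: 'n \<Rightarrow> nat. (\<Sum>i\<in>UNIV. \<alpha> i) \<le> k}"
  define \<tau> where "\<tau> x = (SOME t. t \<in> T \<and> x \<in> t)" for x
  define e where "e = (\<lambda>(t, \<alpha>) x. if \<tau> x = t then \<Prod>i\<in>UNIV. (x $ i) ^ \<alpha> i else (0::real))"
  have fin: "finite T" "finite A" using T_facts(1) finite_multi_indices by (auto simp: A_def)
  have \<tau>: "\<tau> x \<in> T \<and> x \<in> \<tau> x" if "x \<in> \<Omega>" for x
  proof -
    have "\<exists>t. t \<in> T \<and> x \<in> t" using that T_facts(4) closure_subset[of \<Omega>] by blast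
    then show ?thesis unfolding \<tau>_def by (rule someI_ex)
  qed
  have "\<exists>b\<in>span (e ` (T \<times> A)). v - b \<in> ae_zero \<Omega>" if v: "v \<in> Vh \<Omega> k T" for v
  proof -
    obtain w where w: "\<forall>t\<in>T. \<exists>p. poly_of_degree k p \<and> (\<forall>x\<in>t. w x = p x)"
        "AE x in lebesgue_on \<Omega>. v x = w x"
      using v by (auto simp: Vh_def)
    have "\<forall>t\<in>T. \<exists>c. \<forall>x\<in>t. w x = (\<Sum>\<alpha>\<in>A. c \<alpha> * (\<Prod>i\<in>UNIV. (x $ i) ^ \<alpha> i))"
    proof
      fix t assume "t \<in> T"
      then obtain p where p: "poly_of_degree k p" "\<forall>x\<in>t. w x = p x" using w(1) by blast
      obtain c where "\<forall>x. p x = (\<Sum>\<alpha>\<in>A. c \<alpha> * (\<Prod>i\<in>UNIV. (x $ i) ^ \<alpha> i))"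
        using p(1) unfolding poly_of_degree_def A_def by blast
      then show "\<exists>c. \<forall>x\<in>t. w x = (\<Sum>\<alpha>\<in>A. c \<alpha> * (\<Prod>i\<in>UNIV. (x $ i) ^ \<alpha> i))" using p(2) by auto
    qed
    from bchoice[OF this] obtain c where
      c: "\<forall>t\<in>T. \<forall>x\<in>t. w x = (\<Sum>\<alpha>\<in>A. c t \<alpha> * (\<Prod>i\<in>UNIV. (x $ i) ^ \<alpha> i))" by blast
    define b where "b = (\<Sum>q\<in>T \<times> A. c (fst q) (snd q) *\<^sub>R e q)"
    have "b \<in> span (e ` (T \<times> A))"
      unfolding b_def by (intro span_sum span_scale span_base imageI)
    moreover have "v - b \<in> ae_zero \<Omega>"
    proof -
      have "w x = b x" if x: "x \<in> \<Omega>" for x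
      proof -
        have "b x = (\<Sum>t\<in>T. \<Sum>\<alpha>\<in>A. c t \<alpha> * e (t, \<alpha>) x)"
          unfolding b_def sum_fun_apply by (simp add: sum.cartesian_product case_prod_unfold)
        also have "\<dots> = (\<Sum>t\<in>T. if t = \<tau> x then (\<Sum>\<alpha>\<in>A. c t \<alpha> * (\<Prod>i\<in>UNIV. (x $ i) ^ \<alpha> i)) else 0)"
          by (intro sum.cong refl) (auto simp: e_def)
        also have "\<dots> = (\<Sum>\<alpha>\<in>A. c (\<tau> x) \<alpha> * (\<Prod>i\<in>UNIV. (x $ i) ^ \<alpha> i))"
          using \<tau>[OF x] fin by (simp add: sum.delta)
        also have "\<dots> = w x" using \<tau>[OF x] c by metis
        finally show ?thesis by simp
      qed
      moreover have "AE x in lebesgue_on \<Omega>. x \<in> \<Omega>" using AE_space[of "lebesgue_on \<Omega>"] by simp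
      ultimately show ?thesis
        unfolding ae_zero_def using w(2) by (auto elim!: eventually_elim2)
    qed
    ultimately show ?thesis by blast
  qed
  then show ?thesis
    unfolding finite_dim_mod_def using fin by (intro exI[of _ "e ` (T \<times> A)"]) auto
qed

lemma ae_zero_component: "f \<in> ae_zero \<Omega> \<Longrightarrow> (\<lambda>x. f x $ i) \<in> ae_zero \<Omega>"
  by (auto simp: ae_zero_def elim: eventually_mono)

lemma ae_zero_subset_VVh: "ae_zero \<Omega> \<subseteq> VVh \<Omega> k T"
  using subsetD[OF ae_zero_subset_Vh ae_zero_component] by (auto simp: VVh_def)

lemma subspace_VVh: "subspace (VVh \<Omega> k T)"
proof (rule subspaceI)
  show "0 \<in> VVh \<Omega> k T" using ae_zero_subset_VVh by (auto simp: ae_zero_def)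
  show "u + v \<in> VVh \<Omega> k T" if "u \<in> VVh \<Omega> k T" "v \<in> VVh \<Omega> k T" for u v
  proof -
    have "(\<lambda>x. (u + v) x $ i) = (\<lambda>x. u x $ i) + (\<lambda>x. v x $ i)" for i by (simp add: fun_eq_iff)
    with that show ?thesis unfolding VVh_def
      by (simp only: mem_Collect_eq) (intro allI subspace_add[OF subspace_Vh], auto)
  qed
  show "r *\<^sub>R u \<in> VVh \<Omega> k T" if "u \<in> VVh \<Omega> k T" for r u
  proof -
    have "(\<lambda>x. (r *\<^sub>R u) x $ i) = r *\<^sub>R (\<lambda>x. u x $ i)" for i by (simp add: fun_eq_iff)
    with that show ?thesis unfolding VVh_def
      by (simp only: mem_Collect_eq) (intro allI subspace_scale[OF subspace_Vh], auto)
  qed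
qed

lemma VVh_H1: "VVh \<Omega> k T \<subseteq> H1 \<Omega>"
proof
  fix v assume v: "v \<in> VVh \<Omega> k T"
  show "v \<in> H1 \<Omega>"
  proof (rule H1_componentwise[OF \<Omega>_open])
    fix b :: "real ^ 'n" assume "b \<in> Basis"
    then obtain i where "b = axis i 1" by (auto simp: Basis_vec_def)
    then show "(\<lambda>x. v x \<bullet> b) \<in> H1 \<Omega>" using v Vh_H1 by (auto simp: VVh_def inner_axis)
  qed
qed

text \<open>
  The embeddings \<open>E i\<close> of scalar functions as \<open>i\<close>-th components carry a spanning set of the scalar
  space to one of the vector space.
\<close>

lemma finite_dim_VVh: "finite_dim_mod (ae_zero \<Omega>) (VVh \<Omega> k T)"
proof -
  obtain B where B: "finite B" "\<forall>v\<in>Vh \<Omega> k T. \<exists>b\<in>span B. v - b \<in> ae_zero \<Omega>"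
    using finite_dim_Vh unfolding finite_dim_mod_def by (elim exE conjE)
  define E where "E i f = (\<lambda>x. f x *\<^sub>R axis i (1::real))" for i :: 'n and f :: "real ^ 'n \<Rightarrow> real"
  have lin: "linear (E i)" for i
    by (rule linearI) (auto simp: E_def fun_eq_iff scaleR_left_distrib)
  define B' where "B' = (\<Union>i. E i ` B)"
  have E_span: "E i b \<in> span B'" if "b \<in> span B" for i b
  proof -
    have "E i b \<in> span (E i ` B)" using linear_span_image[OF lin] that by blast
    also have "\<dots> \<subseteq> span B'" by (rule span_mono) (auto simp: B'_def)
    finally show ?thesis .
  qed
  have "\<exists>b\<in>span B'. v - b \<in> ae_zero \<Omega>" if v: "v \<in> VVh \<Omega> k T" for v
  proof -
    have "\<forall>i. \<exists>b. b \<in> span B \<and> (\<lambda>x. v x $ i) - b \<in> ae_zero \<Omega>" using v B(2) by (auto simp: VVh_def)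
    then obtain c where c: "\<And>i. c i \<in> span B" "\<And>i. (\<lambda>x. v x $ i) - c i \<in> ae_zero \<Omega>" by metis
    have "AE x in lebesgue_on \<Omega>. \<forall>i\<in>UNIV. v x $ i - c i x = 0"
      using c(2) by (intro AE_finite_allI) (auto simp: ae_zero_def)
    then have "AE x in lebesgue_on \<Omega>. (v - (\<Sum>i\<in>UNIV. E i (c i))) x = 0"
    proof eventually_elim
      fix x assume "\<forall>i\<in>UNIV. v x $ i - c i x = 0"
      then have "v x = (\<Sum>i\<in>UNIV. E i (c i) x)"
        by (subst basis_expansion[symmetric, of "v x"]) (simp add: E_def scalar_mult_eq_scaleR)
      then show "(v - (\<Sum>i\<in>UNIV. E i (c i))) x = 0" by (simp add: sum_fun_apply)
    qed
    moreover have "(\<Sum>i\<in>UNIV. E i (c i)) \<in> span B'" by (intro span_sum E_span c)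
    ultimately show ?thesis unfolding ae_zero_def by blast
  qed
  moreover have "finite B'" using B(1) by (auto simp: B'_def)
  ultimately show ?thesis unfolding finite_dim_mod_def by (intro exI[of _ B'] conjI ballI)
qed

end

section \<open>The two bilinear forms\<close>

text \<open>
  The constant comes from \<open>(p + q)\<^sup>2 \<le> 2 p\<^sup>2 + 2 q\<^sup>2\<close> for the two terms of each entry of the strain.
\<close>

lemma L2_E_op:
  fixes u :: "real ^ 'n::finite \<Rightarrow> real ^ 'n"
  assumes \<Omega>: "open \<Omega>" and u: "u \<in> H1 \<Omega>"
  shows "E_op \<Omega> u \<in> L2_space \<Omega>" and "a_form \<Omega> u u \<le> 4 * h1_inner \<Omega> u u"
proof -
  have dm: "weak_pd \<Omega> i u \<in> borel_measurable (lebesgue_on \<Omega>)" for i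
    using H1_weak_pd(2)[OF \<Omega> u] by (simp add: L2_space_def)
  have dm': "(\<lambda>x. weak_pd \<Omega> i u x $ j) \<in> borel_measurable (lebesgue_on \<Omega>)" for i j
  proof -
    have "(\<lambda>x. weak_pd \<Omega> i u x \<bullet> axis j 1) \<in> borel_measurable (lebesgue_on \<Omega>)"
      using dm by (intro borel_measurable_inner borel_measurable_const)
    then show ?thesis by (simp add: inner_axis)
  qed
  have Em: "E_op \<Omega> u \<in> borel_measurable (lebesgue_on \<Omega>)"
  proof (subst borel_measurable_euclidean_space, rule ballI)
    fix b :: "real ^ 'n ^ 'n" assume "b \<in> Basis"
    then obtain r s where b: "b = axis r (axis s 1)" by (auto simp: Basis_vec_def)
    have "(\<lambda>x. E_op \<Omega> u x \<bullet> b) = (\<lambda>x. weak_pd \<Omega> s u x $ r + weak_pd \<Omega> r u x $ s)"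
      by (simp add: b E_op_def inner_axis)
    then show "(\<lambda>x. E_op \<Omega> u x \<bullet> b) \<in> borel_measurable (lebesgue_on \<Omega>)"
      using dm' by simp
  qed
  have pointwise: "(norm (E_op \<Omega> u x))\<^sup>2 \<le> 4 * (\<Sum>j\<in>UNIV. (norm (weak_pd \<Omega> j u x))\<^sup>2)" for x
  proof -
    have n: "(norm y)\<^sup>2 = (\<Sum>i\<in>UNIV. (y $ i)\<^sup>2)" for y :: "real ^ 'n"
      unfolding power2_norm_eq_inner inner_vec_def by (simp add: power2_eq_square)
    have ineq: "(p + q)\<^sup>2 \<le> 2 * p\<^sup>2 + 2 * q\<^sup>2" for p q :: real
      using sum_squares_bound[of p q] by (simp add: power2_sum)
    have "(norm (E_op \<Omega> u x))\<^sup>2 = (\<Sum>r\<in>UNIV. \<Sum>s\<in>UNIV. (weak_pd \<Omega> s u x $ r + weak_pd \<Omega> r u x $ s)\<^sup>2)"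
      unfolding power2_norm_eq_inner inner_vec_def E_op_def by (simp add: power2_eq_square)
    also have "\<dots> \<le> (\<Sum>r\<in>UNIV. \<Sum>s\<in>UNIV. 2 * (weak_pd \<Omega> s u x $ r)\<^sup>2 + 2 * (weak_pd \<Omega> r u x $ s)\<^sup>2)"
      by (intro sum_mono ineq)
    also have "\<dots> = 2 * (\<Sum>r\<in>UNIV. \<Sum>s\<in>UNIV. (weak_pd \<Omega> s u x $ r)\<^sup>2) + 2 * (\<Sum>r\<in>UNIV. \<Sum>s\<in>UNIV. (weak_pd \<Omega> r u x $ s)\<^sup>2)"
      by (simp add: sum.distrib sum_distrib_left)
    also have "(\<Sum>r\<in>UNIV. \<Sum>s\<in>UNIV. (weak_pd \<Omega> s u x $ r)\<^sup>2) = (\<Sum>r\<in>UNIV. \<Sum>s\<in>UNIV. (weak_pd \<Omega> r u x $ s)\<^sup>2)"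
      by (rule sum.swap)
    finally show ?thesis by (simp add: n)
  qed
  have di: "integrable (lebesgue_on \<Omega>) (\<lambda>x. (norm (weak_pd \<Omega> j u x))\<^sup>2)" for j
    using H1_weak_pd(2)[OF \<Omega> u] by (simp add: L2_space_def)
  have Si: "integrable (lebesgue_on \<Omega>) (\<lambda>x. 4 * (\<Sum>j\<in>UNIV. (norm (weak_pd \<Omega> j u x))\<^sup>2))"
    by (intro integrable_mult_right Bochner_Integration.integrable_sum di)
  have Ei: "integrable (lebesgue_on \<Omega>) (\<lambda>x. (norm (E_op \<Omega> u x))\<^sup>2)"
  proof (rule Bochner_Integration.integrable_bound[OF Si])
    show "AE x in lebesgue_on \<Omega>. norm ((norm (E_op \<Omega> u x))\<^sup>2) \<le> norm (4 * (\<Sum>j\<in>UNIV. (norm (weak_pd \<Omega> j u x))\<^sup>2))"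
      using pointwise order_trans[OF pointwise abs_ge_self] by (intro AE_I2) simp
  qed (use Em in measurable)
  show "E_op \<Omega> u \<in> L2_space \<Omega>" using Em Ei by (simp add: L2_space_def)
  have "a_form \<Omega> u u = (LINT x|lebesgue_on \<Omega>. (norm (E_op \<Omega> u x))\<^sup>2)"
    by (simp add: a_form_def power2_norm_eq_inner)
  also have "\<dots> \<le> (LINT x|lebesgue_on \<Omega>. 4 * (\<Sum>j\<in>UNIV. (norm (weak_pd \<Omega> j u x))\<^sup>2))"
    by (rule integral_mono[OF Ei Si pointwise])
  also have "\<dots> = 4 * (\<Sum>j\<in>UNIV. LINT x|lebesgue_on \<Omega>. (norm (weak_pd \<Omega> j u x))\<^sup>2)"
    using di by (simp add: Bochner_Integration.integral_sum)
  also have "\<dots> \<le> 4 * h1_inner \<Omega> u u"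
  proof -
    have "0 \<le> (LINT x|lebesgue_on \<Omega>. u x \<bullet> u x)" by (rule integral_nonneg_AE) simp
    then show ?thesis by (simp add: h1_inner_def power2_norm_eq_inner)
  qed
  finally show "a_form \<Omega> u u \<le> 4 * h1_inner \<Omega> u u" .
qed

text \<open>
  As a semi-inner product, the form obeys its own Cauchy-Schwarz inequality: a rigid motion, which has
  \<open>a v v = 0\<close>, satisfies \<open>a v w = 0\<close> for all \<open>w\<close>, and the boundedness of the form reduces to that of
  its diagonal.
\<close>

lemma semi_inner_a_form:
  assumes \<Omega>: "open (\<Omega> :: (real ^ 'n::finite) set)"
  shows "semi_inner (H1 \<Omega>) (a_form \<Omega>)"
proof
  interpret X: semi_inner "H1 \<Omega> :: (real ^ 'n \<Rightarrow> real ^ 'n) set" "h1_inner \<Omega>" by (rule semi_inner_H1[OF \<Omega>])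
  show "subspace (H1 \<Omega> :: (real ^ 'n \<Rightarrow> real ^ 'n) set)" by (rule X.subspace_X)
  note E2 = L2_E_op(1)[OF \<Omega>] and int = L2_inner_integrable
  have m: "(\<lambda>x. f x \<bullet> g x) \<in> borel_measurable (lebesgue_on \<Omega>)" if "f \<in> L2_space \<Omega>" "g \<in> L2_space \<Omega>"
    for f g :: "real ^ 'n \<Rightarrow> real ^ 'n ^ 'n"
    using int[OF that] by (rule borel_measurable_integrable)
  fix u v w :: "real ^ 'n \<Rightarrow> real ^ 'n" and c
  assume u: "u \<in> H1 \<Omega>"
  show "0 \<le> a_form \<Omega> u u" unfolding a_form_def by (rule integral_nonneg_AE) simp
  assume w: "w \<in> H1 \<Omega>"
  show "a_form \<Omega> u w = a_form \<Omega> w u" unfolding a_form_def by (simp add: inner_commute)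
  have "AE x in lebesgue_on \<Omega>. \<forall>i\<in>UNIV. weak_pd \<Omega> i (\<lambda>x. c *\<^sub>R u x) x = c *\<^sub>R weak_pd \<Omega> i u x"
    by (rule AE_finite_allI) (auto intro: H1_scale(2)[OF \<Omega> u])
  then have ae: "AE x in lebesgue_on \<Omega>. E_op \<Omega> (c *\<^sub>R u) x = c *\<^sub>R E_op \<Omega> u x"
    by eventually_elim (simp add: E_op_def vec_eq_iff scaleR_fun_def algebra_simps)
  have "a_form \<Omega> (c *\<^sub>R u) w = (LINT x|lebesgue_on \<Omega>. c * (E_op \<Omega> u x \<bullet> E_op \<Omega> w x))"
    unfolding a_form_def
    by (intro integral_cong_AE m E2 borel_measurable_times borel_measurable_const X.X_closed u w)
      (use ae in eventually_elim, simp)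
  then show "a_form \<Omega> (c *\<^sub>R u) w = c * a_form \<Omega> u w" by (simp add: a_form_def)
  assume v: "v \<in> H1 \<Omega>"
  have "AE x in lebesgue_on \<Omega>. \<forall>i\<in>UNIV. weak_pd \<Omega> i (\<lambda>x. u x + v x) x = weak_pd \<Omega> i u x + weak_pd \<Omega> i v x"
    by (rule AE_finite_allI) (auto intro: H1_add(2)[OF \<Omega> u v])
  then have ae: "AE x in lebesgue_on \<Omega>. E_op \<Omega> (u + v) x = E_op \<Omega> u x + E_op \<Omega> v x"
    by eventually_elim (simp add: E_op_def vec_eq_iff plus_fun_def algebra_simps)
  have "a_form \<Omega> (u + v) w = (LINT x|lebesgue_on \<Omega>. E_op \<Omega> u x \<bullet> E_op \<Omega> w x + E_op \<Omega> v x \<bullet> E_op \<Omega> w x)"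
    unfolding a_form_def
    by (intro integral_cong_AE m E2 borel_measurable_add X.X_closed u v w)
      (use ae in eventually_elim, simp add: inner_add_left)
  also have "\<dots> = a_form \<Omega> u w + a_form \<Omega> v w"
    unfolding a_form_def by (intro Bochner_Integration.integral_add int E2 u v w)
  finally show "a_form \<Omega> (u + v) w = a_form \<Omega> u w + a_form \<Omega> v w" .
qed

lemma is_weak_deriv_sum:
  fixes f f' :: "'i \<Rightarrow> real ^ 'n::finite \<Rightarrow> 'b::euclidean_space"
  assumes \<Omega>: "open \<Omega>" and "finite I" and "\<And>j. j \<in> I \<Longrightarrow> is_weak_deriv \<Omega> [i] (f j) (f' j)"
  shows "is_weak_deriv \<Omega> [i] (\<lambda>x. \<Sum>j\<in>I. f j x) (\<lambda>x. \<Sum>j\<in>I. f' j x)"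
  using assms(2,3)
proof (induction I rule: finite_induct)
  case empty
  have "locally_integrable \<Omega> (\<lambda>x. 0 :: 'b)" by (simp add: locally_integrable_def set_integrable_def)
  then show ?case by (simp add: is_weak_deriv_def)
next
  case (insert j I)
  then show ?case by (simp add: is_weak_deriv_add[OF \<Omega>])
qed

lemma Linf_component:
  assumes g: "g \<in> Linf_space \<Omega>" and b: "b \<in> Basis"
  shows "(\<lambda>x. g x \<bullet> b) \<in> Linf_space \<Omega>"
proof -
  obtain M where M: "AE x in lebesgue_on \<Omega>. norm (g x) \<le> M" using g by (auto simp: Linf_space_def)
  have "AE x in lebesgue_on \<Omega>. norm (g x \<bullet> b) \<le> M"
    using M by eventually_elim (use Basis_le_norm[OF b] in \<open>auto intro: order_trans\<close>)
  then show ?thesis using g by (auto simp: Linf_space_def)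
qed

lemma is_weak_deriv_inner:
  fixes f g :: "real ^ 'n::finite \<Rightarrow> 'b::euclidean_space"
  assumes \<Omega>: "open \<Omega>"
    and f: "is_weak_deriv \<Omega> [i] f f'" and g: "is_weak_deriv \<Omega> [i] g g'"
    and gB: "g \<in> Linf_space \<Omega>" "g' \<in> Linf_space \<Omega>"
  shows "is_weak_deriv \<Omega> [i] (\<lambda>x. f x \<bullet> g x) (\<lambda>x. f' x \<bullet> g x + f x \<bullet> g' x)"
proof -
  have "is_weak_deriv \<Omega> [i] (\<lambda>x. \<Sum>b\<in>Basis. (f x \<bullet> b) * (g x \<bullet> b))
      (\<lambda>x. \<Sum>b\<in>Basis. (f' x \<bullet> b) * (g x \<bullet> b) + (f x \<bullet> b) * (g' x \<bullet> b))"
  proof (rule is_weak_deriv_sum[OF \<Omega> finite_Basis])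
    fix b :: 'b assume b: "b \<in> Basis"
    have fb: "is_weak_deriv \<Omega> [i] (\<lambda>x. f x \<bullet> b) (\<lambda>x. f' x \<bullet> b)"
      using f b is_weak_deriv_componentwise[OF \<Omega>] by blast
    have gb: "is_weak_deriv \<Omega> [i] (\<lambda>x. g x \<bullet> b) (\<lambda>x. g' x \<bullet> b)"
      using g b is_weak_deriv_componentwise[OF \<Omega>] by blast
    show "is_weak_deriv \<Omega> [i] (\<lambda>x. (f x \<bullet> b) * (g x \<bullet> b)) (\<lambda>x. (f' x \<bullet> b) * (g x \<bullet> b) + (f x \<bullet> b) * (g' x \<bullet> b))"
      by (rule weak_deriv_product[OF \<Omega> fb gb Linf_component[OF gB(1) b] Linf_component[OF gB(2) b]])
  qed
  moreover have "(\<Sum>b\<in>Basis. (f x \<bullet> b) * (g x \<bullet> b)) = f x \<bullet> g x" for x by (rule euclidean_inner[symmetric])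
  moreover have "(\<Sum>b\<in>Basis. (f' x \<bullet> b) * (g x \<bullet> b) + (f x \<bullet> b) * (g' x \<bullet> b)) = f' x \<bullet> g x + f x \<bullet> g' x" for x
    by (simp only: sum.distrib euclidean_inner[symmetric])
  ultimately show ?thesis by (simp only:)
qed

lemma L2_inner_Linf:
  assumes f: "f \<in> L2_space \<Omega>" and g: "g \<in> borel_measurable (lebesgue_on \<Omega>)"
    and M: "AE x in lebesgue_on \<Omega>. norm (g x) \<le> M"
  shows "(\<lambda>x. f x \<bullet> g x) \<in> L2_space \<Omega>"
    and "(LINT x|lebesgue_on \<Omega>. (f x \<bullet> g x)\<^sup>2) \<le> M\<^sup>2 * (LINT x|lebesgue_on \<Omega>. (norm (f x))\<^sup>2)"
proof -
  have fm: "f \<in> borel_measurable (lebesgue_on \<Omega>)" and fi: "integrable (lebesgue_on \<Omega>) (\<lambda>x. (norm (f x))\<^sup>2)"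
    using f by (auto simp: L2_space_def)
  have m: "(\<lambda>x. f x \<bullet> g x) \<in> borel_measurable (lebesgue_on \<Omega>)" using fm g by measurable
  have i: "integrable (lebesgue_on \<Omega>) (\<lambda>x. M\<^sup>2 * (norm (f x))\<^sup>2)" using fi by (rule integrable_mult_right)
  have b: "AE x in lebesgue_on \<Omega>. (f x \<bullet> g x)\<^sup>2 \<le> M\<^sup>2 * (norm (f x))\<^sup>2"
    using M
  proof eventually_elim
    fix x assume "norm (g x) \<le> M"
    then have "\<bar>f x \<bullet> g x\<bar> \<le> norm (f x) * M"
      using Cauchy_Schwarz_ineq2[of "f x" "g x"] mult_left_mono[of "norm (g x)" M "norm (f x)"] by simp
    then have "\<bar>f x \<bullet> g x\<bar>\<^sup>2 \<le> (norm (f x) * M)\<^sup>2" by (rule power_mono) simp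
    then show "(f x \<bullet> g x)\<^sup>2 \<le> M\<^sup>2 * (norm (f x))\<^sup>2" by (simp add: power_mult_distrib mult.commute)
  qed
  have i': "integrable (lebesgue_on \<Omega>) (\<lambda>x. (f x \<bullet> g x)\<^sup>2)"
  proof (rule Bochner_Integration.integrable_bound[OF i])
    show "AE x in lebesgue_on \<Omega>. norm ((f x \<bullet> g x)\<^sup>2) \<le> norm (M\<^sup>2 * (norm (f x))\<^sup>2)"
      using b by eventually_elim simp
  qed (use m in measurable)
  show "(\<lambda>x. f x \<bullet> g x) \<in> L2_space \<Omega>" using m i' by (simp add: L2_space_def)
  have "(LINT x|lebesgue_on \<Omega>. (f x \<bullet> g x)\<^sup>2) \<le> (LINT x|lebesgue_on \<Omega>. M\<^sup>2 * (norm (f x))\<^sup>2)"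
    by (rule integral_mono_AE[OF i' i b])
  then show "(LINT x|lebesgue_on \<Omega>. (f x \<bullet> g x)\<^sup>2) \<le> M\<^sup>2 * (LINT x|lebesgue_on \<Omega>. (norm (f x))\<^sup>2)" by simp
qed

text \<open>
  By the product rule the weak derivatives of \<open>v \<bullet> zh\<close> are \<open>\<partial>\<^sub>i v \<bullet> zh + v \<bullet> \<partial>\<^sub>i zh\<close>, and both
  \<open>zh\<close> and its weak derivatives are bounded almost everywhere.
\<close>

lemma inner_multiplier_bounded:
  fixes zh :: "real ^ 'n::finite \<Rightarrow> 'b::euclidean_space"
  assumes \<Omega>: "open \<Omega>" and zh: "zh \<in> Hinf \<Omega> 1"
  shows "\<exists>C. \<forall>v\<in>H1 \<Omega>. (\<lambda>x. v x \<bullet> zh x) \<in> H1 \<Omega> \<and>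
    h1_inner \<Omega> (\<lambda>x. v x \<bullet> zh x) (\<lambda>x. v x \<bullet> zh x) \<le> C * h1_inner \<Omega> v v"
proof -
  have zhL: "zh \<in> Linf_space \<Omega>" and
    der: "\<forall>\<alpha>. length \<alpha> \<le> 1 \<longrightarrow> (\<exists>g\<in>Linf_space \<Omega>. is_weak_deriv \<Omega> \<alpha> zh g)"
    using zh unfolding Hinf_def sobolev_def by simp_all
  have "\<exists>g. g \<in> Linf_space \<Omega> \<and> is_weak_deriv \<Omega> [i] zh g" for i
    using der[rule_format, of "[i]"] by auto
  then obtain g where g: "\<And>i. g i \<in> Linf_space \<Omega>" "\<And>i. is_weak_deriv \<Omega> [i] zh (g i)" by metis
  obtain M0 where M0: "AE x in lebesgue_on \<Omega>. norm (zh x) \<le> M0" using zhL by (auto simp: Linf_space_def)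
  have "\<forall>i. \<exists>M. AE x in lebesgue_on \<Omega>. norm (g i x) \<le> M" using g(1) by (auto simp: Linf_space_def)
  then obtain M1 where M1: "\<And>i. AE x in lebesgue_on \<Omega>. norm (g i x) \<le> M1 i" by metis
  have zm: "zh \<in> borel_measurable (lebesgue_on \<Omega>)" "\<And>i. g i \<in> borel_measurable (lebesgue_on \<Omega>)"
    using zhL g(1) by (auto simp: Linf_space_def)
  define C where "C = M0\<^sup>2 + (\<Sum>i\<in>UNIV. 2 * M0\<^sup>2 + 2 * (M1 i)\<^sup>2)"
  have "(\<lambda>x. v x \<bullet> zh x) \<in> H1 \<Omega> \<and>
    h1_inner \<Omega> (\<lambda>x. v x \<bullet> zh x) (\<lambda>x. v x \<bullet> zh x) \<le> C * h1_inner \<Omega> v v" if v: "v \<in> H1 \<Omega>" for v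
  proof -
    let ?S = "h1_inner \<Omega> v v"
    define P where "P i x = weak_pd \<Omega> i v x \<bullet> zh x + v x \<bullet> g i x" for i x
    note P1 = L2_inner_Linf[OF H1_weak_pd(2)[OF \<Omega> v] zm(1) M0]
    note P2 = L2_inner_Linf[OF H1_L2[OF \<Omega> v] zm(2) M1]
    note P0 = L2_inner_Linf[OF H1_L2[OF \<Omega> v] zm(1) M0]
    have PL2: "P i \<in> L2_space \<Omega>" for i unfolding P_def[abs_def] by (rule L2_add[OF P1(1) P2(1)])
    have d: "is_weak_deriv \<Omega> [i] (\<lambda>x. v x \<bullet> zh x) (P i)" for i
      unfolding P_def[abs_def] by (rule is_weak_deriv_inner[OF \<Omega> H1_weak_pd(1)[OF \<Omega> v] g(2) zhL g(1)])
    have H: "(\<lambda>x. v x \<bullet> zh x) \<in> H1 \<Omega>" using P0(1) PL2 d by (subst H1_iff[OF \<Omega>]) blast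
    have dbound: "(LINT x|lebesgue_on \<Omega>. weak_pd \<Omega> i (\<lambda>x. v x \<bullet> zh x) x \<bullet> weak_pd \<Omega> i (\<lambda>x. v x \<bullet> zh x) x)
        \<le> (2 * M0\<^sup>2 + 2 * (M1 i)\<^sup>2) * ?S" for i
    proof -
      have i1: "integrable (lebesgue_on \<Omega>) (\<lambda>x. (weak_pd \<Omega> i v x \<bullet> zh x)\<^sup>2)" using P1(1) by (simp add: L2_space_def)
      have i2: "integrable (lebesgue_on \<Omega>) (\<lambda>x. (v x \<bullet> g i x)\<^sup>2)" using P2(1) by (simp add: L2_space_def)
      have "(LINT x|lebesgue_on \<Omega>. weak_pd \<Omega> i (\<lambda>x. v x \<bullet> zh x) x \<bullet> weak_pd \<Omega> i (\<lambda>x. v x \<bullet> zh x) x)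
          \<le> (LINT x|lebesgue_on \<Omega>. 2 * (weak_pd \<Omega> i v x \<bullet> zh x)\<^sup>2 + 2 * (v x \<bullet> g i x)\<^sup>2)"
      proof (rule integral_mono_AE)
        show "integrable (lebesgue_on \<Omega>) (\<lambda>x. weak_pd \<Omega> i (\<lambda>x. v x \<bullet> zh x) x \<bullet> weak_pd \<Omega> i (\<lambda>x. v x \<bullet> zh x) x)"
          by (intro L2_inner_integrable H1_weak_pd(2)[OF \<Omega> H])
        show "integrable (lebesgue_on \<Omega>) (\<lambda>x. 2 * (weak_pd \<Omega> i v x \<bullet> zh x)\<^sup>2 + 2 * (v x \<bullet> g i x)\<^sup>2)"
          by (intro Bochner_Integration.integrable_add integrable_mult_right i1 i2)
        show "AE x in lebesgue_on \<Omega>. weak_pd \<Omega> i (\<lambda>x. v x \<bullet> zh x) x \<bullet> weak_pd \<Omega> i (\<lambda>x. v x \<bullet> zh x) x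
            \<le> 2 * (weak_pd \<Omega> i v x \<bullet> zh x)\<^sup>2 + 2 * (v x \<bullet> g i x)\<^sup>2"
          using weak_pd_AE[OF \<Omega> d[of i]]
        proof eventually_elim
          fix x assume eq: "weak_pd \<Omega> i (\<lambda>x. v x \<bullet> zh x) x = P i x"
          have "(p + q) * (p + q) \<le> 2 * p\<^sup>2 + 2 * q\<^sup>2" for p q :: real
            using sum_squares_bound[of p q] by (simp add: power2_eq_square algebra_simps)
          then show "weak_pd \<Omega> i (\<lambda>x. v x \<bullet> zh x) x \<bullet> weak_pd \<Omega> i (\<lambda>x. v x \<bullet> zh x) x
            \<le> 2 * (weak_pd \<Omega> i v x \<bullet> zh x)\<^sup>2 + 2 * (v x \<bullet> g i x)\<^sup>2"
            unfolding eq by (simp add: P_def)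
        qed
      qed
      also have "\<dots> = 2 * (LINT x|lebesgue_on \<Omega>. (weak_pd \<Omega> i v x \<bullet> zh x)\<^sup>2) + 2 * (LINT x|lebesgue_on \<Omega>. (v x \<bullet> g i x)\<^sup>2)"
        using i1 i2 by simp
      also have "\<dots> \<le> 2 * (M0\<^sup>2 * ?S) + 2 * ((M1 i)\<^sup>2 * ?S)"
        by (intro add_mono mult_left_mono order_trans[OF P1(2)] order_trans[OF P2(2)] L2_norm_le_h1_inner[OF \<Omega> v]) auto
      finally show ?thesis by (simp add: algebra_simps)
    qed
    have "(LINT x|lebesgue_on \<Omega>. (v x \<bullet> zh x) \<bullet> (v x \<bullet> zh x)) \<le> M0\<^sup>2 * (LINT x|lebesgue_on \<Omega>. (norm (v x))\<^sup>2)"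
      using P0(2) by (simp add: power2_eq_square)
    also have "\<dots> \<le> M0\<^sup>2 * ?S" by (intro mult_left_mono L2_norm_le_h1_inner[OF \<Omega> v]) auto
    finally have "h1_inner \<Omega> (\<lambda>x. v x \<bullet> zh x) (\<lambda>x. v x \<bullet> zh x) \<le> M0\<^sup>2 * ?S + (\<Sum>i\<in>UNIV. (2 * M0\<^sup>2 + 2 * (M1 i)\<^sup>2) * ?S)"
      unfolding h1_inner_def[of \<Omega> "\<lambda>x. v x \<bullet> zh x"] by (intro add_mono sum_mono dbound)
    then show ?thesis using H by (simp add: C_def distrib_right sum_distrib_right)
  qed
  then show ?thesis by blast
qed

section \<open>Form norms and projections\<close>

text \<open>
  Boundedness on the unit balls makes the supremum in \<open>form_norm\<close> meaningful. Dividing by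
  \<open>h1_norm p + e\<close> instead of \<open>h1_norm p\<close> and letting \<open>e\<close> tend to zero also covers arguments of norm
  zero, which need not be the zero function.
\<close>

lemma form_norm_bound:
  fixes B :: "(real ^ 'n::finite \<Rightarrow> 'b::euclidean_space) \<Rightarrow> (real ^ 'n \<Rightarrow> 'c::euclidean_space) \<Rightarrow> real"
  assumes \<Omega>: "open \<Omega>"
    and scale: "\<And>p q c. p \<in> H1 \<Omega> \<Longrightarrow> q \<in> H1 \<Omega> \<Longrightarrow> B (c *\<^sub>R p) q = c * B p q"
      "\<And>p q c. p \<in> H1 \<Omega> \<Longrightarrow> q \<in> H1 \<Omega> \<Longrightarrow> B p (c *\<^sub>R q) = c * B p q"
    and bound: "\<And>p q. p \<in> H1 \<Omega> \<Longrightarrow> q \<in> H1 \<Omega> \<Longrightarrow> h1_norm \<Omega> p \<le> 1 \<Longrightarrow> h1_norm \<Omega> q \<le> 1 \<Longrightarrow> \<bar>B p q\<bar> \<le> C"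
  shows "0 \<le> form_norm \<Omega> B"
    and "p \<in> H1 \<Omega> \<Longrightarrow> q \<in> H1 \<Omega> \<Longrightarrow> \<bar>B p q\<bar> \<le> form_norm \<Omega> B * h1_norm \<Omega> p * h1_norm \<Omega> q"
proof -
  interpret X: semi_inner "H1 \<Omega> :: (real ^ 'n \<Rightarrow> 'b) set" "h1_inner \<Omega>" by (rule semi_inner_H1[OF \<Omega>])
  interpret Y: semi_inner "H1 \<Omega> :: (real ^ 'n \<Rightarrow> 'c) set" "h1_inner \<Omega>" by (rule semi_inner_H1[OF \<Omega>])
  have nX: "h1_norm \<Omega> p = X.nrm p" for p by (simp add: h1_norm_def X.nrm_def)
  have nY: "h1_norm \<Omega> q = Y.nrm q" for q by (simp add: h1_norm_def Y.nrm_def)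
  define S where "S = {\<bar>B p q\<bar> | p q. p \<in> H1 \<Omega> \<and> q \<in> H1 \<Omega> \<and> h1_norm \<Omega> p \<le> 1 \<and> h1_norm \<Omega> q \<le> 1}"
  have N: "form_norm \<Omega> B = Sup S" by (simp add: form_norm_def S_def)
  have bdd: "bdd_above S" unfolding S_def bdd_above_def using bound by blast
  have unit: "\<bar>B p q\<bar> \<le> form_norm \<Omega> B"
    if "p \<in> H1 \<Omega>" "q \<in> H1 \<Omega>" "h1_norm \<Omega> p \<le> 1" "h1_norm \<Omega> q \<le> 1" for p q
    unfolding N by (rule cSup_upper[OF _ bdd]) (use that in \<open>unfold S_def, blast\<close>)
  have "X.nrm 0 \<le> 1" "Y.nrm 0 \<le> 1" using X.nrm_scale[of 0 0] Y.nrm_scale[of 0 0] by simp_all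
  then show N0: "0 \<le> form_norm \<Omega> B"
    using unit[of 0 0] nX nY by (intro order_trans[OF abs_ge_zero]) auto
  assume p: "p \<in> H1 \<Omega>" and q: "q \<in> H1 \<Omega>"
  have np: "0 \<le> h1_norm \<Omega> p" and nq: "0 \<le> h1_norm \<Omega> q" using p q by (auto simp: nX nY)
  have eps: "\<bar>B p q\<bar> \<le> form_norm \<Omega> B * (h1_norm \<Omega> p + e) * (h1_norm \<Omega> q + e)" if e: "e > 0" for e
  proof -
    define r s where "r = h1_norm \<Omega> p + e" and "s = h1_norm \<Omega> q + e"
    have rs: "r > 0" "s > 0" using np nq e by (auto simp: r_def s_def)
    have "h1_norm \<Omega> ((1 / r) *\<^sub>R p) \<le> 1" "h1_norm \<Omega> ((1 / s) *\<^sub>R q) \<le> 1"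
      using p q rs e by (auto simp: nX nY X.nrm_scale Y.nrm_scale r_def s_def field_simps)
    then have "\<bar>B ((1 / r) *\<^sub>R p) ((1 / s) *\<^sub>R q)\<bar> \<le> form_norm \<Omega> B"
      by (intro unit X.X_closed Y.X_closed p q)
    moreover have "B ((1 / r) *\<^sub>R p) ((1 / s) *\<^sub>R q) = (1 / r) * ((1 / s) * B p q)"
      using scale(1)[OF p Y.X_closed(4)[OF q]] scale(2)[OF p q] by simp
    ultimately have "\<bar>B p q\<bar> / (r * s) \<le> form_norm \<Omega> B" using rs by (simp add: abs_mult)
    then have "\<bar>B p q\<bar> \<le> form_norm \<Omega> B * (r * s)" using rs by (simp add: pos_divide_le_eq)
    then show ?thesis by (simp add: r_def s_def mult.assoc)
  qed
  have "((\<lambda>e. form_norm \<Omega> B * (h1_norm \<Omega> p + e) * (h1_norm \<Omega> q + e)) \<longlongrightarrow>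
      form_norm \<Omega> B * (h1_norm \<Omega> p + 0) * (h1_norm \<Omega> q + 0)) (at_right 0)"
    by (intro tendsto_intros)
  then have "\<bar>B p q\<bar> \<le> form_norm \<Omega> B * (h1_norm \<Omega> p + 0) * (h1_norm \<Omega> q + 0)"
  proof (rule tendsto_lowerbound)
    show "\<forall>\<^sub>F e in at_right 0. \<bar>B p q\<bar> \<le> form_norm \<Omega> B * (h1_norm \<Omega> p + e) * (h1_norm \<Omega> q + e)"
      using eps by (auto simp: eventually_at_right_field intro: exI[of _ 1])
  qed simp
  then show "\<bar>B p q\<bar> \<le> form_norm \<Omega> B * h1_norm \<Omega> p * h1_norm \<Omega> q" by simp
qed

lemma h1_proj_properties:
  fixes u :: "real ^ 'n::finite \<Rightarrow> 'b::euclidean_space"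
  assumes \<Omega>: "open \<Omega>" and K: "subspace K" "K \<subseteq> H1 \<Omega>" "finite_dim_mod (ae_zero \<Omega>) K" "ae_zero \<Omega> \<subseteq> K"
    and u: "u \<in> H1 \<Omega>"
  shows "h1_proj \<Omega> K u \<in> K" and "\<And>k. k \<in> K \<Longrightarrow> h1_inner \<Omega> (u - h1_proj \<Omega> K u) k = 0"
proof -
  interpret X: semi_inner "H1 \<Omega> :: (real ^ 'n \<Rightarrow> 'b) set" "h1_inner \<Omega>" by (rule semi_inner_H1[OF \<Omega>])
  have "\<exists>w\<in>K. \<forall>k\<in>K. h1_inner \<Omega> (u - w) k = 0"
    by (rule X.projection_exists[OF K(1-4) _ u]) (rule h1_inner_ae_zero[OF \<Omega>])
  then have "\<exists>w. w \<in> K \<and> (\<forall>k\<in>K. h1_inner \<Omega> (\<lambda>x. u x - w x) k = 0)"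
    unfolding fun_diff_def by blast
  from someI_ex[OF this] have "h1_proj \<Omega> K u \<in> K \<and> (\<forall>k\<in>K. h1_inner \<Omega> (\<lambda>x. u x - h1_proj \<Omega> K u x) k = 0)"
    unfolding h1_proj_def .
  then show "h1_proj \<Omega> K u \<in> K" "\<And>k. k \<in> K \<Longrightarrow> h1_inner \<Omega> (u - h1_proj \<Omega> K u) k = 0"
    unfolding fun_diff_def by blast+
qed

section \<open>The error estimate\<close>

theorem theorem5p7:
  fixes \<Omega> :: "(real ^ 'n::finite) set"
    and z :: "real ^ 'n \<Rightarrow> real"
    and zh :: "real ^ 'n \<Rightarrow> real ^ 'n"
    and zz :: "real ^ 'n \<Rightarrow> real ^ 'n"
    and k :: nat
    and H :: "real set"
    and T :: "real \<Rightarrow> (real ^ 'n) set set"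
    and h \<gamma> \<beta> c\<^sub>1 c\<^sub>2 :: real
    and u uh :: "real ^ 'n \<Rightarrow> real ^ 'n"
    and lam lamh :: "real ^ 'n \<Rightarrow> real"
  assumes "CARD('n) \<in> {2, 3}"
    and "polyhedral_lipschitz_domain \<Omega>"
    and "k \<ge> 1"
    and "z \<in> Hinf \<Omega> 1"
    and "zh \<in> Hinf \<Omega> 1"
    and "AE x in lebesgue_on \<Omega>. norm (zh x) = 1"
    and "zh \<in> Hinf \<Omega> (k + 1)"
    and "zz = (\<lambda>x. z x *\<^sub>R zh x)"
    and "shape_regular_family \<Omega> H T"
    and "h \<in> H"
    and "Kzh \<Omega> zh k (T h) = Kz \<Omega> zh"
    and "\<gamma> > 0" and "coercive_h \<Omega> zh k (T h) \<gamma>"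
    and "\<beta> > 0" and "inf_sup_h \<Omega> zh k (T h) \<beta>"
    and "solves_P \<Omega> zh zz u lam"
    and "solves_Ph \<Omega> zh zz k (T h) uh lamh"
    and "c\<^sub>1 = (1 + 1 / \<gamma> * form_norm \<Omega> (a_form \<Omega>)) *
               (1 + 1 / \<beta> * form_norm \<Omega> (b_form \<Omega> zh))"
    and "c\<^sub>2 = 1 / \<gamma> * form_norm \<Omega> (b_form \<Omega> zh)"
  shows "\<exists>v \<mu>.
    is_arg_min (\<lambda>v. h1_norm \<Omega> (\<lambda>x. u x - v x)) (\<lambda>v. v \<in> VVh \<Omega> k (T h)) v \<and>
    is_arg_min (\<lambda>\<mu>. h1_norm \<Omega> (\<lambda>x. lam x - \<mu> x)) (\<lambda>\<mu>. \<mu> \<in> Vh \<Omega> k (T h)) \<mu> \<and>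
    h1_norm \<Omega> (\<lambda>x. u x - uh x) \<le>
      c\<^sub>1 * h1_norm \<Omega> (\<lambda>x. u x - v x) + c\<^sub>2 * h1_norm \<Omega> (\<lambda>x. lam x - \<mu> x)"
proof -
  note poly = assms(2) and zh = assms(5) and shape = assms(9,10) and KK = assms(11)
    and gamma = assms(12,13) and beta = assms(14,15) and P = assms(16) and Ph = assms(17)
    and c12 = assms(18,19)
  have \<Omega>: "open \<Omega>" "bounded \<Omega>" using poly by (simp_all add: polyhedral_lipschitz_domain_def)
  have tri: "triangulation_of \<Omega> (T h)" using shape by (simp add: shape_regular_family_def)
  interpret triangulated_domain \<Omega> "T h" k by unfold_locales (fact \<Omega> tri)+
  interpret X: semi_inner "H1 \<Omega> :: (real ^ 'n \<Rightarrow> real ^ 'n) set" "h1_inner \<Omega>" by (rule semi_inner_H1[OF \<Omega>(1)])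
  interpret Y: semi_inner "H1 \<Omega> :: (real ^ 'n \<Rightarrow> real) set" "h1_inner \<Omega>" by (rule semi_inner_H1[OF \<Omega>(1)])
  interpret A: semi_inner "H1 \<Omega>" "a_form \<Omega>" by (rule semi_inner_a_form[OF \<Omega>(1)])
  have nX: "h1_norm \<Omega> v = X.nrm v" for v by (simp add: h1_norm_def X.nrm_def)
  have nY: "h1_norm \<Omega> q = Y.nrm q" for q by (simp add: h1_norm_def Y.nrm_def)
  let ?V = "VVh \<Omega> k (T h)" and ?M = "Vh \<Omega> k (T h)" and ?K = "Kzh \<Omega> zh k (T h)" and ?W = "VVh_star \<Omega> zh k (T h)"
  let ?N = "ae_zero \<Omega>"
  let ?a = "a_form \<Omega>" and ?b = "b_form \<Omega> zh"

  have a_nrm: "A.nrm v \<le> 2 * X.nrm v" if v: "v \<in> H1 \<Omega>" for v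
  proof -
    have "A.nrm v \<le> sqrt (4 * h1_inner \<Omega> v v)"
      unfolding A.nrm_def using L2_E_op(2)[OF \<Omega>(1) v] by simp
    then show ?thesis by (simp add: X.nrm_def real_sqrt_mult)
  qed
  have a_unit: "\<bar>?a v w\<bar> \<le> 4" if v: "v \<in> H1 \<Omega>" and w: "w \<in> H1 \<Omega>" and n: "h1_norm \<Omega> v \<le> 1" "h1_norm \<Omega> w \<le> 1" for v w
  proof -
    have "\<bar>?a v w\<bar> \<le> A.nrm v * A.nrm w" by (rule A.cauchy_schwarz[OF v w])
    also have "\<dots> \<le> 2 * 2"
      using a_nrm[OF v] a_nrm[OF w] n A.nrm_nonneg[OF v] A.nrm_nonneg[OF w] by (intro mult_mono) (auto simp: nX)
    finally show ?thesis by simp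
  qed
  have a_norm: "0 \<le> form_norm \<Omega> ?a"
    "\<bar>?a v w\<bar> \<le> form_norm \<Omega> ?a * h1_norm \<Omega> v * h1_norm \<Omega> w" if "v \<in> H1 \<Omega>" "w \<in> H1 \<Omega>" for v w
    by (rule form_norm_bound[where B = ?a and C = 4, OF \<Omega>(1)];
        (rule A.s_scale A.s_scale_right a_unit that; assumption)?)+
  obtain C where C: "\<forall>v\<in>H1 \<Omega>. (\<lambda>x. v x \<bullet> zh x) \<in> H1 \<Omega> \<and>
    h1_inner \<Omega> (\<lambda>x. v x \<bullet> zh x) (\<lambda>x. v x \<bullet> zh x) \<le> C * h1_inner \<Omega> v v"
    using inner_multiplier_bounded[OF \<Omega>(1) zh] by (elim exE)
  \<comment> \<open>Multiplication by \<open>zh\<close>; with it \<open>b\<close> is the \<open>H\<^sup>1\<close> inner product of \<open>q\<close> and \<open>J v\<close>.\<close>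
  define J where "J v = (\<lambda>x. v x \<bullet> zh x)" for v :: "real ^ 'n \<Rightarrow> real ^ 'n"
  have J: "J v \<in> H1 \<Omega>" "h1_inner \<Omega> (J v) (J v) \<le> C * h1_inner \<Omega> v v" if "v \<in> H1 \<Omega>" for v
    using C that by (simp_all add: J_def)
  have J_add: "J (v + w) = J v + J w" for v w by (simp add: J_def fun_eq_iff inner_add_left)
  have J_scale: "J (c *\<^sub>R v) = c *\<^sub>R J v" for c v by (simp add: J_def fun_eq_iff)
  have b_J: "?b q v = h1_inner \<Omega> q (J v)" for q v by (simp add: b_form_def J_def)
  have b_unit: "\<bar>?b q v\<bar> \<le> sqrt \<bar>C\<bar>" if q: "q \<in> H1 \<Omega>" and v: "v \<in> H1 \<Omega>" and n: "h1_norm \<Omega> q \<le> 1" "h1_norm \<Omega> v \<le> 1" for q v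
  proof -
    have "\<bar>?b q v\<bar> \<le> Y.nrm q * Y.nrm (J v)" unfolding b_J by (rule Y.cauchy_schwarz[OF q J(1)[OF v]])
    also have "\<dots> \<le> 1 * sqrt \<bar>C\<bar>"
    proof (rule mult_mono)
      have "h1_inner \<Omega> v v \<le> 1" using n(2) X.nrm_sq[OF v] X.nrm_nonneg[OF v] by (simp add: nX power_le_one flip: X.nrm_sq[OF v])
      then have "C * h1_inner \<Omega> v v \<le> \<bar>C\<bar> * 1"
        using X.s_nonneg[OF v] by (intro mult_mono) auto
      then show "Y.nrm (J v) \<le> sqrt \<bar>C\<bar>" unfolding Y.nrm_def using J(2)[OF v] by simp
    qed (use n q v J Y.nrm_nonneg in \<open>auto simp: nY\<close>)
    finally show ?thesis by simp
  qed
  have b_scale: "?b (c *\<^sub>R q) v = c * ?b q v" "?b q (c *\<^sub>R v) = c * ?b q v" if "q \<in> H1 \<Omega>" "v \<in> H1 \<Omega>" for c q v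
    using that J by (simp_all add: b_J J_scale Y.s_scale Y.s_scale_right)
  have b_norm: "0 \<le> form_norm \<Omega> ?b"
    "\<bar>?b q v\<bar> \<le> form_norm \<Omega> ?b * h1_norm \<Omega> q * h1_norm \<Omega> v" if "q \<in> H1 \<Omega>" "v \<in> H1 \<Omega>" for q v
    by (rule form_norm_bound[where B = ?b and C = "sqrt \<bar>C\<bar>", OF \<Omega>(1)];
        (rule b_scale b_unit that; assumption)?)+

  interpret S: saddle_point_forms "H1 \<Omega>" "h1_inner \<Omega>" "H1 \<Omega>" "h1_inner \<Omega>" ?a ?b "form_norm \<Omega> ?a" "form_norm \<Omega> ?b"
  proof
    show "?a (x + y) z = ?a x z + ?a y z" if "x \<in> H1 \<Omega>" "y \<in> H1 \<Omega>" "z \<in> H1 \<Omega>" for x y z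
      by (rule A.s_add[OF that])
    show "?a (c *\<^sub>R x) z = c * ?a x z" if "x \<in> H1 \<Omega>" "z \<in> H1 \<Omega>" for c x z
      by (rule A.s_scale[OF that])
    show "?b (p + q) x = ?b p x + ?b q x" if "p \<in> H1 \<Omega>" "q \<in> H1 \<Omega>" "x \<in> H1 \<Omega>" for p q x
      unfolding b_J using that J by (intro Y.s_add)
    show "?b (c *\<^sub>R p) x = c * ?b p x" if "p \<in> H1 \<Omega>" "x \<in> H1 \<Omega>" for c p x
      using that by (rule b_scale)
    show "?b p (x + y) = ?b p x + ?b p y" if "p \<in> H1 \<Omega>" "x \<in> H1 \<Omega>" "y \<in> H1 \<Omega>" for p x y
      unfolding b_J J_add using that J by (intro Y.s_add_right)
    show "?b p (c *\<^sub>R x) = c * ?b p x" if "p \<in> H1 \<Omega>" "x \<in> H1 \<Omega>" for c p x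
      using that by (rule b_scale)
    show "\<bar>?a x y\<bar> \<le> form_norm \<Omega> ?a * X.nrm x * X.nrm y" if "x \<in> H1 \<Omega>" "y \<in> H1 \<Omega>" for x y
      using a_norm(2)[OF that] by (simp add: nX)
    show "\<bar>?b p x\<bar> \<le> form_norm \<Omega> ?b * Y.nrm p * X.nrm x" if "p \<in> H1 \<Omega>" "x \<in> H1 \<Omega>" for p x
      using b_norm(2)[OF that] by (simp add: nX nY)
    show "0 \<le> form_norm \<Omega> ?a" by (rule a_norm(1)[OF X.X_closed(1) X.X_closed(1)])
    show "0 \<le> form_norm \<Omega> ?b" by (rule b_norm(1)[OF Y.X_closed(1) X.X_closed(1)])
  qed

  have NX: "h1_inner \<Omega> n n = 0" if "n \<in> ?N" for n :: "real ^ 'n \<Rightarrow> real ^ 'n" by (rule h1_inner_ae_zero[OF \<Omega>(1) that])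
  have NY: "h1_inner \<Omega> n n = 0" if "n \<in> ?N" for n :: "real ^ 'n \<Rightarrow> real" by (rule h1_inner_ae_zero[OF \<Omega>(1) that])
  have VX: "v \<in> H1 \<Omega>" if "v \<in> ?V" for v using VVh_H1 that by (rule subsetD)
  have MY: "p \<in> H1 \<Omega>" if "p \<in> ?M" for p using Vh_H1 that by (rule subsetD)

  have K_iff: "v \<in> ?K \<longleftrightarrow> v \<in> ?V \<and> (\<forall>p\<in>?M. ?b p v = 0) \<and> ?a v v = 0" for v
    using VX by (auto simp: Kzh_def ker_bh_def rigid_def)
  have KV: "?K \<subseteq> ?V" using K_iff by blast
  have K_b: "?b p v = 0" if "v \<in> ?K" "p \<in> ?M" for v p using that K_iff by blast
  have K_a: "?a v w = 0" if v: "v \<in> ?K" and w: "w \<in> H1 \<Omega>" for v w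
  proof -
    have "\<bar>?a v w\<bar> \<le> A.nrm v * A.nrm w" using v w KV VX by (intro A.cauchy_schwarz) auto
    moreover have "A.nrm v = 0" using v K_iff by (simp add: A.nrm_def)
    ultimately show ?thesis by simp
  qed
  have NK: "?N \<subseteq> ?K"
  proof
    fix n :: "real ^ 'n \<Rightarrow> real ^ 'n" assume n: "n \<in> ?N"
    have nV: "n \<in> ?V" using ae_zero_subset_VVh n by (rule subsetD)
    have n0: "X.nrm n = 0" using NX[OF n] by (simp add: X.nrm_def)
    have "?b p n = 0" if "p \<in> ?M" for p
      using S.b_bound[OF MY[OF that] VX[OF nV]] n0 by simp
    moreover have "?a n n = 0" using S.a_bound[OF VX[OF nV] VX[OF nV]] n0 by simp
    ultimately show "n \<in> ?K" using nV K_iff by blast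
  qed
  have subK: "subspace ?K"
  proof (rule subspaceI)
    show "0 \<in> ?K" by (rule subsetD[OF NK]) (simp add: ae_zero_def)
    show "v + w \<in> ?K" if vw: "v \<in> ?K" "w \<in> ?K" for v w
    proof -
      have V: "v \<in> ?V" "w \<in> ?V" using vw KV by auto
      have "?a (v + w) (v + w) = 0"
        using A.s_add[OF VX[OF V(1)] VX[OF V(2)]] K_a[OF vw(1)] K_a[OF vw(2)] VX V by simp
      moreover have "?b p (v + w) = 0" if "p \<in> ?M" for p
        using S.b_add_right[OF MY[OF that] VX[OF V(1)] VX[OF V(2)]] K_b[OF vw(1) that] K_b[OF vw(2) that] by simp
      ultimately show ?thesis using subspace_add[OF subspace_VVh V] K_iff by blast
    qed
    show "c *\<^sub>R v \<in> ?K" if v: "v \<in> ?K" for c v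
    proof -
      have V: "v \<in> ?V" using v KV by auto
      have "?a (c *\<^sub>R v) (c *\<^sub>R v) = 0"
        using A.s_scale[OF VX[OF V]] K_a[OF v] VX[OF V] by simp
      moreover have "?b p (c *\<^sub>R v) = 0" if "p \<in> ?M" for p
        using S.b_scale_right[OF MY[OF that] VX[OF V]] K_b[OF v that] by simp
      ultimately show ?thesis using subspace_scale[OF subspace_VVh V] K_iff by blast
    qed
  qed
  have KX: "?K \<subseteq> H1 \<Omega>" using KV VVh_H1 by (rule order_trans)
  have finK: "finite_dim_mod ?N ?K" by (rule finite_dim_mod_subset[OF finite_dim_VVh KV])
  note proj = h1_proj_properties[OF \<Omega>(1) subK KX finK NK]
  have null_orth: "h1_inner \<Omega> n w = 0" if "n \<in> ?N" "n \<in> H1 \<Omega>" "w \<in> H1 \<Omega>" for n w :: "real ^ 'n \<Rightarrow> real ^ 'n"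
    using X.cauchy_schwarz[OF that(2,3)] NX[OF that(1)] by (simp add: X.nrm_def)
  \<comment> \<open>A function and its projection have the same inner products with the kernel.\<close>
  have W_eq: "?W = {v \<in> ?V. \<forall>w\<in>?K. h1_inner \<Omega> v w = 0}"
  proof -
    have "h1_proj \<Omega> ?K v \<in> ?N \<longleftrightarrow> (\<forall>w\<in>?K. h1_inner \<Omega> v w = 0)" if v: "v \<in> ?V" for v
    proof -
      let ?p = "h1_proj \<Omega> ?K v"
      have pK: "?p \<in> ?K" by (rule proj(1)[OF VX[OF v]])
      have pX: "?p \<in> H1 \<Omega>" using pK KX by auto
      have eq: "h1_inner \<Omega> v w = h1_inner \<Omega> ?p w" if w: "w \<in> ?K" for w
        using proj(2)[OF VX[OF v] w] X.s_diff[OF VX[OF v] pX, of w] w KX by auto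
      show ?thesis
      proof
        assume "?p \<in> ?N"
        then show "\<forall>w\<in>?K. h1_inner \<Omega> v w = 0" using eq null_orth[OF _ pX] KX by auto
      next
        assume "\<forall>w\<in>?K. h1_inner \<Omega> v w = 0"
        then have "h1_inner \<Omega> ?p ?p = 0" using eq[OF pK] pK by simp
        then show "?p \<in> ?N" by (rule h1_inner_eq_0_imp[OF \<Omega>(1) pX])
      qed
    qed
    then show ?thesis unfolding VVh_star_def ae_zero_def by auto
  qed

  have coercive: "\<gamma> * (X.nrm v)\<^sup>2 \<le> ?a v v" if "v \<in> ?W" "\<And>p. p \<in> ?M \<Longrightarrow> ?b p v = 0" for v
    using gamma(2) that by (auto simp: coercive_h_def ker_bh_def VVh_star_def nX)
  have inf_sup: "\<beta> * Y.nrm p \<le> D" if p: "p \<in> ?M" and D: "0 \<le> D" and bound: "\<And>v. v \<in> ?W \<Longrightarrow> ?b p v \<le> D * X.nrm v" for p D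
  proof -
    have "\<beta> * Y.nrm p \<le> (SUP v \<in> ?W. ?b p v / h1_norm \<Omega> v)"
      using beta(2) p by (simp add: inf_sup_h_def nY)
    also have "\<dots> \<le> D"
    proof (rule cSUP_least)
      have "(0 :: real ^ 'n \<Rightarrow> real ^ 'n) \<in> ?N" by (simp add: ae_zero_def)
      then have "(0 :: real ^ 'n \<Rightarrow> real ^ 'n) \<in> ?W"
        unfolding W_eq using null_orth[of 0] KX NK KV by (auto simp: subset_iff)
      then show "?W \<noteq> {}" by blast
      show "?b p v / h1_norm \<Omega> v \<le> D" if v: "v \<in> ?W" for v
      proof (cases "X.nrm v = 0")
        case True
        then show ?thesis using D by (simp add: nX)
      next
        case False
        then have "X.nrm v > 0" using X.nrm_nonneg[of v] v VX by (auto simp: VVh_star_def less_le)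
        then show ?thesis using bound[OF v] by (simp add: nX pos_divide_le_eq)
      qed
    qed
    finally show ?thesis .
  qed

  \<comment> \<open>Equality of the two kernels makes the normalisation of \<open>u\<close> one with respect to the discrete kernel.\<close>
  have u: "u \<in> H1 \<Omega>" and l: "lam \<in> H1 \<Omega>"
    and u_proj: "AE x in lebesgue_on \<Omega>. h1_proj \<Omega> ?K u x = h1_proj \<Omega> ?K zz x"
    and u_eq: "\<And>v. v \<in> H1 \<Omega> \<Longrightarrow> ?a u v + ?b lam v = 0" and u_con: "\<And>q. q \<in> H1 \<Omega> \<Longrightarrow> ?b q u = ?b q zz"
    using P KK by (auto simp: solves_P_def)
  have uh: "uh \<in> ?V" and lh: "lamh \<in> ?M"
    and uh_proj: "AE x in lebesgue_on \<Omega>. h1_proj \<Omega> ?K uh x = h1_proj \<Omega> ?K zz x"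
    and uh_eq: "\<And>v. v \<in> ?V \<Longrightarrow> ?a uh v + ?b lamh v = 0" and uh_con: "\<And>q. q \<in> ?M \<Longrightarrow> ?b q uh = ?b q zz"
    using Ph by (auto simp: solves_Ph_def)
  \<comment> \<open>Both projections agree with the projection of \<open>zz\<close> up to null sets, so their difference is a null function.\<close>
  have u_K: "h1_inner \<Omega> (u - uh) w = 0" if w: "w \<in> ?K" for w
  proof -
    let ?p = "h1_proj \<Omega> ?K u" and ?q = "h1_proj \<Omega> ?K uh"
    have pq: "?p \<in> H1 \<Omega>" "?q \<in> H1 \<Omega>" and wX: "w \<in> H1 \<Omega>"
      using proj(1)[OF u] proj(1)[OF VX[OF uh]] w KX by auto
    have "AE x in lebesgue_on \<Omega>. (?p - ?q) x = 0" using u_proj uh_proj by eventually_elim simp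
    then have "h1_inner \<Omega> (?p - ?q) w = 0" using pq wX by (intro null_orth) (auto simp: ae_zero_def)
    then show ?thesis
      using proj(2)[OF u w] proj(2)[OF VX[OF uh] w] pq wX u VX[OF uh] by (simp add: X.s_diff)
  qed
  have u_b: "?b q u = ?b q uh" if "q \<in> ?M" for q using u_con[OF MY[OF that]] uh_con[OF that] by simp

  obtain v where v: "v \<in> ?V" "\<forall>w\<in>?V. X.nrm (u - v) \<le> X.nrm (u - w)"
    using X.best_approximation_exists[OF subspace_VVh VVh_H1 finite_dim_VVh ae_zero_subset_VVh NX u] by blast
  obtain m where m: "m \<in> ?M" "\<forall>q\<in>?M. Y.nrm (lam - m) \<le> Y.nrm (lam - q)"
    using Y.best_approximation_exists[OF subspace_Vh Vh_H1 finite_dim_Vh ae_zero_subset_Vh NY l] by blast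
  have est: "X.nrm (u - uh) \<le> (1 + 1 / \<gamma> * form_norm \<Omega> ?a) * (1 + 1 / \<beta> * form_norm \<Omega> ?b) * X.nrm (u - v)
      + 1 / \<gamma> * form_norm \<Omega> ?b * Y.nrm (lam - m)"
    by (rule S.quasi_optimality[OF subspace_VVh VVh_H1 finite_dim_VVh subspace_Vh Vh_H1 finite_dim_Vh
          subK KV K_b K_a NK NX ae_zero_subset_Vh NY W_eq gamma(1) coercive beta(1) inf_sup u uh l lh u_K u_b
          u_eq[OF VX] uh_eq v(1) m(1)])
  show ?thesis
    unfolding nX nY is_arg_min_linorder c12
    using v m est unfolding fun_diff_def by (intro exI[of _ v] exI[of _ m] conjI) simp_all
qed

end
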